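(* Let $d,n,m$ be positive integers. For any $P_1,\ldots,P_m,Q \in M_n(\mathbb{H}_c[x_1,\ldots,x_d])$ the following are equivalent: (1) For every $a \in \mathbb{R}^d$ and every (column vector) $\mathbf{v} \in \mathbb{H}^n$ such that $P_1(a)\mathbf{v}=\ldots=P_m(a)\mathbf{v}=0$, we have $Q(a)\mathbf{v}=0$. (2) $Q$ belongs to the smallest real left ideal of $M_n(\mathbb{H}_c[x_1,\ldots,x_d])$ that contains $P_1,\ldots,P_m$.
   Context: $\mathbb{H}$ denotes the real quaternions. $\mathbb{H}_c[x_1,\ldots,x_d]:=\mathbb{H}\otimes_{\mathbb{R}}\mathbb{R}[x_1,\ldots,x_d]$ is the ring of quaternionic polynomials whose variables commute with each other and with the elements of $\mathbb{H}$; its elements are regarded as polynomial functions $\mathbb{R}^d\to\mathbb{H}$. Its involution is determined by $x_i^\ast=x_i$ for all $i$ and $c^\ast=\bar c$ for all $c\in\mathbb{H}$. For a ring with involution $A$, the ring $M_n(A)$ carries the conjugated transpose involution $[a_{i,j}]^\ast=[a_{j,i}^\ast]$. A left ideal $I$ of a ring with involution $B$ is called real if for every $k$ and all $b_1,\ldots,b_k \in B$ such that $b_1^\ast b_1+\ldots+b_k^\ast b_k \in I$ we have $b_1,\ldots,b_k \in I$. An intersection of real left ideals is a real left ideal, so every subset of $B$ is contained in a smallest real left ideal. *)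

theory Defs
  imports "HOL-Analysis.Analysis" "HOL-Algebra.Ideal" "HOL-Library.Poly_Mapping"
begin

section \<open>Rings with involution and real left ideals\<close>

locale ring_with_involution = ring R for R (structure) +
  fixes star :: "'a \<Rightarrow> 'a"
  assumes star_closed: "a \<in> carrier R \<Longrightarrow> star a \<in> carrier R"
    and star_add: "a \<in> carrier R \<Longrightarrow> b \<in> carrier R \<Longrightarrow> star (a \<oplus> b) = star a \<oplus> star b"
    and star_mult: "a \<in> carrier R \<Longrightarrow> b \<in> carrier R \<Longrightarrow> star (a \<otimes> b) = star b \<otimes> star a"
    and star_star: "a \<in> carrier R \<Longrightarrow> star (star a) = a"

definition left_ideal :: "('a, 'm) ring_scheme \<Rightarrow> 'a set \<Rightarrow> bool" where
  "left_ideal R I \<longleftrightarrow>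
     additive_subgroup I R \<and> (\<forall>r\<in>carrier R. \<forall>a\<in>I. r \<otimes>\<^bsub>R\<^esub> a \<in> I)"

definition real_left_ideal :: "('a, 'm) ring_scheme \<Rightarrow> ('a \<Rightarrow> 'a) \<Rightarrow> 'a set \<Rightarrow> bool" where
  "real_left_ideal R star I \<longleftrightarrow>
     left_ideal R I \<and>
     (\<forall>(k::nat) b. (\<forall>i\<in>{1..k}. b i \<in> carrier R) \<longrightarrow>
        (\<Oplus>\<^bsub>R\<^esub>i\<in>{1..k}. star (b i) \<otimes>\<^bsub>R\<^esub> b i) \<in> I \<longrightarrow> (\<forall>i\<in>{1..k}. b i \<in> I))"

definition smallest_real_left_ideal ::
    "('a, 'm) ring_scheme \<Rightarrow> ('a \<Rightarrow> 'a) \<Rightarrow> 'a set \<Rightarrow> 'a set" where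
  "smallest_real_left_ideal R star S = \<Inter> {I. real_left_ideal R star I \<and> S \<subseteq> I}"

lemma (in ring_with_involution) real_left_ideal_carrier:
  "real_left_ideal R star (carrier R)"
  unfolding real_left_ideal_def left_ideal_def
  by (auto intro!: additive_subgroup.intro simp: add.subgroup_self)

lemma (in ring_with_involution) real_left_ideal_smallest:
  assumes "S \<subseteq> carrier R"
  shows "real_left_ideal R star (smallest_real_left_ideal R star S)"
    and "S \<subseteq> smallest_real_left_ideal R star S"
    and "real_left_ideal R star I \<Longrightarrow> S \<subseteq> I \<Longrightarrow> smallest_real_left_ideal R star S \<subseteq> I"
proof -
  let ?F = "{I. real_left_ideal R star I \<and> S \<subseteq> I}"
  have "carrier R \<in> ?F"
    using assms real_left_ideal_carrier by simp
  moreover have "subgroup I (add_monoid R)" if "I \<in> ?F" for I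
    using that unfolding real_left_ideal_def left_ideal_def
    by (auto dest: additive_subgroup.a_subgroup)
  ultimately have "additive_subgroup (\<Inter>?F) R"
    by (intro additive_subgroup.intro add.subgroups_Inter) auto
  then show "real_left_ideal R star (smallest_real_left_ideal R star S)"
    unfolding smallest_real_left_ideal_def real_left_ideal_def left_ideal_def by blast
qed (auto simp: smallest_real_left_ideal_def)


section \<open>Matrix rings with the conjugated transpose\<close>

text \<open>
  On the type of square matrices the overloaded product is componentwise, so the
  matrix ring is set up as a record.
\<close>

definition matrix_ring :: "('a::ring_1 ^ 'n ^ 'n) ring" where
  "matrix_ring = \<lparr>carrier = UNIV, mult = (**), one = mat 1, zero = 0, add = (+)\<rparr>"

definition conj_transpose :: "('a \<Rightarrow> 'a) \<Rightarrow> 'a ^ 'n ^ 'm \<Rightarrow> 'a ^ 'm ^ 'n" where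
  "conj_transpose star A = (\<chi> i j. star (A $ j $ i))"

lemma ring_matrix_ring: "ring (matrix_ring :: ('a::ring_1 ^ 'n ^ 'n) ring)"
proof (rule ringI)
  show "abelian_group (matrix_ring :: ('a ^ 'n ^ 'n) ring)"
  proof (rule abelian_groupI)
    fix A :: "'a ^ 'n ^ 'n"
    show "\<exists>B\<in>carrier matrix_ring. B \<oplus>\<^bsub>matrix_ring\<^esub> A = \<zero>\<^bsub>matrix_ring\<^esub>"
      by (intro bexI[of _ "- A"]) (simp_all add: matrix_ring_def)
  qed (simp_all add: matrix_ring_def ac_simps)
  show "Group.monoid (matrix_ring :: ('a ^ 'n ^ 'n) ring)"
    by (rule Group.monoidI) (simp_all add: matrix_ring_def matrix_mul_assoc)
qed (simp_all add: matrix_ring_def matrix_matrix_mult_def vec_eq_iff ring_distribs sum.distrib)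

lemma matrix_ring_with_involution:
  fixes star :: "'a::ring_1 \<Rightarrow> 'a"
  assumes add: "\<And>a b. star (a + b) = star a + star b"
    and mult: "\<And>a b. star (a * b) = star b * star a"
    and invol: "\<And>a. star (star a) = a"
  shows "ring_with_involution (matrix_ring :: ('a ^ 'n ^ 'n) ring) (conj_transpose star)"
proof -
  have "star 0 = 0"
    using add[of 0 0] by simp
  then have sum: "star (sum f S) = (\<Sum>i\<in>S. star (f i))" for f :: "'n \<Rightarrow> 'a" and S
    by (induction S rule: infinite_finite_induct) (simp_all add: add)
  show ?thesis
    by (intro ring_with_involution.intro ring_matrix_ring ring_with_involution_axioms.intro)
      (simp_all add: matrix_ring_def conj_transpose_def matrix_matrix_mult_def vec_eq_iff
        add mult invol sum)
qed


section \<open>Quaternions\<close>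

datatype quat = Quat (qRe: real) (qI: real) (qJ: real) (qK: real)

instantiation quat :: real_algebra_1
begin

definition "0 = Quat 0 0 0 0"
definition "1 = Quat 1 0 0 0"
definition "x + y = Quat (qRe x + qRe y) (qI x + qI y) (qJ x + qJ y) (qK x + qK y)"
definition "- x = Quat (- qRe x) (- qI x) (- qJ x) (- qK x)"
definition "x - y = Quat (qRe x - qRe y) (qI x - qI y) (qJ x - qJ y) (qK x - qK y)"
definition "r *\<^sub>R x = Quat (r * qRe x) (r * qI x) (r * qJ x) (r * qK x)"
definition "x * y = Quat
  (qRe x * qRe y - qI x * qI y - qJ x * qJ y - qK x * qK y)
  (qRe x * qI y + qI x * qRe y + qJ x * qK y - qK x * qJ y)
  (qRe x * qJ y - qI x * qK y + qJ x * qRe y + qK x * qI y)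
  (qRe x * qK y + qI x * qJ y - qJ x * qI y + qK x * qRe y)"

instance
  by intro_classes
    (simp_all add: zero_quat_def one_quat_def plus_quat_def uminus_quat_def minus_quat_def
      scaleR_quat_def times_quat_def algebra_simps)

end

definition qcnj :: "quat \<Rightarrow> quat" where
  "qcnj x = Quat (qRe x) (- qI x) (- qJ x) (- qK x)"

lemma qcnj_simps [simp]:
  "qcnj 0 = 0" "qcnj (x + y) = qcnj x + qcnj y"
  "qcnj (x * y) = qcnj y * qcnj x" "qcnj (qcnj x) = x"
  by (simp_all add: qcnj_def zero_quat_def plus_quat_def times_quat_def algebra_simps)


section \<open>Quaternionic polynomials in central variables\<close>

text \<open>
  The variables are indexed by the finite type \<open>'d\<close>. A polynomial is a finitely supported
  function from exponent vectors to coefficients; the library's product of such functions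
  is convolution, so that monomials commute with coefficients.
\<close>

type_synonym 'd qpoly = "('d \<Rightarrow>\<^sub>0 nat) \<Rightarrow>\<^sub>0 quat"

definition qpoly_star :: "'d qpoly \<Rightarrow> 'd qpoly" where
  "qpoly_star p = Poly_Mapping.map qcnj p"

definition qpoly_eval :: "'d::finite qpoly \<Rightarrow> real ^ 'd \<Rightarrow> quat" where
  "qpoly_eval p a =
     (\<Sum>e\<in>Poly_Mapping.keys p.
        (\<Prod>i\<in>UNIV. (a $ i) ^ Poly_Mapping.lookup e i) *\<^sub>R Poly_Mapping.lookup p e)"

definition qpoly_matrix_eval :: "'d::finite qpoly ^ 'n ^ 'm \<Rightarrow> real ^ 'd \<Rightarrow> quat ^ 'n ^ 'm" where
  "qpoly_matrix_eval A a = (\<chi> i j. qpoly_eval (A $ i $ j) a)"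

lemma lookup_qpoly_star:
  "Poly_Mapping.lookup (qpoly_star p) e = qcnj (Poly_Mapping.lookup p e)"
  by (simp add: qpoly_star_def map.rep_eq when_def)

lemma qpoly_star_zero: "qpoly_star 0 = 0"
  by (rule poly_mapping_eqI) (simp add: lookup_qpoly_star)

lemma qpoly_star_add: "qpoly_star (p + q) = qpoly_star p + qpoly_star q"
  by (rule poly_mapping_eqI) (simp add: lookup_qpoly_star lookup_add)

lemma qpoly_star_single:
  "qpoly_star (Poly_Mapping.single e c) = Poly_Mapping.single e (qcnj c)"
  by (rule poly_mapping_eqI) (simp add: lookup_qpoly_star lookup_single when_def)

lemma qpoly_star_star: "qpoly_star (qpoly_star p) = p"
  by (rule poly_mapping_eqI) (simp add: lookup_qpoly_star)

lemma qpoly_induct [case_names zero add]: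
  assumes "P 0"
    and "\<And>p e c. P p \<Longrightarrow> P (Poly_Mapping.single e c + p)"
  shows "P (p :: 'd qpoly)"
proof (induction p rule: update_induct)
  case const
  show ?case by (rule assms(1))
next
  case (update p e c)
  have "Poly_Mapping.update e c p = Poly_Mapping.single e c + p"
    using update(1) by (intro poly_mapping_eqI)
      (auto simp: lookup_update lookup_add lookup_single when_def in_keys_iff)
  then show ?case
    using assms(2)[OF update.IH] by simp
qed

lemma qpoly_star_mult: "qpoly_star (p * q) = qpoly_star q * qpoly_star p"
proof (induction p rule: qpoly_induct)
  case zero
  show ?case by (simp add: qpoly_star_zero)
next
  case (add p e c)
  have "qpoly_star (Poly_Mapping.single e c * q) = qpoly_star q * Poly_Mapping.single e (qcnj c)"
  proof (induction q rule: qpoly_induct)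
    case zero
    show ?case by (simp add: qpoly_star_zero)
  qed (simp add: ring_distribs qpoly_star_add qpoly_star_single mult_single add.commute)
  with add show ?case
    by (simp add: ring_distribs qpoly_star_add qpoly_star_single)
qed

lemma qpoly_matrix_ring_with_involution:
  "ring_with_involution (matrix_ring :: ('d qpoly ^ 'n ^ 'n) ring) (conj_transpose qpoly_star)"
  by (intro matrix_ring_with_involution qpoly_star_add qpoly_star_mult qpoly_star_star)

lemma qpoly_eval_superset:
  assumes "finite S" "Poly_Mapping.keys p \<subseteq> S"
  shows "qpoly_eval p a =
    (\<Sum>e\<in>S. (\<Prod>i\<in>UNIV. (a $ i) ^ Poly_Mapping.lookup e i) *\<^sub>R Poly_Mapping.lookup p e)"
  unfolding qpoly_eval_def
  using assms by (intro sum.mono_neutral_left) (auto simp: in_keys_iff)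

lemma qpoly_eval_zero: "qpoly_eval 0 a = 0"
  by (simp add: qpoly_eval_def)

lemma qpoly_eval_single:
  "qpoly_eval (Poly_Mapping.single e c) a =
     (\<Prod>i\<in>UNIV. (a $ i) ^ Poly_Mapping.lookup e i) *\<^sub>R c"
  by (subst qpoly_eval_superset[of "{e}"]) auto

lemma qpoly_eval_add: "qpoly_eval (p + q) a = qpoly_eval p a + qpoly_eval q a"
proof -
  let ?S = "Poly_Mapping.keys p \<union> Poly_Mapping.keys q"
  have "Poly_Mapping.keys (p + q) \<subseteq> ?S"
    by (rule Poly_Mapping.keys_add)
  then show ?thesis
    by (simp add: qpoly_eval_superset[of ?S] lookup_add scaleR_add_right sum.distrib)
qed

lemma qpoly_eval_mult: "qpoly_eval (p * q) a = qpoly_eval p a * qpoly_eval q a"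
proof (induction p rule: qpoly_induct)
  case zero
  show ?case by (simp add: qpoly_eval_zero)
next
  case (add p e c)
  have "qpoly_eval (Poly_Mapping.single e c * q) a =
      qpoly_eval (Poly_Mapping.single e c) a * qpoly_eval q a"
  proof (induction q rule: qpoly_induct)
    case zero
    show ?case by (simp add: qpoly_eval_zero)
  qed (simp add: ring_distribs qpoly_eval_add qpoly_eval_single mult_single lookup_add
      power_add prod.distrib mult.commute)
  with add show ?case
    by (simp add: ring_distribs qpoly_eval_add)
qed

end

theory Submission
  imports Defs "HOL-Computational_Algebra.Fundamental_Theorem_Algebra"
begin

text \<open>
  Matrices that vanish at a fixed vector form a real left ideal, which settles one direction. For the
  other one, take a real left ideal \<open>N\<close> that contains the \<open>P\<^sub>i\<close> but not \<open>Q\<close> and is maximal with these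
  properties. The real polynomials \<open>r\<close> with \<open>r Q \<in> N\<close> form a real prime ideal \<open>p\<close>, the quaternionic
  ones form a two-sided ideal \<open>PP\<close> lying over it, and realness of \<open>N\<close> prevents every multiple
  \<open>s Q\<close> with \<open>s \<notin> p\<close> from lying in \<open>N\<close> modulo \<open>PP\<close>. So linear algebra over the quaternions with
  coefficients in the formally real field of fractions of \<open>\<real>[x] / p\<close> yields a polynomial vector \<open>v\<close>
  with \<open>P\<^sub>i v \<equiv> 0\<close> and \<open>Q v \<noteq> 0\<close> modulo \<open>PP\<close>, and it remains to find a real point at which
  the finitely many polynomials in \<open>p\<close> involved vanish, and one outside of \<open>p\<close> does not.

  The existence of such a point is the theorem of Artin and Lang. Over a countable ring of coefficients
  the residue field of \<open>p\<close> embeds into the complex numbers. A maximal cone in \<open>\<complex>\<close> containing the images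
  of the sums of squares is the positive cone of a real closed subfield. A countable real closed
  subfield of that one embeds into an ultrapower of \<open>\<real>\<close>, by extending order isomorphisms between
  subrings: along algebraic elements one proceeds by the least degree, with Rolle's theorem locating
  the roots, and along transcendental ones by countable saturation. The generic point so
  obtained in the ultrapower is represented by a sequence of real points.
\<close>

section \<open>Subrings as sets, polynomials over them, and the product ring\<close>

section \<open>Polynomials with coefficients in a subring\<close>

text \<open>The residue field of \<open>p\<close> depends on a term and is never a type here: fields
  are subsets of \<open>complex\<close> and \<open>hyper\<close>, and a homomorphism is its graph, a
  subring of a product ring that grows by adjoining one pair at a time. \<open>complex\<close> is a
  container in which a countable subring finds roots and transcendental elements; the ultrapower
  stands in for the real numbers because a cut in a countable ordered field, say that of an
  infinitely large element, need not be filled by a real number.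

  The noncommutative side rests on the norm: \<open>qpoly_star f * f\<close> is a real polynomial,
  and it lies in \<open>p\<close> exactly if \<open>f\<close> lies in \<open>PP\<close>. So modulo
  \<open>PP\<close> every nonzero element has a nonzero central multiple, which is what elimination
  needs, and finitely many quaternionic equations turn into one real equation, a sum of norms.
  Realness of \<open>N\<close> is used for three things: \<open>p\<close> is real, \<open>PP\<close>
  is closed under conjugation, and a matrix \<open>C = s Q - b\<close> with \<open>b\<close> in
  \<open>N\<close> and entries in \<open>PP\<close> lies in \<open>N\<close>, because
  \<open>adj C ** C\<close> does.\<close>

instantiation prod :: (times, times) times
begin
definition "x * y = (fst x * fst y, snd x * snd y)"
instance ..
end

instantiation prod :: (one, one) one
begin
definition "1 = (1, 1)"
instance ..
end

lemma fst_times [simp]: "fst (x * y) = fst x * fst y"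
  and snd_times [simp]: "snd (x * y) = snd x * snd y"
  by (simp_all add: times_prod_def)

lemma fst_one [simp]: "fst 1 = 1" and snd_one [simp]: "snd 1 = 1"
  by (simp_all add: one_prod_def)

instance prod :: (comm_ring_1, comm_ring_1) comm_ring_1
  by intro_classes (simp_all add: prod_eq_iff algebra_simps)

definition unital_subring :: "'a::comm_ring_1 set \<Rightarrow> bool" where
  "unital_subring S \<longleftrightarrow> 1 \<in> S \<and> (\<forall>x\<in>S. \<forall>y\<in>S. x - y \<in> S \<and> x * y \<in> S)"

definition polys_over :: "'a::zero set \<Rightarrow> 'a poly set" where
  "polys_over S = {p. \<forall>i. coeff p i \<in> S}"

definition adjoin :: "'a::comm_ring_1 set \<Rightarrow> 'a \<Rightarrow> 'a set" where
  "adjoin S x = (\<lambda>p. poly p x) ` polys_over S"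

lemma coeff_polys_over: "p \<in> polys_over S \<Longrightarrow> coeff p i \<in> S"
  by (simp add: polys_over_def)

lemma polys_over_mono: "S \<subseteq> T \<Longrightarrow> p \<in> polys_over S \<Longrightarrow> p \<in> polys_over T"
  by (auto simp: polys_over_def)

context
  fixes S :: "'a::comm_ring_1 set"
  assumes S: "unital_subring S"
begin

lemma
  shows unital_subring_one: "1 \<in> S"
    and unital_subring_diff: "x \<in> S \<Longrightarrow> y \<in> S \<Longrightarrow> x - y \<in> S"
    and unital_subring_mult: "x \<in> S \<Longrightarrow> y \<in> S \<Longrightarrow> x * y \<in> S"
  using S by (auto simp: unital_subring_def)

lemma unital_subring_zero: "0 \<in> S"
  using unital_subring_diff[OF unital_subring_one unital_subring_one] by simp

lemma unital_subring_uminus: "x \<in> S \<Longrightarrow> - x \<in> S"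
  using unital_subring_diff[OF unital_subring_zero] by simp

lemma unital_subring_add: "x \<in> S \<Longrightarrow> y \<in> S \<Longrightarrow> x + y \<in> S"
  using unital_subring_diff[OF _ unital_subring_uminus, of x y] by simp

lemma unital_subring_sum: "(\<And>i. i \<in> A \<Longrightarrow> f i \<in> S) \<Longrightarrow> sum f A \<in> S"
  by (induction A rule: infinite_finite_induct)
    (auto intro: unital_subring_zero unital_subring_add)

lemma unital_subring_prod: "(\<And>i. i \<in> A \<Longrightarrow> f i \<in> S) \<Longrightarrow> prod f A \<in> S"
  by (induction A rule: infinite_finite_induct)
    (auto intro: unital_subring_one unital_subring_mult)

lemma unital_subring_power: "x \<in> S \<Longrightarrow> x ^ n \<in> S"
  by (induction n) (auto intro: unital_subring_one unital_subring_mult)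

lemma unital_subring_of_nat: "of_nat n \<in> S"
  by (induction n) (auto intro: unital_subring_one unital_subring_zero unital_subring_add)

lemmas unital_subring_closed = unital_subring_one unital_subring_zero unital_subring_add
  unital_subring_diff unital_subring_uminus unital_subring_mult unital_subring_power

lemma polys_over_pCons_iff: "pCons a p \<in> polys_over S \<longleftrightarrow> a \<in> S \<and> p \<in> polys_over S"
  by (auto simp: polys_over_def coeff_pCons split: nat.splits)

lemma polys_over_zero: "0 \<in> polys_over S"
  by (simp add: polys_over_def unital_subring_zero)

lemma polys_over_add: "p \<in> polys_over S \<Longrightarrow> q \<in> polys_over S \<Longrightarrow> p + q \<in> polys_over S"
  by (simp add: polys_over_def unital_subring_add)

lemma polys_over_diff: "p \<in> polys_over S \<Longrightarrow> q \<in> polys_over S \<Longrightarrow> p - q \<in> polys_over S"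
  by (simp add: polys_over_def unital_subring_diff)

lemma polys_over_smult: "a \<in> S \<Longrightarrow> p \<in> polys_over S \<Longrightarrow> smult a p \<in> polys_over S"
  by (simp add: polys_over_def unital_subring_mult)

lemma polys_over_mult: "p \<in> polys_over S \<Longrightarrow> q \<in> polys_over S \<Longrightarrow> p * q \<in> polys_over S"
  by (auto simp: polys_over_def coeff_mult intro!: unital_subring_sum unital_subring_mult)

lemma polys_over_monom: "a \<in> S \<Longrightarrow> monom a n \<in> polys_over S"
  by (simp add: polys_over_def unital_subring_zero)

lemma polys_over_one: "1 \<in> polys_over S"
  using polys_over_monom[OF unital_subring_one, of 0] by (simp add: monom_0 one_pCons)

lemma polys_over_uminus: "p \<in> polys_over S \<Longrightarrow> - p \<in> polys_over S"
  by (simp add: polys_over_def unital_subring_uminus)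

lemma polys_over_linear: "a \<in> S \<Longrightarrow> [:- a, 1:] \<in> polys_over S"
  by (simp add: polys_over_pCons_iff polys_over_zero unital_subring_closed)

lemma polys_over_power: "p \<in> polys_over S \<Longrightarrow> p ^ n \<in> polys_over S"
  by (induction n) (simp_all add: polys_over_one polys_over_mult)

lemma poly_in_subring: "p \<in> polys_over S \<Longrightarrow> x \<in> S \<Longrightarrow> poly p x \<in> S"
  by (induction p) (auto simp: polys_over_pCons_iff intro: unital_subring_closed)

lemma synthetic_div_polys_over: "p \<in> polys_over S \<Longrightarrow> x \<in> S \<Longrightarrow> synthetic_div p x \<in> polys_over S"
  by (induction p) (auto simp: polys_over_pCons_iff polys_over_zero intro: poly_in_subring)

lemma unital_subring_adjoin: "unital_subring (adjoin S x)"
proof -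
  have "poly p x - poly q x \<in> adjoin S x" "poly p x * poly q x \<in> adjoin S x"
    if "p \<in> polys_over S" "q \<in> polys_over S" for p q
    using that polys_over_diff[of p q] polys_over_mult[of p q]
    by (auto simp: adjoin_def image_iff simp flip: poly_diff poly_mult)
  moreover have "1 \<in> adjoin S x"
    using polys_over_one by (force simp: adjoin_def image_iff)
  ultimately show ?thesis
    by (auto simp: unital_subring_def adjoin_def)
qed

lemma subset_adjoin: "S \<subseteq> adjoin S x"
proof
  fix a assume "a \<in> S"
  then show "a \<in> adjoin S x"
    using polys_over_monom[of a 0] by (force simp: adjoin_def image_iff monom_0)
qed

lemma in_adjoin: "x \<in> adjoin S x"
proof -
  have "[:0, 1:] \<in> polys_over S"
    using polys_over_linear[OF unital_subring_zero] by simp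
  then show ?thesis
    by (force simp: adjoin_def image_iff)
qed

text \<open>The leading coefficient of \<open>f\<close> need not be invertible, so \<open>q\<close>
  is multiplied by a power of it; each round cancels the top coefficient of
  \<open>lead_coeff f\<close> times \<open>q\<close> against a multiple of \<open>f\<close>. A
  product ring has zero divisors, so degrees of products are only bounded, and the drop in degree is
  read off from the vanishing coefficient.\<close>

lemma pseudo_division:
  assumes f: "f \<in> polys_over S" "0 < degree f" and q: "q \<in> polys_over S"
  obtains k u r where "u \<in> polys_over S" "r \<in> polys_over S" "degree r < degree f"
    "smult (lead_coeff f ^ k) q = u * f + r"
proof -
  have "\<exists>k u r. u \<in> polys_over S \<and> r \<in> polys_over S \<and> degree r < degree f \<and>
      smult (lead_coeff f ^ k) q = u * f + r"
    using q
  proof (induction "degree q" arbitrary: q rule: less_induct)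
    case less
    show ?case
    proof (cases "degree q < degree f")
      case True
      have "0 \<in> polys_over S" by (rule polys_over_zero)
      moreover have "smult (lead_coeff f ^ 0) q = 0 * f + q" by simp
      ultimately show ?thesis using True less.prems by blast
    next
      case False
      define m where "m = monom (lead_coeff q) (degree q - degree f)"
      define q' where "q' = smult (lead_coeff f) q - m * f"
      have m: "m \<in> polys_over S"
        unfolding m_def by (intro polys_over_monom coeff_polys_over less.prems)
      have q': "q' \<in> polys_over S"
        unfolding q'_def
        by (intro polys_over_diff polys_over_smult polys_over_mult m f(1) less.prems coeff_polys_over)
      have "degree (m * f) \<le> degree q"
        using degree_mult_le[of m f] degree_monom_le[of "lead_coeff q" "degree q - degree f"] False
        by (simp add: m_def)
      then have "degree q' \<le> degree q"
        unfolding q'_def by (intro degree_diff_le) (auto intro: order.trans[OF degree_smult_le])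
      moreover have "coeff q' (degree q) = 0"
        using False by (simp add: q'_def m_def coeff_monom_mult)
      ultimately have "degree q' < degree q"
        using f(2) False by (metis coeff_0_degree_minus_1 degree_0 le_neq_implies_less
            leading_coeff_0_iff not_less zero_less_iff_neq_zero)
      from less.hyps[OF this q'] obtain k u r where
        *: "u \<in> polys_over S" "r \<in> polys_over S" "degree r < degree f"
          "smult (lead_coeff f ^ k) q' = u * f + r" by blast
      have "smult (lead_coeff f ^ Suc k) q = smult (lead_coeff f ^ k) (q' + m * f)"
        by (simp add: q'_def mult.commute)
      also have "\<dots> = (u + smult (lead_coeff f ^ k) m) * f + r"
        using *(4) by (simp add: smult_add_right algebra_simps)
      finally have "smult (lead_coeff f ^ Suc k) q = (u + smult (lead_coeff f ^ k) m) * f + r" .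
      moreover have "u + smult (lead_coeff f ^ k) m \<in> polys_over S"
        by (intro polys_over_add * polys_over_smult m unital_subring_power coeff_polys_over f)
      ultimately show ?thesis using * by blast
    qed
  qed
  then show ?thesis using that by blast
qed

text \<open>A polynomial of degree n in \<open>y = 1 / x\<close> becomes a polynomial in
  \<open>x\<close> after multiplication by \<open>x ^ n\<close>. Denominators are cleared this way
  when an inverse is adjoined to a subring.\<close>

lemma power_mult_poly_inverse:
  assumes "x * y = 1" "x \<in> S" "p \<in> polys_over S"
  shows "\<exists>n. x ^ n * poly p y \<in> S"
  using assms(3)
proof (induction p)
  case 0
  show ?case by (simp add: unital_subring_zero)
next
  case (pCons a p)
  then obtain n where n: "x ^ n * poly p y \<in> S" and a: "a \<in> S"
    by (auto simp: polys_over_pCons_iff)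
  have "x ^ Suc n * poly (pCons a p) y = x ^ Suc n * a + x ^ n * (x * y) * poly p y"
    by (simp add: algebra_simps)
  also have "\<dots> \<in> S"
    using n a by (auto simp: assms(1) intro!: unital_subring_closed assms(2))
  finally show ?case by blast
qed

end

lemma countable_polys_over: "countable S \<Longrightarrow> countable (polys_over S)"
proof -
  assume S: "countable S"
  have "p \<in> Poly ` lists S" if "p \<in> polys_over S" for p
  proof -
    have "coeffs p \<in> lists S"
      using that by (auto simp: polys_over_def coeffs_def)
    then show ?thesis by (metis Poly_coeffs imageI)
  qed
  then have "polys_over S \<subseteq> Poly ` lists S" by blast
  then show ?thesis
    using S by (meson countable_image countable_lists countable_subset)
qed

lemma countable_adjoin: "countable S \<Longrightarrow> countable (adjoin S x)"
  by (simp add: adjoin_def countable_polys_over)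

lemma unital_subring_Union_chain:
  assumes "C \<noteq> {}" "subset.chain A C" "\<And>S. S \<in> C \<Longrightarrow> unital_subring S"
  shows "unital_subring (\<Union>C)"
proof -
  have "\<exists>S\<in>C. x \<in> S \<and> y \<in> S" if "x \<in> \<Union>C" "y \<in> \<Union>C" for x y
    using that assms(2) unfolding subset.chain_def by blast
  then show ?thesis
    using assms(1,3) unfolding unital_subring_def by (metis Union_iff ex_in_conv)
qed

text \<open>A polynomial whose coefficients lie in the graph of a homomorphism is a polynomial
  together with its image; the two projections recover them.\<close>

abbreviation fst_poly :: "('a::zero \<times> 'b::zero) poly \<Rightarrow> 'a poly" where
  "fst_poly \<equiv> map_poly fst"

abbreviation snd_poly :: "('a::zero \<times> 'b::zero) poly \<Rightarrow> 'b poly" where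
  "snd_poly \<equiv> map_poly snd"

lemma coeff_fst_poly [simp]: "coeff (fst_poly p) i = fst (coeff p i)"
  and coeff_snd_poly [simp]: "coeff (snd_poly p) i = snd (coeff p i)"
  by (simp_all add: coeff_map_poly)

lemma fst_poly_eval:
  fixes p :: "('a::comm_ring_1 \<times> 'b::comm_ring_1) poly"
  shows "fst (poly p x) = poly (fst_poly p) (fst x)"
  by (induction p) (simp_all add: map_poly_pCons)

lemma snd_poly_eval:
  fixes p :: "('a::comm_ring_1 \<times> 'b::comm_ring_1) poly"
  shows "snd (poly p x) = poly (snd_poly p) (snd x)"
  by (induction p) (simp_all add: map_poly_pCons)

lemma fst_poly_hom:
  fixes p q :: "('a::comm_ring_1 \<times> 'b::comm_ring_1) poly"
  shows "fst_poly (p + q) = fst_poly p + fst_poly q"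
    and "fst_poly (p * q) = fst_poly p * fst_poly q"
    and "fst_poly (smult c p) = smult (fst c) (fst_poly p)"
  by (simp_all add: poly_eq_iff coeff_mult fst_sum)

lemma snd_poly_hom:
  fixes p q :: "('a::comm_ring_1 \<times> 'b::comm_ring_1) poly"
  shows "snd_poly (p + q) = snd_poly p + snd_poly q"
    and "snd_poly (p * q) = snd_poly p * snd_poly q"
    and "snd_poly (smult c p) = smult (snd c) (snd_poly p)"
  by (simp_all add: poly_eq_iff coeff_mult snd_sum)

text \<open>The derivative is formed in both components at once, by the recursion of
  \<open>pderiv\<close> on \<open>pCons\<close>, which keeps its coefficients in
  \<open>S\<close>.\<close>

lemma pderiv_pair:
  fixes p :: "('a::{comm_ring_1,semiring_no_zero_divisors} \<times> 'b::{comm_ring_1,semiring_no_zero_divisors}) poly"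
  assumes S: "unital_subring S" and "p \<in> polys_over S"
  obtains d where "d \<in> polys_over S" "fst_poly d = pderiv (fst_poly p)" "snd_poly d = pderiv (snd_poly p)"
proof -
  have "\<exists>d\<in>polys_over S. fst_poly d = pderiv (fst_poly p) \<and> snd_poly d = pderiv (snd_poly p)"
    using assms(2)
  proof (induction p)
    case 0
    show ?case by (intro bexI[of _ 0]) (simp_all add: polys_over_zero S)
  next
    case (pCons a p)
    then obtain d where d: "d \<in> polys_over S" "p \<in> polys_over S"
      "fst_poly d = pderiv (fst_poly p)" "snd_poly d = pderiv (snd_poly p)"
      by (auto simp: polys_over_pCons_iff S)
    have "p + pCons 0 d \<in> polys_over S"
      using d by (intro polys_over_add S) (simp_all add: polys_over_pCons_iff S unital_subring_zero)
    then show ?case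
      using d by (intro bexI[of _ "p + pCons 0 d"])
        (simp_all add: map_poly_pCons pderiv_pCons fst_poly_hom snd_poly_hom)
  qed
  then show ?thesis using that by blast
qed

lemma polys_over_fst: "p \<in> polys_over S \<Longrightarrow> fst_poly p \<in> polys_over (fst ` S)"
  by (auto simp: polys_over_def)

section \<open>Extending homomorphisms into the complex numbers with prescribed prime kernel\<close>

section \<open>Embedding residue rings into the complex numbers\<close>

locale prime_ideal_set =
  fixes p :: "'r::comm_ring_1 set"
  assumes zero_in: "0 \<in> p"
    and add_in: "x \<in> p \<Longrightarrow> y \<in> p \<Longrightarrow> x + y \<in> p"
    and mult_in: "x \<in> p \<Longrightarrow> r * x \<in> p"
    and one_notin: "1 \<notin> p"
    and prime: "x * y \<in> p \<Longrightarrow> x \<in> p \<or> y \<in> p"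
begin

lemma mult_in': "x \<in> p \<Longrightarrow> x * r \<in> p"
  using mult_in[of x r] by (simp add: mult.commute)

lemma uminus_in: "x \<in> p \<Longrightarrow> - x \<in> p"
  using mult_in[of x "-1"] by simp

lemma diff_in: "x \<in> p \<Longrightarrow> y \<in> p \<Longrightarrow> x - y \<in> p"
  using add_in[of x "- y"] uminus_in by simp

lemma mult_in_iff: "x * y \<in> p \<longleftrightarrow> x \<in> p \<or> y \<in> p"
  using prime mult_in mult_in' by blast

lemma power_in: "x ^ n \<in> p \<Longrightarrow> x \<in> p"
  by (induction n) (auto simp: one_notin mult_in_iff)

lemma add_in_iff: "x \<in> p \<Longrightarrow> x + y \<in> p \<longleftrightarrow> y \<in> p"
  using diff_in[of "x + y" x] add_in by auto

lemma poly_in: "(\<And>i. coeff f i \<in> p) \<Longrightarrow> poly f x \<in> p"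
proof (induction f)
  case (pCons a f)
  have "a \<in> p" using pCons.prems[of 0] by simp
  moreover have "coeff f i \<in> p" for i using pCons.prems[of "Suc i"] by simp
  ultimately show ?case using pCons.IH by (simp add: add_in mult_in)
qed (simp add: zero_in)

text \<open>A relation \<open>H\<close> as below is the graph of a homomorphism with kernel \<open>p\<close> from the subring
  \<open>fst ` H\<close> to a field.\<close>

definition residue_graph :: "('r \<times> 'k::field) set \<Rightarrow> bool" where
  "residue_graph H \<longleftrightarrow> unital_subring H \<and> (\<forall>z\<in>H. fst z \<in> p \<longleftrightarrow> snd z = 0)"

lemma residue_graph_coeffs:
  assumes "residue_graph H" "f \<in> polys_over H"
  shows "fst (coeff f i) \<in> p \<longleftrightarrow> snd (coeff f i) = 0"
  using assms by (auto simp: residue_graph_def polys_over_def)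

lemma poly_fst_in:
  assumes "residue_graph H" "f \<in> polys_over H" "snd_poly f = 0"
  shows "poly (fst_poly f) x \<in> p"
proof (rule poly_in)
  fix i
  show "coeff (fst_poly f) i \<in> p"
    using residue_graph_coeffs[OF assms(1,2), of i] assms(3)
    by (metis coeff_0 coeff_fst_poly coeff_snd_poly)
qed

text \<open>Terms whose coefficients lie in \<open>p\<close> are discarded, so that the leading coefficient
  becomes a nonzero element of the residue field.\<close>

lemma trim_residue_poly:
  assumes H: "residue_graph H" and f: "f \<in> polys_over H"
  obtains g where "g \<in> polys_over H" "snd_poly g = snd_poly f" "degree g = degree (snd_poly f)"
    "\<And>x. poly (fst_poly g) x \<in> p \<longleftrightarrow> poly (fst_poly f) x \<in> p"
proof -
  have S: "unital_subring H" using H by (simp add: residue_graph_def)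
  define d where "d = degree (snd_poly f)"
  define g where "g = poly_cutoff (Suc d) f"
  have g: "g \<in> polys_over H"
    using f by (auto simp: polys_over_def g_def coeff_poly_cutoff unital_subring_zero[OF S])
  have sg: "snd_poly g = snd_poly f"
  proof (rule poly_eqI)
    fix n
    show "coeff (snd_poly g) n = coeff (snd_poly f) n"
      using coeff_eq_0[of "snd_poly f" n] by (auto simp: g_def coeff_poly_cutoff d_def)
  qed
  have "degree g \<le> d"
    by (rule degree_le) (simp add: g_def coeff_poly_cutoff)
  moreover have "degree (snd_poly g) \<le> degree g"
    by (rule degree_le) (simp add: coeff_eq_0)
  ultimately have dg: "degree g = d" using sg by (simp add: d_def)
  have h: "f - g \<in> polys_over H" by (intro polys_over_diff f g S)
  have "snd_poly (f - g) = 0"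
    using sg by (simp add: poly_eq_iff)
  then have "poly (fst_poly (f - g)) x \<in> p" for x
    using poly_fst_in[OF H h] by blast
  moreover have "fst_poly f = fst_poly (f - g) + fst_poly g"
    by (simp add: poly_eq_iff)
  ultimately have "poly (fst_poly g) x \<in> p \<longleftrightarrow> poly (fst_poly f) x \<in> p" for x
    by (simp add: add_in_iff)
  then show ?thesis using that g sg dg by (simp add: d_def)
qed

text \<open>The image of \<open>b\<close> has to satisfy exactly those relations over
  \<open>H\<close> that \<open>b\<close> satisfies modulo \<open>p\<close>. If all of them are
  trivial, \<open>\<beta>\<close> is taken transcendental over the image of \<open>H\<close>;
  otherwise it is a root of the image of a relation of least degree, and division with remainder
  compares the relations on the two sides.\<close>

lemma residue_graph_extend:
  fixes H :: "('r \<times> complex) set"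
  assumes H: "residue_graph H" and "countable H"
  obtains \<beta> where "residue_graph (adjoin H (b, \<beta>))"
proof -
  have S: "unital_subring H" using H by (simp add: residue_graph_def)
  have coeffs: "fst (coeff f i) \<in> p \<longleftrightarrow> snd (coeff f i) = 0" if "f \<in> polys_over H" for f i
    using residue_graph_coeffs[OF H that] .
  define M where "M = {f \<in> polys_over H. poly (fst_poly f) b \<in> p \<and> snd_poly f \<noteq> 0}"
  have "\<exists>\<beta>. \<forall>q\<in>polys_over H. poly (fst_poly q) b \<in> p \<longleftrightarrow> poly (snd_poly q) \<beta> = 0"
  proof (cases "M = {}")
    case True
    \<comment> \<open>Countably many nonzero polynomials have only countably many complex
      roots.\<close>
    define R where "R = (\<Union>f\<in>{f \<in> polys_over H. snd_poly f \<noteq> 0}. {x. poly (snd_poly f) x = 0})"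
    have "countable R"
      unfolding R_def
      by (intro countable_UN countable_Collect countable_polys_over assms)
        (auto intro: countable_finite poly_roots_finite)
    then have "R \<noteq> UNIV"
      using uncountable_UNIV_complex by auto
    then obtain \<beta> where "\<beta> \<notin> R" by blast
    then have "poly (snd_poly q) \<beta> = 0 \<longleftrightarrow> snd_poly q = 0" if "q \<in> polys_over H" for q
      using that by (auto simp: R_def)
    moreover have "poly (fst_poly q) b \<in> p \<longleftrightarrow> snd_poly q = 0" if "q \<in> polys_over H" for q
      using that True poly_fst_in[OF H that] unfolding M_def by blast
    ultimately show ?thesis by auto
  next
    case False
    then obtain f0 where f0: "f0 \<in> M" "\<And>g. g \<in> M \<Longrightarrow> degree (snd_poly f0) \<le> degree (snd_poly g)"
      using exists_least_iff[of "\<lambda>n. \<exists>g\<in>M. degree (snd_poly g) = n"]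
      by (metis (mono_tags, lifting) ex_in_conv not_le)
    \<comment> \<open>Trimming makes the leading coefficient of \<open>f\<close> nonzero in the
      residue field, so that the powers of it introduced by pseudo-division can be cancelled on both
      sides.\<close>
    from f0(1) obtain f where f: "f \<in> polys_over H" "snd_poly f = snd_poly f0"
      "degree f = degree (snd_poly f)" "poly (fst_poly f) b \<in> p" and nz: "snd_poly f \<noteq> 0"
      using trim_residue_poly[OF H, of f0] unfolding M_def by (metis (mono_tags, lifting) mem_Collect_eq)
    have min: "snd_poly g = 0"
      if "g \<in> polys_over H" "poly (fst_poly g) b \<in> p" "degree (snd_poly g) < degree f" for g
      using that f0(2)[of g] f(2,3) unfolding M_def by fastforce
    have deg_snd: "degree (snd_poly g) \<le> degree g" for g :: "('r \<times> complex) poly"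
      by (rule degree_le) (simp add: coeff_eq_0)
    have deg_f: "degree f > 0"
    proof (rule ccontr)
      assume "\<not> ?thesis"
      then obtain c where c: "f = [:c:]" by (metis degree_0_id not_gr_zero degree_eq_zeroE)
      then have "fst c \<in> p" using f(4) by (simp add: map_poly_pCons)
      then have "snd c = 0" using coeffs[OF f(1), of 0] c by simp
      then show False using nz c by (simp add: map_poly_pCons)
    qed
    have lead: "snd (lead_coeff g) \<noteq> 0" "fst (lead_coeff g) \<notin> p"
      if "g \<in> polys_over H" "snd_poly g \<noteq> 0" "degree g = degree (snd_poly g)" for g
    proof -
      show "snd (lead_coeff g) \<noteq> 0"
        using that(2,3) by (metis coeff_snd_poly leading_coeff_0_iff)
      then show "fst (lead_coeff g) \<notin> p" using coeffs[OF that(1)] by blast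
    qed
    have "degree (snd_poly f) > 0" using deg_f f(3) by simp
    then obtain \<beta> where \<beta>: "poly (snd_poly f) \<beta> = 0"
      by (metis constant_degree fundamental_theorem_of_algebra not_gr_zero)
    have fwd: "poly (snd_poly q) \<beta> = 0"
      if q: "q \<in> polys_over H" "poly (fst_poly q) b \<in> p" for q
    proof -
      obtain k u r where *: "u \<in> polys_over H" "r \<in> polys_over H" "degree r < degree f"
        "smult (lead_coeff f ^ k) q = u * f + r"
        using pseudo_division[OF S f(1) deg_f q(1)] .
      have 1: "fst_poly (smult (lead_coeff f ^ k) q) = fst_poly u * fst_poly f + fst_poly r"
        and 2: "snd_poly (smult (lead_coeff f ^ k) q) = snd_poly u * snd_poly f + snd_poly r"
        by (simp_all add: * fst_poly_hom snd_poly_hom)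
      have "poly (fst_poly (smult (lead_coeff f ^ k) q)) b \<in> p"
        using q(2) by (simp add: fst_poly_hom mult_in)
      then have "poly (fst_poly r) b \<in> p"
        using f(4) by (simp add: 1 add_in_iff mult_in)
      then have "snd_poly r = 0"
        using min[OF *(2)] deg_snd[of r] *(3) by simp
      then have "poly (snd_poly (smult (lead_coeff f ^ k) q)) \<beta> = 0"
        by (simp add: 2 \<beta>)
      moreover have "snd (lead_coeff f ^ k) \<noteq> 0"
        using lead(1)[OF f(1) nz f(3)] by (induction k) auto
      ultimately show ?thesis by (simp add: snd_poly_hom)
    qed
    \<comment> \<open>Let \<open>r\<close> have least degree among the polynomials with nonzero
      image that vanish at \<open>\<beta>\<close>. It divides \<open>f\<close> up to a scalar and up
      to coefficients in \<open>p\<close>, with a cofactor \<open>u\<close> of smaller degree than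
      \<open>f\<close>. By the choice of \<open>f\<close>, \<open>u\<close> does not vanish at
      \<open>b\<close> modulo \<open>p\<close>, so by primeness \<open>r\<close> does; and
      \<open>q\<close> is a multiple of \<open>r\<close> in the same sense.\<close>
    have bwd: "poly (fst_poly q) b \<in> p"
      if q: "q \<in> polys_over H" "poly (snd_poly q) \<beta> = 0" for q
    proof -
      define N where "N = {g \<in> polys_over H. poly (snd_poly g) \<beta> = 0 \<and> snd_poly g \<noteq> 0}"
      have "f \<in> N" unfolding N_def using f(1) \<beta> nz by blast
      then obtain r0 where r0: "r0 \<in> N" "\<And>g. g \<in> N \<Longrightarrow> degree (snd_poly r0) \<le> degree (snd_poly g)"
        using exists_least_iff[of "\<lambda>n. \<exists>g\<in>N. degree (snd_poly g) = n"]
        by (metis (mono_tags, lifting) not_le)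
      then obtain r where r: "r \<in> polys_over H" "snd_poly r = snd_poly r0"
        "degree r = degree (snd_poly r)"
        using trim_residue_poly[OF H, of r0] unfolding N_def by (metis (mono_tags, lifting) mem_Collect_eq)
      have rnz: "snd_poly r \<noteq> 0" and r\<beta>: "poly (snd_poly r) \<beta> = 0"
        using r0(1) r(2) by (simp_all add: N_def)
      have rmin: "snd_poly g = 0"
        if "g \<in> polys_over H" "poly (snd_poly g) \<beta> = 0" "degree (snd_poly g) < degree r" for g
        using that r0(2)[of g] r(2,3) unfolding N_def by fastforce
      have deg_r: "degree r > 0"
        using rnz r\<beta> r(3) by (metis degree_eq_zeroE gr0I mult_zero_right pCons_0_0 poly_0 poly_pCons add_0_right)
      have rem: "\<exists>k u s. u \<in> polys_over H \<and> smult (lead_coeff r ^ k) g = u * r + s \<and>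
          snd_poly s = 0 \<and> poly (fst_poly s) b \<in> p"
        if g: "g \<in> polys_over H" "poly (snd_poly g) \<beta> = 0" for g
      proof -
        obtain k u s where *: "u \<in> polys_over H" "s \<in> polys_over H" "degree s < degree r"
          "smult (lead_coeff r ^ k) g = u * r + s"
          using pseudo_division[OF S r(1) deg_r g(1)] .
        have "snd_poly (smult (lead_coeff r ^ k) g) = snd_poly u * snd_poly r + snd_poly s"
          by (simp add: * snd_poly_hom)
        then have "poly (snd_poly (smult (lead_coeff r ^ k) g)) \<beta> =
            poly (snd_poly u) \<beta> * poly (snd_poly r) \<beta> + poly (snd_poly s) \<beta>"
          by simp
        then have "poly (snd_poly s) \<beta> = 0"
          using g(2) r\<beta> by (simp add: snd_poly_hom)
        then have "snd_poly s = 0"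
          using rmin[OF *(2)] deg_snd[of s] *(3) by simp
        then show ?thesis using * poly_fst_in[OF H *(2)] by blast
      qed
      have lead_r: "fst (lead_coeff r ^ k) \<notin> p" for k
        using lead(2)[OF r(1) rnz r(3)] power_in by (induction k) (auto simp: one_notin mult_in_iff)
      have r_in: "poly (fst_poly r) b \<in> p"
      proof -
        obtain k u s where *: "u \<in> polys_over H" "smult (lead_coeff r ^ k) f = u * r + s"
          "snd_poly s = 0" "poly (fst_poly s) b \<in> p"
          using rem[OF f(1) \<beta>] by blast
        have 1: "fst_poly (smult (lead_coeff r ^ k) f) = fst_poly u * fst_poly r + fst_poly s"
          and 2: "snd_poly (smult (lead_coeff r ^ k) f) = snd_poly u * snd_poly r"
          by (simp_all add: * fst_poly_hom snd_poly_hom)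
        define c where "c = snd (lead_coeff r ^ k)"
        have c: "c \<noteq> 0"
          unfolding c_def using lead(1)[OF r(1) rnz r(3)] by (induction k) auto
        have 3: "smult c (snd_poly f) = snd_poly u * snd_poly r"
          using 2 by (simp only: snd_poly_hom c_def)
        have eq: "snd_poly u \<noteq> 0"
          using 3 c nz by (metis mult_zero_left smult_eq_0_iff)
        have "degree (snd_poly f) = degree (snd_poly u) + degree (snd_poly r)"
          using arg_cong[OF 3, of degree] c eq rnz by (simp add: degree_mult_eq)
        then have "degree (snd_poly u) < degree f"
          using deg_r f(3) r(3) by linarith
        then have "poly (fst_poly u) b \<notin> p" using min[OF *(1)] eq by blast
        moreover have "poly (fst_poly (smult (lead_coeff r ^ k) f)) b \<in> p"
          using f(4) by (simp add: fst_poly_hom mult_in)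
        then have "poly (fst_poly u) b * poly (fst_poly r) b \<in> p"
          using *(4) by (simp add: 1 add.commute[of "_ * _"] add_in_iff)
        ultimately show ?thesis using prime by blast
      qed
      obtain k u s where *: "u \<in> polys_over H" "smult (lead_coeff r ^ k) q = u * r + s"
        "snd_poly s = 0" "poly (fst_poly s) b \<in> p"
        using rem[OF q] by blast
      have "fst_poly (smult (lead_coeff r ^ k) q) = fst_poly u * fst_poly r + fst_poly s"
        by (simp add: * fst_poly_hom)
      then have "poly (fst_poly (smult (lead_coeff r ^ k) q)) b \<in> p"
        using r_in *(4) by (simp add: add_in mult_in)
      then have "fst (lead_coeff r ^ k) * poly (fst_poly q) b \<in> p"
        by (simp only: fst_poly_hom poly_smult)
      then show ?thesis using prime lead_r by blast
    qed
    show ?thesis using fwd bwd by blast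
  qed
  then obtain \<beta> where "\<forall>q\<in>polys_over H. poly (fst_poly q) b \<in> p \<longleftrightarrow> poly (snd_poly q) \<beta> = 0"
    by blast
  then have "residue_graph (adjoin H (b, \<beta>))"
    unfolding residue_graph_def
    by (intro conjI unital_subring_adjoin S)
      (simp only: adjoin_def ball_simps fst_poly_eval snd_poly_eval fst_conv snd_conv)
  then show ?thesis using that by blast
qed

theorem residue_graph_exists:
  assumes char: "\<And>n. of_int n \<in> p \<Longrightarrow> n = 0" and "finite B"
  obtains H :: "('r \<times> complex) set" where "residue_graph H" "countable H" "B \<subseteq> fst ` H"
proof -
  have "\<exists>H :: ('r \<times> complex) set. residue_graph H \<and> countable H \<and> B \<subseteq> fst ` H"
    using assms(2)
  proof induction
    case empty
    \<comment> \<open>By \<open>char\<close> only the integer 0 lies in \<open>p\<close>, so the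
      integers form an initial graph.\<close>
    let ?H = "range (\<lambda>n. (of_int n, of_int n)) :: ('r \<times> complex) set"
    have "1 \<in> ?H" by (rule image_eqI[of _ _ 1]) (simp_all add: prod_eq_iff)
    moreover have "of_int n \<in> p \<longleftrightarrow> n = 0" for n
      using char zero_in by auto
    moreover have "(of_int m, of_int m) - (of_int n, of_int n) \<in> ?H"
      "(of_int m, of_int m) * (of_int n, of_int n) \<in> ?H" for m n
      by (rule image_eqI[of _ _ "m - n"], simp_all) (rule image_eqI[of _ _ "m * n"], simp_all add: prod_eq_iff)
    ultimately have "residue_graph ?H"
      by (auto simp: residue_graph_def unital_subring_def)
    moreover have "countable ?H" by simp
    ultimately show ?case by blast
  next
    case (insert b B)
    then obtain H :: "('r \<times> complex) set" where H: "residue_graph H" "countable H" "B \<subseteq> fst ` H"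
      by blast
    obtain \<beta> where \<beta>: "residue_graph (adjoin H (b, \<beta>))"
      using residue_graph_extend[OF H(1,2)] .
    have S: "unital_subring H" using H by (simp add: residue_graph_def)
    have "(b, \<beta>) \<in> adjoin H (b, \<beta>)" by (rule in_adjoin[OF S])
    moreover have "H \<subseteq> adjoin H (b, \<beta>)" by (rule subset_adjoin[OF S])
    ultimately have "insert b B \<subseteq> fst ` adjoin H (b, \<beta>)"
      using H(3) by force
    then show ?case using \<beta> countable_adjoin[OF H(2)] by blast
  qed
  then show ?thesis using that by blast
qed

end

section \<open>Ordered subfields: signs, root bounds, Rolle's theorem\<close>

section \<open>Real closed subfields\<close>

locale ordered_subfield =
  fixes F T :: "'a::field_char_0 set"
  assumes subring: "unital_subring F"
    and inverse_closed: "x \<in> F \<Longrightarrow> inverse x \<in> F"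
    and cone_subset: "T \<subseteq> F"
    and cone_add: "x \<in> T \<Longrightarrow> y \<in> T \<Longrightarrow> x + y \<in> T"
    and cone_mult: "x \<in> T \<Longrightarrow> y \<in> T \<Longrightarrow> x * y \<in> T"
    and cone_total: "x \<in> F \<Longrightarrow> x \<in> T \<or> - x \<in> T"
    and cone_antisym: "x \<in> T \<Longrightarrow> - x \<in> T \<Longrightarrow> x = 0"
begin

lemmas closed = unital_subring_closed[OF subring] inverse_closed

text \<open>The order lives on a subset and is no class instance, so \<open>a < b\<close> is written
  \<open>sg (b - a) = 1\<close> throughout. Everything that is not in \<open>T\<close> gets the
  value \<open>- 1\<close>, also outside of \<open>F\<close>; this is why the rules below ask for
  membership in \<open>F\<close>.\<close>

definition sg :: "'a \<Rightarrow> int" where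
  "sg x = (if x = 0 then 0 else if x \<in> T then 1 else - 1)"

lemma cone_zero: "0 \<in> T"
  using cone_total[OF unital_subring_zero[OF subring]] by simp

lemma cone_power2: "x \<in> F \<Longrightarrow> x ^ 2 \<in> T"
  using cone_total[of x] cone_mult[of x x] cone_mult[of "- x" "- x"] by (auto simp: power2_eq_square)

lemma cone_one: "1 \<in> T"
  using cone_power2[OF unital_subring_one[OF subring]] by simp

lemma cone_of_nat: "of_nat n \<in> T"
  by (induction n) (auto simp: cone_zero intro: cone_add cone_one)

lemma sg_cases: "sg x = 0 \<or> sg x = 1 \<or> sg x = - 1"
  by (simp add: sg_def)

lemma sg_zero [simp]: "sg 0 = 0"
  and sg_eq_0_iff [simp]: "sg x = 0 \<longleftrightarrow> x = 0"
  and sg_eq_1_iff: "sg x = 1 \<longleftrightarrow> x \<in> T \<and> x \<noteq> 0"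
  by (simp_all add: sg_def)

lemma sg_one [simp]: "sg 1 = 1"
  by (simp add: sg_def cone_one)

lemma sg_minus [simp]: "x \<in> F \<Longrightarrow> sg (- x) = - sg x"
  using cone_total[of x] cone_antisym[of x] by (auto simp: sg_def)

lemma sg_minus_commute: "x \<in> F \<Longrightarrow> y \<in> F \<Longrightarrow> sg (x - y) = - sg (y - x)"
  using sg_minus[of "y - x"] closed by simp

lemma not_cone_iff: "x \<in> F \<Longrightarrow> x \<notin> T \<longleftrightarrow> sg x = - 1"
  using cone_zero by (auto simp: sg_def)

lemma sg_mult:
  assumes "x \<in> F" "y \<in> F"
  shows "sg (x * y) = sg x * sg y"
proof -
  have pos: "sg (x * y) = 1" if "sg x = 1" "sg y = 1" for x y
    using that by (auto simp: sg_eq_1_iff cone_mult)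
  show ?thesis
    using sg_cases[of x] sg_cases[of y] pos[of x y] pos[of "- x" y] pos[of x "- y"] pos[of "- x" "- y"]
      assms sg_minus[of "x * y"] closed by auto
qed

lemma pos_add: "sg x = 1 \<Longrightarrow> y \<in> T \<Longrightarrow> sg (x + y) = 1"
  unfolding sg_eq_1_iff using cone_antisym[of x] by (auto intro: cone_add simp: add_eq_0_iff)

lemma sg_add:
  assumes "x \<in> F" "y \<in> F" "sg x = sg y"
  shows "sg (x + y) = sg x"
proof -
  have pos: "sg (x + y) = 1" if "sg x = 1" "sg y = 1" for x y
    using that pos_add[of x y] by (simp add: sg_eq_1_iff)
  have "sg (- x + - y) = - sg (x + y)"
    using sg_minus[of "x + y"] assms closed by (simp only: minus_add_distrib)
  then show ?thesis
    using sg_cases[of x] pos[of x y] pos[of "- x" "- y"] assms by auto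
qed

lemma less_trans:
  "x \<in> F \<Longrightarrow> y \<in> F \<Longrightarrow> z \<in> F \<Longrightarrow> sg (y - x) = 1 \<Longrightarrow> sg (z - y) = 1 \<Longrightarrow> sg (z - x) = 1"
  using sg_add[of "y - x" "z - y"] closed by simp

text \<open>Polarisation: 4z is the difference of the squares of z + 1 and z - 1. A ring whose
  squares all lie in \<open>F\<close> is therefore contained in \<open>F\<close>.\<close>

lemma in_subfield_if_squares:
  assumes "(z + 1) ^ 2 \<in> F" "(z - 1) ^ 2 \<in> F"
  shows "z \<in> F"
proof -
  have "(z + 1) ^ 2 - (z - 1) ^ 2 = of_nat 4 * z" by (simp add: power2_eq_square algebra_simps)
  then have 4: "of_nat 4 * z \<in> F" using unital_subring_diff[OF subring assms] by simp
  have "inverse (of_nat 4) \<in> F" by (intro inverse_closed unital_subring_of_nat subring)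
  from unital_subring_mult[OF subring this 4] show ?thesis by simp
qed

lemma poly_closed: "p \<in> polys_over F \<Longrightarrow> x \<in> F \<Longrightarrow> poly p x \<in> F"
  by (rule poly_in_subring[OF subring])

lemma split_root:
  assumes "f \<in> polys_over F" "f \<noteq> 0" "a \<in> F"
  obtains m g where "g \<in> polys_over F" "f = [:- a, 1:] ^ m * g" "poly g a \<noteq> 0"
proof -
  have "\<exists>m g. g \<in> polys_over F \<and> f = [:- a, 1:] ^ m * g \<and> poly g a \<noteq> 0"
    using assms(1,2)
  proof (induction "degree f" arbitrary: f rule: less_induct)
    case less
    show ?case
    proof (cases "poly f a = 0")
      case False
      have "f = [:- a, 1:] ^ 0 * f" by simp
      then show ?thesis using False less.prems by blast
    next
      case True
      define h where "h = synthetic_div f a"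
      have f: "f = [:- a, 1:] * h"
        using synthetic_div_correct'[of a f] True by (simp add: h_def)
      have "h \<noteq> 0" using f less.prems by auto
      then have "degree h < degree f" unfolding f by (subst degree_mult_eq) auto
      moreover have "h \<in> polys_over F"
        unfolding h_def by (rule synthetic_div_polys_over[OF subring less.prems(1) assms(3)])
      ultimately obtain m g where "g \<in> polys_over F" "h = [:- a, 1:] ^ m * g" "poly g a \<noteq> 0"
        using less.hyps \<open>h \<noteq> 0\<close> by blast
      moreover from this have "f = [:- a, 1:] ^ Suc m * g"
        by (simp only: f power_Suc mult.assoc)
      ultimately show ?thesis by blast
    qed
  qed
  then show ?thesis using that by blast
qed

text \<open>The bound is found in the smaller field \<open>D\<close> of the coefficients. The induction
  shows that the square of the value stays above some positive \<open>e\<close> outside of a bounded set.\<close>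

lemma root_bound:
  assumes D: "unital_subring D" "\<And>x. x \<in> D \<Longrightarrow> inverse x \<in> D" "D \<subseteq> F"
    and f: "f \<in> polys_over D" "f \<noteq> 0"
  obtains B where "B \<in> D" "\<And>x. x \<in> F \<Longrightarrow> poly f x = 0 \<Longrightarrow> sg (B - x) = 1 \<and> sg (x - - B) = 1"
proof -
  have "\<exists>B e. B \<in> D \<and> e \<in> D \<and> sg B = 1 \<and> sg e = 1 \<and>
      (\<forall>x\<in>F. sg (x ^ 2 - B) = 1 \<longrightarrow> sg (poly f x ^ 2 - e) = 1)"
    using f
  proof (induction f)
    case (pCons a g)
    have a: "a \<in> D" "a \<in> F" and g: "g \<in> polys_over D" "g \<in> polys_over F"
      using pCons.prems D by (auto simp: polys_over_pCons_iff intro: polys_over_mono)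
    have two: "sg 2 = 1" using cone_of_nat[of 2] by (simp add: sg_eq_1_iff)
    have two_in: "2 \<in> D" using unital_subring_of_nat[OF D(1), of 2] by simp
    show ?case
    proof (cases "g = 0")
      case True
      then have "a \<noteq> 0" using pCons.prems by simp
      \<comment> \<open>For a nonzero constant any positive number below its square will do; half of
        the square is taken.\<close>
      have e: "a ^ 2 * inverse 2 \<in> D"
        using a two_in by (intro unital_subring_closed D)
      have "2 \<in> F" "inverse 2 \<in> F"
        using two_in D(2)[OF two_in] D(3) by blast+
      from sg_mult[OF this] have half: "sg (inverse 2) = 1"
        using two by simp
      have "sg (a ^ 2) = 1"
        using \<open>a \<noteq> 0\<close> cone_power2[OF a(2)] by (simp add: sg_eq_1_iff)
      then have "sg (a ^ 2 * inverse 2) = 1"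
        using half \<open>inverse 2 \<in> F\<close> a(2) by (simp only: sg_mult closed)
      moreover have "a ^ 2 - a ^ 2 * inverse 2 = a ^ 2 * inverse 2" by (simp add: field_simps)
      ultimately show ?thesis
        using e True unital_subring_one[OF D(1)]
        by (intro exI[of _ 1] exI[of _ "a ^ 2 * inverse 2"]) simp
    next
      case False
      then obtain B e where B: "B \<in> D" "e \<in> D" "sg B = 1" "sg e = 1"
        and *: "\<And>x. x \<in> F \<Longrightarrow> sg (x ^ 2 - B) = 1 \<Longrightarrow> sg (poly g x ^ 2 - e) = 1"
        using pCons.IH g(1) by blast
      have inF: "B \<in> F" "e \<in> F" "2 \<in> F" using B two_in D(3) by auto
      have e0: "e \<noteq> 0" using B(4) by auto
      \<comment> \<open>This gives \<open>C * e = 2 * a ^ 2 + 2 * e\<close>. With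
        \<open>2 (a + x y)^2 + 2 a^2 = (2 a + x y)^2 + (x y)^2\<close>, where \<open>y\<close> is
        the value of \<open>g\<close>, the bounds \<open>y^2 > e\<close> and
        \<open>x^2 > B + C\<close> then imply \<open>(a + x y)^2 > e\<close>.\<close>
      define C where "C = 2 * (a ^ 2 * inverse e) + 2"
      have C: "C \<in> D"
        unfolding C_def using a B two_in by (intro unital_subring_closed D)
      have "sg (inverse e) = 1"
        using sg_mult[of e "inverse e"] B(4) inF(2) e0 inverse_closed by auto
      then have "2 * (a ^ 2 * inverse e) \<in> T"
        using two cone_power2[OF a(2)] by (intro cone_mult) (auto simp: sg_eq_1_iff)
      then have C_pos: "sg C = 1"
        unfolding C_def add.commute[of _ 2] by (rule pos_add[OF two])
      have "sg (poly (pCons a g) x ^ 2 - e) = 1" if x: "x \<in> F" "sg (x ^ 2 - (B + C)) = 1" for x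
      proof -
        define y where "y = poly g x"
        have y: "y \<in> F" unfolding y_def by (rule poly_closed[OF g(2) x(1)])
        have "sg (x ^ 2 - B) = 1"
          using pos_add[OF x(2), of C] C_pos by (simp add: sg_eq_1_iff)
        then have 1: "sg (y ^ 2 - e) = 1" using *[OF x(1)] by (simp add: y_def)
        have CinF: "C \<in> F" using C D(3) by auto
        have "2 * ((a + x * y) ^ 2 - e) = (x ^ 2 - (B + C)) * e +
            ((2 * a + x * y) ^ 2 + (x ^ 2 * (y ^ 2 - e) + B * e))"
          using e0 by (simp add: C_def power2_eq_square algebra_simps)
        moreover have "sg ((x ^ 2 - (B + C)) * e) = 1"
          using x B(4) inF CinF by (subst sg_mult) (auto intro: closed)
        moreover have "(2 * a + x * y) ^ 2 + (x ^ 2 * (y ^ 2 - e) + B * e) \<in> T"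
          using 1 B(3,4) x a y inF by (intro cone_add cone_mult cone_power2 closed) (auto simp: sg_eq_1_iff)
        ultimately have "sg (2 * ((a + x * y) ^ 2 - e)) = 1" by (simp add: pos_add)
        then have "sg ((a + x * y) ^ 2 - e) = 1"
          using two a x y inF by (subst (asm) sg_mult) (auto intro: closed)
        then show ?thesis by (simp add: y_def)
      qed
      moreover have "sg (B + C) = 1" using pos_add[OF B(3)] C_pos by (auto simp: sg_eq_1_iff)
      ultimately show ?thesis
        using B C by (intro exI[of _ "B + C"] exI[of _ e]) (auto intro: unital_subring_add D)
    qed
  qed simp
  then obtain B e where B: "B \<in> D" "e \<in> D" "sg B = 1" "sg e = 1"
    and *: "\<And>x. x \<in> F \<Longrightarrow> sg (x ^ 2 - B) = 1 \<Longrightarrow> sg (poly f x ^ 2 - e) = 1" by blast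
  have inF: "B \<in> F" "e \<in> F" using B D(3) by auto
  \<comment> \<open>From a bound on the square of a root to a bound on the root:
    \<open>(B + 1)^2 > B\<close> for positive \<open>B\<close>, and squares only grow beyond
    \<open>B + 1\<close> and below \<open>- (B + 1)\<close>.\<close>
  have no_root: "poly f x \<noteq> 0" if x: "x \<in> F" "x - (B + 1) \<in> T \<or> - x - (B + 1) \<in> T" for x
  proof -
    obtain t where t: "t \<in> T" "x ^ 2 = (t + (B + 1)) ^ 2"
      using x(2)
    proof
      assume "x - (B + 1) \<in> T"
      then show ?thesis using that[of "x - (B + 1)"] by simp
    next
      assume "- x - (B + 1) \<in> T"
      then show ?thesis using that[of "- x - (B + 1)"] by (simp add: algebra_simps power2_eq_square)
    qed
    have "x ^ 2 - B = 1 + (t ^ 2 + (of_nat 2 * t * (B + 1) + (B ^ 2 + B)))"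
      unfolding t(2) by (simp add: power2_eq_square algebra_simps)
    moreover have "t ^ 2 + (of_nat 2 * t * (B + 1) + (B ^ 2 + B)) \<in> T"
      using t(1) B(3) cone_subset inF by (intro cone_add cone_mult cone_power2 cone_of_nat cone_one) (auto simp: sg_eq_1_iff)
    ultimately have "sg (x ^ 2 - B) = 1" by (metis pos_add sg_one)
    then have "sg (poly f x ^ 2 - e) = 1" using *[OF x(1)] by simp
    then show ?thesis using B(4) inF(2) by auto
  qed
  show ?thesis
  proof (rule that[of "B + 1"])
    show "B + 1 \<in> D" using B by (auto intro: unital_subring_closed D)
    fix x assume x: "x \<in> F" "poly f x = 0"
    have F: "x - (B + 1) \<in> F" "- x - (B + 1) \<in> F" using x inF by (auto intro!: closed)
    have "sg (x - (B + 1)) = - 1" "sg (- x - (B + 1)) = - 1"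
      using no_root[OF x(1)] x(2) not_cone_iff F by blast+
    moreover have "B + 1 - x = - (x - (B + 1))" "x - - (B + 1) = - (- x - (B + 1))" by simp_all
    ultimately show "sg (B + 1 - x) = 1 \<and> sg (x - - (B + 1)) = 1"
      using sg_minus F by (metis minus_minus)
  qed
qed

end

text \<open>Real closedness is stated in the form in which it is used, as the intermediate value
  property of polynomials, which characterises real closed fields among the ordered ones.\<close>

locale real_closed_subfield = ordered_subfield +
  assumes ivt: "\<lbrakk>p \<in> polys_over F; a \<in> F; b \<in> F; sg (b - a) = 1; sg (poly p a) = - 1; sg (poly p b) = 1\<rbrakk>
    \<Longrightarrow> \<exists>c\<in>F. sg (c - a) = 1 \<and> sg (b - c) = 1 \<and> poly p c = 0"
begin

lemma sg_poly_eq_on_interval: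
  assumes p: "p \<in> polys_over F" and ab: "a \<in> F" "b \<in> F" "sg (b - a) = 1"
    and ends: "poly p a \<noteq> 0" "poly p b \<noteq> 0"
    and no_root: "\<And>c. c \<in> F \<Longrightarrow> sg (c - a) = 1 \<Longrightarrow> sg (b - c) = 1 \<Longrightarrow> poly p c \<noteq> 0"
  shows "sg (poly p a) = sg (poly p b)"
proof (rule ccontr)
  assume "sg (poly p a) \<noteq> sg (poly p b)"
  moreover have "sg (poly p a) \<noteq> 0" "sg (poly p b) \<noteq> 0" using ends by simp_all
  ultimately consider "sg (poly p a) = - 1" "sg (poly p b) = 1"
    | "sg (poly (- p) a) = - 1" "sg (poly (- p) b) = 1"
    using sg_cases[of "poly p a"] sg_cases[of "poly p b"] poly_closed[OF p] ab by auto
  then show False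
  proof cases
    case 1
    then show False using ivt[OF p ab] no_root by blast
  next
    case 2
    then show False
      using ivt[OF polys_over_uminus[OF subring p] ab] no_root by auto
  qed
qed

lemma sg_poly_eq_no_root:
  assumes p: "p \<in> polys_over F" and ab: "a \<in> F" "b \<in> F"
    and no_root: "\<And>c. c \<in> F \<Longrightarrow> poly p c \<noteq> 0"
  shows "sg (poly p a) = sg (poly p b)"
proof -
  consider "a = b" | "sg (b - a) = 1" | "sg (a - b) = 1"
    using sg_cases[of "b - a"] sg_minus_commute[OF ab] by fastforce
  then show ?thesis
  proof cases
    case 2
    then show ?thesis using sg_poly_eq_on_interval[OF p ab] no_root ab by blast
  next
    case 3
    then show ?thesis using sg_poly_eq_on_interval[OF p ab(2,1)] no_root ab by metis
  qed simp
qed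

text \<open>With the full multiplicities split off, f = (X - a)^m (X - b)^k g, and the derivative is
  (X - a)^(m-1) (X - b)^(k-1) u. As \<open>g\<close> has no root from \<open>a\<close> to
  \<open>b\<close>, its signs at the two ends agree, whereas u(a) = m (a - b) g(a) and u(b) = k (b -
  a) g(b) have opposite signs. So \<open>u\<close> has a root in between.\<close>

lemma rolle_adjacent:
  assumes f: "f \<in> polys_over F" "f \<noteq> 0" and ab: "a \<in> F" "b \<in> F" "sg (b - a) = 1"
    and roots: "poly f a = 0" "poly f b = 0"
    and adj: "\<And>c. c \<in> F \<Longrightarrow> sg (c - a) = 1 \<Longrightarrow> sg (b - c) = 1 \<Longrightarrow> poly f c \<noteq> 0"
  shows "\<exists>c\<in>F. sg (c - a) = 1 \<and> sg (b - c) = 1 \<and> poly (pderiv f) c = 0"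
proof -
  have "a \<noteq> b" using ab by auto
  obtain m h where h: "h \<in> polys_over F" "f = [:- a, 1:] ^ m * h" "poly h a \<noteq> 0"
    using split_root[OF f ab(1)] .
  have "h \<noteq> 0" using h(3) by auto
  obtain k g where g: "g \<in> polys_over F" "h = [:- b, 1:] ^ k * g" "poly g b \<noteq> 0"
    using split_root[OF h(1) \<open>h \<noteq> 0\<close> ab(2)] .
  have ga: "poly g a \<noteq> 0" using h(3) g(2) by auto
  have "m \<noteq> 0" using roots(1) h by (cases m) auto
  moreover have "k \<noteq> 0"
    using roots(2) h(2) g \<open>a \<noteq> b\<close> by (cases k) auto
  ultimately obtain m' k' where mk: "m = Suc m'" "k = Suc k'" by (metis not0_implies_Suc)
  have f_eq: "f = [:- a, 1:] ^ Suc m' * ([:- b, 1:] ^ Suc k' * g)"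
    using h(2) g(2) mk by simp
  define u where "u = smult (of_nat (Suc m')) ([:- b, 1:] * g) +
    smult (of_nat (Suc k')) ([:- a, 1:] * g) + [:- a, 1:] * [:- b, 1:] * pderiv g"
  have deriv: "pderiv f = [:- a, 1:] ^ m' * [:- b, 1:] ^ k' * u"
  proof -
    have "pderiv (A ^ Suc m' * (B ^ Suc k' * g)) = A ^ m' * B ^ k' *
        (smult (of_nat (Suc m')) (B * g) + smult (of_nat (Suc k')) (A * g) + A * B * pderiv g)"
      if "pderiv A = 1" "pderiv B = 1" for A B :: "'a poly"
      unfolding pderiv_mult pderiv_power_Suc that
      by (simp add: algebra_simps smult_add_right del: of_nat_Suc)
    moreover have "pderiv [:- c, 1:] = 1" for c :: 'a
      by (simp add: pderiv_pCons one_pCons)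
    ultimately show ?thesis
      unfolding f_eq u_def by blast
  qed
  have pd: "pderiv p \<in> polys_over F" if "p \<in> polys_over F" for p
    using that by (auto simp: polys_over_def coeff_pderiv simp del: of_nat_Suc
        intro!: closed unital_subring_of_nat[OF subring])
  have u: "u \<in> polys_over F"
    unfolding u_def
    by (intro polys_over_add polys_over_mult polys_over_smult polys_over_linear pd g(1) ab subring
        unital_subring_of_nat)
  have ua: "poly u a = of_nat (Suc m') * ((a - b) * poly g a)"
    and ub: "poly u b = of_nat (Suc k') * ((b - a) * poly g b)"
    by (simp_all add: u_def algebra_simps)
  have nat: "sg (of_nat (Suc n)) = 1" "of_nat n \<in> F" for n
    using cone_of_nat[of "Suc n"] unital_subring_of_nat[OF subring] by (simp_all add: sg_eq_1_iff del: of_nat_Suc)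
  have g_sgn: "sg (poly g a) = sg (poly g b)"
  proof (rule sg_poly_eq_on_interval[OF g(1) ab ga g(3)])
    fix c assume "c \<in> F" "sg (c - a) = 1" "sg (b - c) = 1"
    then show "poly g c \<noteq> 0" using adj[of c] by (auto simp: f_eq)
  qed
  have Fs: "poly g a \<in> F" "poly g b \<in> F" "b - a \<in> F" "a - b \<in> F"
    using poly_closed[OF g(1)] ab closed by auto
  have "sg (poly u a) = - sg (poly g a)" "sg (poly u b) = sg (poly g b)"
    using Fs nat ab sg_minus_commute[OF ab(1,2)]
    by (simp_all add: ua ub sg_mult closed del: of_nat_Suc)
  then have "sg (poly u a) \<noteq> sg (poly u b)" "poly u a \<noteq> 0" "poly u b \<noteq> 0"
    using g_sgn ga g(3) sg_eq_0_iff by (metis (no_types, lifting) equal_neg_zero neg_equal_0_iff_equal)+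
  then obtain c where "c \<in> F" "sg (c - a) = 1" "sg (b - c) = 1" "poly u c = 0"
    using sg_poly_eq_on_interval[OF u ab] by blast
  then show ?thesis by (intro bexI[of _ c]) (simp_all add: deriv)
qed

text \<open>Induction on the number of roots strictly between \<open>a\<close> and \<open>b\<close>:
  if there is such a root \<open>c\<close>, the interval from \<open>a\<close> to \<open>c\<close>
  contains fewer of them.\<close>

lemma rolle:
  assumes f: "f \<in> polys_over F" "f \<noteq> 0" and a: "a \<in> F" "poly f a = 0"
    and b: "b \<in> F" "poly f b = 0" "sg (b - a) = 1"
  shows "\<exists>c\<in>F. sg (c - a) = 1 \<and> sg (b - c) = 1 \<and> poly (pderiv f) c = 0"
  using b
proof (induction "card {c \<in> F. poly f c = 0 \<and> sg (c - a) = 1 \<and> sg (b - c) = 1}"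
    arbitrary: b rule: less_induct)
  case less
  show ?case
  proof (cases "\<exists>c\<in>F. poly f c = 0 \<and> sg (c - a) = 1 \<and> sg (b - c) = 1")
    case False
    then show ?thesis using rolle_adjacent[OF f a(1) less.prems(1,3) a(2) less.prems(2)] by blast
  next
    case True
    then obtain c where c: "c \<in> F" "poly f c = 0" "sg (c - a) = 1" "sg (b - c) = 1" by blast
    define R where "R b = {c \<in> F. poly f c = 0 \<and> sg (c - a) = 1 \<and> sg (b - c) = 1}" for b
    have "finite (R b)"
      using finite_subset[OF _ poly_roots_finite[OF f(2)], of "R b"] by (auto simp: R_def)
    moreover have "R c \<subseteq> R b" "c \<in> R b" "c \<notin> R c"
      using c less_trans[OF _ c(1) less.prems(1) _ c(4)] by (auto simp: R_def)
    ultimately have "card (R c) < card (R b)"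
      by (intro psubset_card_mono) auto
    from less.hyps[OF this[unfolded R_def] c(1-3)] show ?thesis
      using less_trans[OF _ c(1) less.prems(1) _ c(4)] by blast
  qed
qed

text \<open>A second root would produce a critical point by Rolle's theorem, and a multiple root
  would be one itself. So the cofactor of \<open>X - \<theta>\<close> in \<open>f\<close> keeps its
  sign from \<open>d\<close> to \<open>e\<close>. Consequently the sign of \<open>f\<close> at a
  point tells on which side of \<open>\<theta>\<close> the point lies.\<close>

lemma sg_poly_near_simple_root:
  assumes f: "f \<in> polys_over F" and \<theta>: "\<theta> \<in> F" "poly f \<theta> = 0"
    and de: "d \<in> F" "e \<in> F" "sg (\<theta> - d) = 1" "sg (e - \<theta>) = 1" "poly f d \<noteq> 0" "poly f e \<noteq> 0"
    and crit: "\<And>c. c \<in> F \<Longrightarrow> sg (c - d) = 1 \<Longrightarrow> sg (e - c) = 1 \<Longrightarrow> poly (pderiv f) c \<noteq> 0"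
    and x: "x \<in> F" "sg (x - d) \<noteq> - 1" "sg (e - x) \<noteq> - 1"
  shows "sg (poly f x) = sg (x - \<theta>) * sg (poly f e)"
proof -
  define g where "g = synthetic_div f \<theta>"
  have fg: "f = [:- \<theta>, 1:] * g"
    using synthetic_div_correct'[of \<theta> f] \<theta> by (simp add: g_def)
  have g: "g \<in> polys_over F" unfolding g_def by (rule synthetic_div_polys_over[OF subring f \<theta>(1)])
  have f0: "f \<noteq> 0" using de by auto
  have cl: "sg (c - d) = 1" if "c \<in> F" "c \<noteq> d" "sg (c - d) \<noteq> - 1" for c
    using that sg_cases[of "c - d"] by auto
  have cr: "sg (e - c) = 1" if "c \<in> F" "c \<noteq> e" "sg (e - c) \<noteq> - 1" for c
    using that sg_cases[of "e - c"] by auto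
  have no_root: "poly g c \<noteq> 0" if c: "c \<in> F" "sg (c - d) \<noteq> - 1" "sg (e - c) \<noteq> - 1" for c
  proof
    assume root: "poly g c = 0"
    then have fc: "poly f c = 0" by (simp add: fg)
    then have c': "sg (c - d) = 1" "sg (e - c) = 1" using cl cr c de by blast+
    have "pderiv f = [:- \<theta>, 1:] * pderiv g + g"
      unfolding fg pderiv_mult by (simp add: pderiv_pCons)
    moreover have "poly (pderiv f) \<theta> \<noteq> 0" using crit \<theta>(1) de by blast
    ultimately have "c \<noteq> \<theta>" using root by auto
    then consider "sg (\<theta> - c) = 1" | "sg (c - \<theta>) = 1"
      using sg_cases[of "c - \<theta>"] sg_minus_commute[OF c(1) \<theta>(1)] by fastforce
    then show False
    proof cases
      case 1
      obtain z where "z \<in> F" "sg (z - c) = 1" "sg (\<theta> - z) = 1" "poly (pderiv f) z = 0"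
        using rolle[OF f f0 c(1) fc \<theta> 1] by blast
      then show False
        using crit less_trans[OF de(1) c(1) _ c'(1)] less_trans[OF _ \<theta>(1) de(2) _ de(4)] by blast
    next
      case 2
      obtain z where "z \<in> F" "sg (z - \<theta>) = 1" "sg (c - z) = 1" "poly (pderiv f) z = 0"
        using rolle[OF f f0 \<theta> c(1) fc 2] by blast
      then show False
        using crit less_trans[OF de(1) \<theta>(1) _ de(3)] less_trans[OF _ c(1) de(2) _ c'(2)] by blast
    qed
  qed
  have "sg (e - d) = 1" using less_trans[OF de(1) \<theta>(1) de(2,3,4)] .
  then have e: "sg (e - d) \<noteq> - 1" "sg (e - e) \<noteq> - 1" by simp_all
  have "sg (poly g x) = sg (poly g e)"
  proof (cases "x = e")
    case False
    then have xe: "sg (e - x) = 1" using cr x by blast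
    show ?thesis
    proof (rule sg_poly_eq_on_interval[OF g x(1) de(2) xe])
      show "poly g x \<noteq> 0" "poly g e \<noteq> 0" using no_root x de(2) e by blast+
      fix c assume c: "c \<in> F" "sg (c - x) = 1" "sg (e - c) = 1"
      have "sg (c - d) = 1"
        using cl[OF x(1) _ x(2)] less_trans[OF de(1) x(1) c(1) _ c(2)] c(2) by (cases "x = d") auto
      then show "poly g c \<noteq> 0" using no_root[OF c(1)] c(3) by simp
    qed
  qed simp
  moreover have "poly f x = (x - \<theta>) * poly g x" "poly f e = (e - \<theta>) * poly g e"
    by (simp_all add: fg algebra_simps)
  ultimately show ?thesis
    using x de \<theta> poly_closed[OF g] by (simp add: sg_mult closed)
qed

end

section \<open>Extending order isomorphisms: algebraic elements by degree, all others by
  cuts\<close>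

section \<open>Order isomorphisms between subrings of two real closed fields\<close>

lemma unital_subring_fst:
  assumes "unital_subring G"
  shows "unital_subring (fst ` G)"
proof -
  have "fst z - fst w \<in> fst ` G" "fst z * fst w \<in> fst ` G" if "z \<in> G" "w \<in> G" for z w
    using assms that by (auto simp: unital_subring_def simp flip: fst_diff fst_times)
  moreover have "1 \<in> fst ` G"
    using assms by (auto simp: unital_subring_def intro: image_eqI[of _ _ 1])
  ultimately show ?thesis by (auto simp: unital_subring_def)
qed

locale real_closed_pair =
  A: real_closed_subfield F1 T1 + B: real_closed_subfield F2 T2
  for F1 T1 :: "'a::field_char_0 set" and F2 T2 :: "'b::field_char_0 set"
begin

definition same_sign :: "'a \<times> 'b \<Rightarrow> bool" where
  "same_sign z \<longleftrightarrow> fst z \<in> F1 \<and> snd z \<in> F2 \<and> A.sg (fst z) = B.sg (snd z)"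

text \<open>Only 0 has sign 0, so agreement of signs on differences makes \<open>G\<close> the graph
  of a bijection between its two projections, and this bijection is an order isomorphism of
  rings.\<close>

definition partial_iso :: "('a \<times> 'b) set \<Rightarrow> bool" where
  "partial_iso G \<longleftrightarrow> unital_subring G \<and> (\<forall>z\<in>G. same_sign z)"

definition maximal_iso :: "('a \<times> 'b) set \<Rightarrow> bool" where
  "maximal_iso G \<longleftrightarrow> partial_iso G \<and> (\<forall>H. partial_iso H \<longrightarrow> G \<subseteq> H \<longrightarrow> H = G)"

lemma same_sign_mult: "same_sign z \<Longrightarrow> same_sign w \<Longrightarrow> same_sign (z * w)"
  by (simp add: same_sign_def A.sg_mult B.sg_mult A.closed B.closed)

lemma same_sign_cancel:
  assumes "same_sign c" "fst c \<noteq> 0" "same_sign (c * w)" "fst w \<in> F1" "snd w \<in> F2"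
  shows "same_sign w"
proof -
  have "A.sg (fst c) \<noteq> 0" using assms(2) by simp
  moreover have "A.sg (fst c) * A.sg (fst w) = A.sg (fst c) * B.sg (snd w)"
    using assms A.sg_mult[of "fst c" "fst w"] B.sg_mult[of "snd c" "snd w"]
    by (simp add: same_sign_def)
  ultimately show ?thesis
    using assms(4,5) by (simp add: same_sign_def)
qed

lemma partial_isoD:
  assumes "partial_iso G"
  shows "unital_subring G" and "z \<in> G \<Longrightarrow> same_sign z"
    and "z \<in> G \<Longrightarrow> fst z \<in> F1" and "z \<in> G \<Longrightarrow> snd z \<in> F2"
    and "z \<in> G \<Longrightarrow> A.sg (fst z) = B.sg (snd z)"
  using assms by (auto simp: partial_iso_def same_sign_def)

lemma partial_iso_zero:
  assumes "partial_iso G" "z \<in> G"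
  shows "fst z = 0 \<longleftrightarrow> z = 0" and "snd z = 0 \<longleftrightarrow> z = 0"
proof -
  have "fst z = 0 \<longleftrightarrow> snd z = 0"
    using partial_isoD(5)[OF assms] A.sg_eq_0_iff B.sg_eq_0_iff by metis
  then show "fst z = 0 \<longleftrightarrow> z = 0" "snd z = 0 \<longleftrightarrow> z = 0"
    by (auto simp: prod_eq_iff)
qed

lemma partial_iso_poly:
  assumes G: "partial_iso G" and p: "p \<in> polys_over G"
  shows "fst_poly p \<in> polys_over F1" "snd_poly p \<in> polys_over F2"
    "degree (fst_poly p) = degree p" "degree (snd_poly p) = degree p"
    "fst_poly p = 0 \<longleftrightarrow> p = 0" "snd_poly p = 0 \<longleftrightarrow> p = 0"
proof -
  have c: "coeff p i \<in> G" for i using p by (simp add: polys_over_def)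
  show "fst_poly p \<in> polys_over F1" "snd_poly p \<in> polys_over F2"
    using c partial_isoD[OF G] by (auto simp: polys_over_def)
  have z: "fst (coeff p i) = 0 \<longleftrightarrow> coeff p i = 0" "snd (coeff p i) = 0 \<longleftrightarrow> coeff p i = 0" for i
    using partial_iso_zero[OF G c] by blast+
  show "fst_poly p = 0 \<longleftrightarrow> p = 0" "snd_poly p = 0 \<longleftrightarrow> p = 0"
    by (simp_all add: poly_eq_iff z)
  show "degree (fst_poly p) = degree p" unfolding Polynomial.degree_def by (simp add: z)
  show "degree (snd_poly p) = degree p" unfolding Polynomial.degree_def by (simp add: z)
qed

lemma partial_iso_Union:
  assumes "C \<noteq> {}" "subset.chain {G. partial_iso G} C"
  shows "partial_iso (\<Union>C)"
proof -
  have *: "partial_iso S" if "S \<in> C" for S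
    using assms(2) that by (auto simp: subset.chain_def)
  then have "unital_subring (\<Union>C)"
    using unital_subring_Union_chain[OF assms] partial_isoD(1) by blast
  then show ?thesis using * by (auto simp: partial_iso_def)
qed

lemma maximal_iso_exists:
  assumes "partial_iso G0"
  obtains G where "maximal_iso G" "G0 \<subseteq> G"
proof -
  let ?A = "{G. partial_iso G \<and> G0 \<subseteq> G}"
  have "\<exists>M\<in>?A. \<forall>X\<in>?A. M \<subseteq> X \<longrightarrow> X = M"
  proof (rule subset_Zorn_nonempty)
    show "?A \<noteq> {}" using assms by blast
    fix C assume C: "C \<noteq> {}" "subset.chain ?A C"
    then have "partial_iso (\<Union>C)"
      by (intro partial_iso_Union) (auto simp: subset.chain_def)
    moreover have "G0 \<subseteq> \<Union>C"
      using C unfolding subset.chain_def by blast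
    ultimately show "\<Union>C \<in> ?A" by blast
  qed
  then obtain M where "partial_iso M" "G0 \<subseteq> M" "\<forall>X\<in>?A. M \<subseteq> X \<longrightarrow> X = M"
    by blast
  then show ?thesis
    using that[of M] by (auto simp: maximal_iso_def)
qed

lemma maximal_isoI:
  assumes G: "maximal_iso G" and "\<And>p. p \<in> polys_over G \<Longrightarrow> same_sign (poly p z)"
  shows "z \<in> G"
proof -
  have S: "unital_subring G" using G by (simp add: maximal_iso_def partial_iso_def)
  have "partial_iso (adjoin G z)"
    using assms(2) unital_subring_adjoin[OF S] by (auto simp: partial_iso_def adjoin_def)
  then have "adjoin G z = G"
    using G subset_adjoin[OF S] by (simp add: maximal_iso_def)
  then show ?thesis using in_adjoin[OF S] by blast
qed

text \<open>A polynomial value at 1/z, multiplied by a power of \<open>z\<close>, lies in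
  \<open>G\<close>, where signs agree. The power of \<open>z\<close> has matching nonzero signs as
  well and can be cancelled.\<close>

lemma maximal_iso_inverse:
  assumes G: "maximal_iso G" and z: "z \<in> G" "fst z \<noteq> 0"
  shows "(inverse (fst z), inverse (snd z)) \<in> G"
proof (rule maximal_isoI[OF G])
  have P: "partial_iso G" using G by (simp add: maximal_iso_def)
  note S = partial_isoD(1)[OF P]
  let ?w = "(inverse (fst z), inverse (snd z))"
  have "snd z \<noteq> 0" using partial_iso_zero[OF P z(1)] z(2) by simp
  then have inv: "z * ?w = 1" using z(2) by (simp add: prod_eq_iff)
  fix p assume p: "p \<in> polys_over G"
  obtain n where n: "z ^ n * poly p ?w \<in> G"
    using power_mult_poly_inverse[OF S inv z(1) p] by blast
  have zn: "z ^ n \<in> G" by (rule unital_subring_power[OF S z(1)])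
  have "fst (z ^ n) \<noteq> 0" using z(2) by (induction n) auto
  moreover have "fst (poly p ?w) \<in> F1" "snd (poly p ?w) \<in> F2"
    using partial_iso_poly(1,2)[OF P p] partial_isoD(3,4)[OF P z(1)]
    by (auto simp: fst_poly_eval snd_poly_eval intro: A.poly_closed B.poly_closed A.closed B.closed)
  ultimately show "same_sign (poly p ?w)"
    using same_sign_cancel partial_isoD(2)[OF P] n zn by blast
qed

text \<open>The induction hypothesis for algebraic elements. Both fields are included, since a sign
  can be transferred only if neither of them contains an unmatched root.\<close>

definition roots_matched :: "('a \<times> 'b) set \<Rightarrow> nat \<Rightarrow> bool" where
  "roots_matched G n \<longleftrightarrow> (\<forall>p\<in>polys_over G. p \<noteq> 0 \<longrightarrow> degree p < n \<longrightarrow>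
     (\<forall>x\<in>F1. poly (fst_poly p) x = 0 \<longrightarrow> x \<in> fst ` G) \<and>
     (\<forall>x\<in>F2. poly (snd_poly p) x = 0 \<longrightarrow> x \<in> snd ` G))"

lemma roots_matchedD:
  assumes "roots_matched G n" "p \<in> polys_over G" "p \<noteq> 0" "degree p < n"
  shows "x \<in> F1 \<Longrightarrow> poly (fst_poly p) x = 0 \<Longrightarrow> x \<in> fst ` G"
    and "y \<in> F2 \<Longrightarrow> poly (snd_poly p) y = 0 \<Longrightarrow> y \<in> snd ` G"
  using assms unfolding roots_matched_def by blast+

text \<open>The sign at \<open>\<theta>\<close> is decided inside \<open>G\<close>. If
  \<open>p\<close> has a root in \<open>G\<close>, it loses a linear factor whose sign is given by
  \<open>cut\<close>. Otherwise, roots being matched, \<open>p\<close> has no root in either field,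
  and its sign is everywhere that at 0.\<close>

lemma same_sign_poly:
  assumes G: "partial_iso G" and roots: "roots_matched G n"
    and \<theta>: "fst \<theta> \<in> F1" "snd \<theta> \<in> F2" and cut: "\<And>z. z \<in> G \<Longrightarrow> same_sign (\<theta> - z)"
    and "p \<in> polys_over G" "degree p < n"
  shows "same_sign (poly p \<theta>)"
  using assms(6,7)
proof (induction "degree p" arbitrary: p rule: less_induct)
  case less
  note S = partial_isoD(1)[OF G]
  show ?case
  proof (cases "degree p = 0")
    case True
    then obtain c where c: "p = [:c:]" by (rule degree_eq_zeroE)
    then have "c \<in> G" using less.prems(1) by (simp add: polys_over_pCons_iff S)
    then show ?thesis using partial_isoD(2)[OF G] c by simp
  next
    case False
    show ?thesis
    proof (cases "\<exists>r\<in>G. poly p r = 0")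
      case True
      then obtain r where r: "r \<in> G" "poly p r = 0" by blast
      define q where "q = synthetic_div p r"
      have pq: "p = [:- r, 1:] * q"
        using synthetic_div_correct'[of r p] r by (simp add: q_def)
      have "degree q < degree p" unfolding q_def degree_synthetic_div using False by simp
      moreover have "q \<in> polys_over G"
        unfolding q_def by (rule synthetic_div_polys_over[OF S less.prems(1) r(1)])
      ultimately have "same_sign (poly q \<theta>)"
        using less.hyps less.prems(2) by simp
      moreover have "poly p \<theta> = (\<theta> - r) * poly q \<theta>" by (simp add: pq algebra_simps)
      ultimately show ?thesis using cut[OF r(1)] same_sign_mult by simp
    next
      case no: False
      have "p \<noteq> 0" using False by auto
      note pp = partial_iso_poly[OF G less.prems(1)]
      have in_G: "poly p r \<in> G" if "r \<in> G" for r using poly_in_subring[OF S less.prems(1) that] .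
      have "poly (fst_poly p) x \<noteq> 0" if x: "x \<in> F1" for x
      proof
        assume 0: "poly (fst_poly p) x = 0"
        then obtain r where "r \<in> G" "x = fst r"
          using roots_matchedD(1)[OF roots less.prems(1) \<open>p \<noteq> 0\<close> less.prems(2) x 0] by blast
        then show False
          using no 0 partial_iso_zero(1)[OF G in_G] by (metis fst_poly_eval)
      qed
      then have 1: "A.sg (poly (fst_poly p) (fst \<theta>)) = A.sg (poly (fst_poly p) 0)"
        using A.sg_poly_eq_no_root pp(1) \<theta>(1) A.closed by blast
      have "poly (snd_poly p) x \<noteq> 0" if x: "x \<in> F2" for x
      proof
        assume 0: "poly (snd_poly p) x = 0"
        then obtain r where "r \<in> G" "x = snd r"
          using roots_matchedD(2)[OF roots less.prems(1) \<open>p \<noteq> 0\<close> less.prems(2) x 0] by blast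
        then show False
          using no 0 partial_iso_zero(2)[OF G in_G] by (metis snd_poly_eval)
      qed
      then have 2: "B.sg (poly (snd_poly p) (snd \<theta>)) = B.sg (poly (snd_poly p) 0)"
        using B.sg_poly_eq_no_root pp(2) \<theta>(2) B.closed by blast
      have "A.sg (poly (fst_poly p) 0) = B.sg (poly (snd_poly p) 0)"
        using partial_isoD(5)[OF G in_G[OF unital_subring_zero[OF S]]]
        by (simp add: fst_poly_eval snd_poly_eval)
      then show ?thesis
        using 1 2 pp(1,2) \<theta>
        by (simp add: same_sign_def fst_poly_eval snd_poly_eval A.poly_closed B.poly_closed)
    qed
  qed
qed

text \<open>A root of \<open>f\<close> strictly between the end points lies in the projection of
  \<open>G\<close> and so differs from \<open>\<theta>\<close>; hence it can replace the end point
  on its side of \<open>\<theta>\<close>, which lowers the number of roots inside.\<close>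

lemma interval_without_roots:
  assumes G: "partial_iso G" and \<theta>: "\<theta> \<in> F1" "\<theta> \<notin> fst ` G" and f: "f \<noteq> 0"
    and roots: "\<And>x. x \<in> F1 \<Longrightarrow> poly f x = 0 \<Longrightarrow> x \<in> fst ` G"
    and de: "d \<in> G" "e \<in> G" "A.sg (\<theta> - fst d) = 1" "A.sg (fst e - \<theta>) = 1"
  obtains d' e' where "d' \<in> G" "e' \<in> G" "A.sg (\<theta> - fst d') = 1" "A.sg (fst e' - \<theta>) = 1"
    "\<And>c. c \<in> F1 \<Longrightarrow> A.sg (c - fst d') = 1 \<Longrightarrow> A.sg (fst e' - c) = 1 \<Longrightarrow> poly f c \<noteq> 0"
proof -
  define R where "R d e = {c \<in> F1. poly f c = 0 \<and> A.sg (c - fst d) = 1 \<and> A.sg (fst e - c) = 1}"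
    for d e :: "'a \<times> 'b"
  have "\<exists>d'\<in>G. \<exists>e'\<in>G. A.sg (\<theta> - fst d') = 1 \<and> A.sg (fst e' - \<theta>) = 1 \<and> R d' e' = {}"
    using de
  proof (induction "card (R d e)" arbitrary: d e rule: less_induct)
    case less
    have dF: "fst d \<in> F1" "fst e \<in> F1" using less.prems partial_isoD(3)[OF G] by auto
    show ?case
    proof (cases "R d e = {}")
      case False
      then obtain r where r: "r \<in> G" "fst r \<in> R d e" using roots unfolding R_def by blast
      then have rF: "fst r \<in> F1" "A.sg (fst r - fst d) = 1" "A.sg (fst e - fst r) = 1"
        by (auto simp: R_def)
      have fin: "finite (R d e)"
        by (rule finite_subset[OF _ poly_roots_finite[OF f]]) (auto simp: R_def)
      have "fst r \<noteq> \<theta>" using \<theta>(2) r(1) by auto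
      then consider "A.sg (\<theta> - fst r) = 1" | "A.sg (fst r - \<theta>) = 1"
        using A.sg_cases[of "fst r - \<theta>"] A.sg_minus_commute[OF rF(1) \<theta>(1)] by fastforce
      then show ?thesis
      proof cases
        case 1
        have "R r e \<subseteq> R d e" "fst r \<notin> R r e"
          using A.less_trans[OF dF(1) rF(1) _ rF(2)] by (auto simp: R_def)
        then have "card (R r e) < card (R d e)" using fin r(2) by (intro psubset_card_mono) auto
        then show ?thesis using less.hyps r(1) less.prems 1 by blast
      next
        case 2
        have "R d r \<subseteq> R d e" "fst r \<notin> R d r"
          using A.less_trans[OF _ rF(1) dF(2) _ rF(3)] by (auto simp: R_def)
        then have "card (R d r) < card (R d e)" using fin r(2) by (intro psubset_card_mono) auto
        then show ?thesis using less.hyps r(1) less.prems 2 by blast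
      qed
    qed (use less.prems in blast)
  qed
  then show ?thesis using that unfolding R_def by blast
qed

text \<open>If roots of polynomials of smaller degree are matched, then so are critical points. Between
  neighbouring critical points a root of \<open>p\<close> is characterised by a sign change.\<close>

lemma match_root:
  assumes G: "maximal_iso G" and p: "p \<in> polys_over G" "p \<noteq> 0"
    and roots: "roots_matched G (degree p)"
    and \<theta>: "\<theta> \<in> F1" "\<theta> \<notin> fst ` G" "poly (fst_poly p) \<theta> = 0"
  shows "\<exists>\<theta>'. \<forall>q\<in>polys_over G. same_sign (poly q (\<theta>, \<theta>'))"
proof -
  have P: "partial_iso G" using G by (simp add: maximal_iso_def)
  note S = partial_isoD(1)[OF P]
  define f1 f2 where "f1 = fst_poly p" and "f2 = snd_poly p"
  have pp: "f1 \<in> polys_over F1" "f2 \<in> polys_over F2" "degree f1 = degree p" "f1 \<noteq> 0" "f2 \<noteq> 0"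
    using partial_iso_poly[OF P p(1)] p(2) by (simp_all add: f1_def f2_def)
  have GF: "fst z \<in> F1" "snd z \<in> F2" if "z \<in> G" for z using partial_isoD[OF P] that by auto
  have sgG: "A.sg (fst z) = B.sg (snd z)" if "z \<in> G" for z using partial_isoD(5)[OF P that] .
  have deg: "degree p > 0"
  proof (rule ccontr)
    assume "\<not> ?thesis"
    then obtain c where "f1 = [:c:]" using pp(3) by (metis degree_eq_zeroE gr0I)
    then show False using \<theta>(3) pp(4) by (simp add: f1_def)
  qed
  \<comment> \<open>A root of \<open>p\<close> in \<open>G\<close> would leave a quotient of smaller
    degree that vanishes at \<open>\<theta>\<close>, and \<open>\<theta>\<close> would be matched
    already.\<close>
  have no_root: "poly f1 (fst r) \<noteq> 0" "poly f2 (snd r) \<noteq> 0" if r: "r \<in> G" for r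
  proof -
    have "poly p r \<noteq> 0"
    proof
      assume "poly p r = 0"
      define q where "q = synthetic_div p r"
      have pq: "p = [:- r, 1:] * q"
        using synthetic_div_correct'[of r p] \<open>poly p r = 0\<close> by (simp add: q_def)
      have q: "q \<in> polys_over G" "degree q < degree p" "q \<noteq> 0"
        using deg synthetic_div_polys_over[OF S p(1) r] degree_synthetic_div[of p r]
          synthetic_div_eq_0_iff[of p r] by (auto simp: q_def)
      have "f1 = [:- fst r, 1:] * fst_poly q"
        unfolding f1_def pq fst_poly_hom by (simp add: map_poly_pCons)
      moreover have "\<theta> \<noteq> fst r" using \<theta>(2) r by auto
      moreover have "poly ([:- fst r, 1:] * g) \<theta> = (\<theta> - fst r) * poly g \<theta>" for g
        by (simp add: algebra_simps)
      ultimately have "poly (fst_poly q) \<theta> = 0"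
        using \<theta>(3) unfolding f1_def by (metis mult_eq_0_iff right_minus_eq)
      then show False using roots_matchedD(1)[OF roots q(1,3,2) \<theta>(1)] \<theta>(2) by blast
    qed
    then have "fst (poly p r) \<noteq> 0" "snd (poly p r) \<noteq> 0"
      using partial_iso_zero[OF P poly_in_subring[OF S p(1) r]] by simp_all
    then show "poly f1 (fst r) \<noteq> 0" "poly f2 (snd r) \<noteq> 0"
      by (simp_all add: f1_def f2_def fst_poly_eval snd_poly_eval)
  qed
  have sgp: "A.sg (poly f1 (fst r)) = B.sg (poly f2 (snd r))" if "r \<in> G" for r
    using sgG[OF poly_in_subring[OF S p(1) that]] by (simp add: f1_def f2_def fst_poly_eval snd_poly_eval)
  obtain dp where dp: "dp \<in> polys_over G" "fst_poly dp = pderiv f1" "snd_poly dp = pderiv f2"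
    using pderiv_pair[OF S p(1)] unfolding f1_def f2_def .
  have dp': "dp \<noteq> 0" "degree dp < degree p"
    using partial_iso_poly[OF P dp(1)] deg pp(3) dp(2) degree_pderiv[of f1] pderiv_eq_0_iff[of f1]
    by auto
  have crit1: "x \<in> fst ` G" if "x \<in> F1" "poly (pderiv f1) x = 0" for x
    using roots_matchedD(1)[OF roots dp(1) dp' that(1)] dp(2) that(2) by simp
  have crit2: "x \<in> snd ` G" if "x \<in> F2" "poly (pderiv f2) x = 0" for x
    using roots_matchedD(2)[OF roots dp(1) dp' that(1)] dp(3) that(2) by simp
  \<comment> \<open>By maximality the first projection of \<open>G\<close> is a field, so the root
    bound can be found inside it; \<open>- b\<close> and \<open>b\<close> are the initial end points
    around \<open>\<theta>\<close>.\<close>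
  obtain b where b: "b \<in> G" "A.sg (fst b - \<theta>) = 1" "A.sg (\<theta> - fst (- b)) = 1"
  proof -
    have "unital_subring (fst ` G)"
      by (rule unital_subring_fst[OF S])
    moreover have "inverse x \<in> fst ` G" if x: "x \<in> fst ` G" for x
    proof (cases "x = 0")
      case False
      then show ?thesis using x maximal_iso_inverse[OF G] by (force simp: image_iff)
    qed (use x in simp)
    moreover have "f1 \<in> polys_over (fst ` G)" unfolding f1_def by (rule polys_over_fst[OF p(1)])
    moreover have "fst ` G \<subseteq> F1" using GF by auto
    ultimately obtain B where "B \<in> fst ` G"
      "\<And>x. x \<in> F1 \<Longrightarrow> poly f1 x = 0 \<Longrightarrow> A.sg (B - x) = 1 \<and> A.sg (x - - B) = 1"
      using A.root_bound[of "fst ` G" f1] pp(4) by blast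
    then show ?thesis using that \<theta> by (auto simp: f1_def)
  qed
  have "pderiv f1 \<noteq> 0" using pderiv_eq_0_iff[of f1] deg pp(3) by simp
  then obtain d e where de: "d \<in> G" "e \<in> G" "A.sg (\<theta> - fst d) = 1" "A.sg (fst e - \<theta>) = 1"
    and nc1: "\<And>c. c \<in> F1 \<Longrightarrow> A.sg (c - fst d) = 1 \<Longrightarrow> A.sg (fst e - c) = 1 \<Longrightarrow> poly (pderiv f1) c \<noteq> 0"
    using interval_without_roots[OF P \<theta>(1,2) _ crit1 unital_subring_uminus[OF S b(1)] b(1,3,2)] by blast
  note diff = unital_subring_diff[OF S]
  have nc2: "poly (pderiv f2) c \<noteq> 0"
    if c: "c \<in> F2" "B.sg (c - snd d) = 1" "B.sg (snd e - c) = 1" for c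
  proof
    assume 0: "poly (pderiv f2) c = 0"
    then obtain r where r: "r \<in> G" "c = snd r" using crit2 c(1) by blast
    have "snd (poly dp r) = 0" using 0 r dp by (simp add: snd_poly_eval)
    then have "fst (poly dp r) = 0"
      using partial_iso_zero[OF P poly_in_subring[OF S dp(1) r(1)]] by simp
    then have "poly (pderiv f1) (fst r) = 0" by (simp add: fst_poly_eval dp)
    moreover have "A.sg (fst r - fst d) = 1" "A.sg (fst e - fst r) = 1"
      using sgG[OF diff[OF r(1) de(1)]] sgG[OF diff[OF de(2) r(1)]] c r by simp_all
    ultimately show False using nc1 GF r(1) by blast
  qed
  have deF: "fst d \<in> F1" "fst e \<in> F1" "snd d \<in> F2" "snd e \<in> F2" using GF de by auto
  have d_less_e: "A.sg (fst e - fst d) = 1"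
    using A.less_trans[OF deF(1) \<theta>(1) deF(2) de(3,4)] .
  have f\<theta>: "poly f1 \<theta> = 0" using \<theta>(3) by (simp add: f1_def)
  have near1: "A.sg (poly f1 x) = A.sg (x - \<theta>) * A.sg (poly f1 (fst e))"
    if "x \<in> F1" "A.sg (x - fst d) \<noteq> - 1" "A.sg (fst e - x) \<noteq> - 1" for x
    by (rule A.sg_poly_near_simple_root[OF pp(1) \<theta>(1) f\<theta> deF(1,2) de(3,4) no_root(1)[OF de(1)]
          no_root(1)[OF de(2)]]) (use nc1 that in blast)+
  \<comment> \<open>Without critical points nearby, \<open>\<theta>\<close> is a simple root, so
    \<open>f1\<close> has opposite signs at the end points. These lie in \<open>G\<close>, so
    \<open>f2\<close> has opposite signs too and acquires a root \<open>\<theta>'\<close> between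
    their second components.\<close>
  have "A.sg (poly f1 (fst d)) = A.sg (fst d - \<theta>) * A.sg (poly f1 (fst e))"
    using near1[OF deF(1)] d_less_e by simp
  then have "A.sg (poly f1 (fst d)) \<noteq> A.sg (poly f1 (fst e))"
    using de(3) A.sg_minus_commute[OF deF(1) \<theta>(1)] no_root(1)[OF de(2)] by simp
  then have "B.sg (poly f2 (snd d)) \<noteq> B.sg (poly f2 (snd e))"
    using sgp de by simp
  moreover have "B.sg (snd e - snd d) = 1"
    using sgG[OF diff[OF de(2,1)]] d_less_e by simp
  ultimately obtain \<theta>' where \<theta>': "\<theta>' \<in> F2" "B.sg (\<theta>' - snd d) = 1" "B.sg (snd e - \<theta>') = 1" "poly f2 \<theta>' = 0"
    using B.sg_poly_eq_on_interval[OF pp(2) deF(3,4)] no_root(2) de by blast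
  have near2: "B.sg (poly f2 x) = B.sg (x - \<theta>') * B.sg (poly f2 (snd e))"
    if "x \<in> F2" "B.sg (x - snd d) \<noteq> - 1" "B.sg (snd e - x) \<noteq> - 1" for x
    by (rule B.sg_poly_near_simple_root[OF pp(2) \<theta>'(1,4) deF(3,4) \<theta>'(2,3) no_root(2)[OF de(1)]
          no_root(2)[OF de(2)]]) (use nc2 that in blast)+
  let ?\<theta> = "(\<theta>, \<theta>')"
  \<comment> \<open>For \<open>z\<close> outside of the interval the comparison with the root
    follows from that with an end point. For \<open>z\<close> inside, the sign of \<open>p\<close>
    at \<open>z\<close>, equal in both fields, tells on which side of the root \<open>z\<close>
    lies.\<close>
  have cut: "same_sign (?\<theta> - z)" if z: "z \<in> G" for z
  proof -
    have zF: "fst z \<in> F1" "snd z \<in> F2" using GF z by auto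
    have zd: "A.sg (fst z - fst d) = B.sg (snd z - snd d)" "A.sg (fst e - fst z) = B.sg (snd e - snd z)"
      using sgG[OF diff[OF z de(1)]] sgG[OF diff[OF de(2) z]] by simp_all
    have "A.sg (\<theta> - fst z) = B.sg (\<theta>' - snd z)"
    proof (cases "A.sg (fst z - fst d) = - 1 \<or> A.sg (fst e - fst z) = - 1")
      case True
      then show ?thesis
      proof
        assume "A.sg (fst z - fst d) = - 1"
        then have "A.sg (fst d - fst z) = 1" "B.sg (snd d - snd z) = 1"
          using A.sg_minus_commute[OF zF(1) deF(1)] B.sg_minus_commute[OF zF(2) deF(3)] zd by simp_all
        then show ?thesis
          using A.less_trans[OF zF(1) deF(1) \<theta>(1) _ de(3)] B.less_trans[OF zF(2) deF(3) \<theta>'(1) _ \<theta>'(2)] by simp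
      next
        assume "A.sg (fst e - fst z) = - 1"
        then have "A.sg (fst z - fst e) = 1" "B.sg (snd z - snd e) = 1"
          using A.sg_minus_commute[OF zF(1) deF(2)] B.sg_minus_commute[OF zF(2) deF(4)] zd by simp_all
        then show ?thesis
          using A.less_trans[OF \<theta>(1) deF(2) zF(1) de(4)] B.less_trans[OF \<theta>'(1) deF(4) zF(2) \<theta>'(3)]
            A.sg_minus_commute[OF \<theta>(1) zF(1)] B.sg_minus_commute[OF \<theta>'(1) zF(2)] by simp
      qed
    next
      case False
      then have "A.sg (poly f1 (fst z)) = A.sg (fst z - \<theta>) * A.sg (poly f1 (fst e))"
        "B.sg (poly f2 (snd z)) = B.sg (snd z - \<theta>') * B.sg (poly f2 (snd e))"
        using near1[OF zF(1)] near2[OF zF(2)] zd by auto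
      then have "A.sg (fst z - \<theta>) = B.sg (snd z - \<theta>')"
        using sgp[OF z] sgp[OF de(2)] no_root[OF de(2)] by simp
      then show ?thesis
        using A.sg_minus_commute[OF \<theta>(1) zF(1)] B.sg_minus_commute[OF \<theta>'(1) zF(2)] by simp
    qed
    then show ?thesis
      using zF \<theta>(1) \<theta>'(1) A.closed B.closed by (simp add: same_sign_def)
  qed
  \<comment> \<open>Pseudo-division by \<open>p\<close> leads to a degree below that of
    \<open>p\<close>, where roots are matched; the power of the leading coefficient lies in
    \<open>G\<close> and is cancelled.\<close>
  have "same_sign (poly q ?\<theta>)" if q: "q \<in> polys_over G" for q
  proof -
    obtain k u r where *: "u \<in> polys_over G" "r \<in> polys_over G" "degree r < degree p"
      "smult (lead_coeff p ^ k) q = u * p + r"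
      using pseudo_division[OF S p(1) deg q] .
    have "poly p ?\<theta> = 0"
      using f\<theta> \<theta>'(4) by (simp add: prod_eq_iff fst_poly_eval snd_poly_eval f1_def f2_def)
    then have "lead_coeff p ^ k * poly q ?\<theta> = poly r ?\<theta>"
      using arg_cong[OF *(4), of "\<lambda>p. poly p ?\<theta>"] by simp
    moreover have "same_sign (poly r ?\<theta>)"
      using same_sign_poly[OF P roots _ _ cut *(2,3)] \<theta>(1) \<theta>'(1) by simp
    moreover have lc: "lead_coeff p \<in> G" using p(1) by (simp add: polys_over_def)
    moreover have "fst (lead_coeff p) \<noteq> 0"
      using partial_iso_zero(1)[OF P lc] p(2) by simp
    then have "fst (lead_coeff p ^ k) \<noteq> 0" by (induction k) auto
    moreover have "fst (poly q ?\<theta>) \<in> F1" "snd (poly q ?\<theta>) \<in> F2"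
      using partial_iso_poly(1,2)[OF P q] \<theta>(1) \<theta>'(1)
      by (auto simp: fst_poly_eval snd_poly_eval intro: A.poly_closed B.poly_closed)
    ultimately show ?thesis
      using same_sign_cancel partial_isoD(2)[OF P unital_subring_power[OF S lc, of k]] by metis
  qed
  then show ?thesis by blast
qed

end

lemma map_poly_swap:
  fixes p :: "('a::comm_ring_1 \<times> 'b::comm_ring_1) poly"
  shows "degree (map_poly prod.swap p) = degree p" "map_poly prod.swap p = 0 \<longleftrightarrow> p = 0"
    "fst_poly (map_poly prod.swap p) = snd_poly p" "snd_poly (map_poly prod.swap p) = fst_poly p"
    "poly (map_poly prod.swap p) (prod.swap z) = prod.swap (poly p z)"
proof -
  have c: "coeff (map_poly prod.swap p) i = prod.swap (coeff p i)" for i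
    by (simp add: coeff_map_poly prod_eq_iff)
  have z: "prod.swap x = 0 \<longleftrightarrow> x = 0" for x :: "'a \<times> 'b"
    by (auto simp: prod_eq_iff)
  show "degree (map_poly prod.swap p) = degree p"
    unfolding Polynomial.degree_def by (simp add: c z)
  show "map_poly prod.swap p = 0 \<longleftrightarrow> p = 0" by (simp add: poly_eq_iff c z)
  show *: "fst_poly (map_poly prod.swap p) = snd_poly p" "snd_poly (map_poly prod.swap p) = fst_poly p"
    by (simp_all add: poly_eq_iff c)
  show "poly (map_poly prod.swap p) (prod.swap z) = prod.swap (poly p z)"
    by (simp add: prod_eq_iff * fst_poly_eval snd_poly_eval)
qed

lemma polys_over_swap:
  "p \<in> polys_over G \<Longrightarrow> map_poly prod.swap p \<in> polys_over (prod.swap ` G)"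
  by (simp add: polys_over_def coeff_map_poly prod_eq_iff)

context real_closed_pair
begin

lemma maximal_iso_root_in_fst:
  assumes G: "maximal_iso G" and p: "p \<in> polys_over G" "p \<noteq> 0" "roots_matched G (degree p)"
    and x: "x \<in> F1" "poly (fst_poly p) x = 0"
  shows "x \<in> fst ` G"
proof (rule ccontr)
  assume "x \<notin> fst ` G"
  from match_root[OF G p x(1) this x(2)] obtain y
    where "\<forall>q\<in>polys_over G. same_sign (poly q (x, y))" by blast
  then have "(x, y) \<in> G" using maximal_isoI[OF G] by blast
  then show False using \<open>x \<notin> fst ` G\<close> by force
qed

end

text \<open>Induction on the degree. For roots in the second field the statement about the first one
  is applied to the two fields in exchanged order, where \<open>prod.swap\<close> carries
  \<open>G\<close> to a maximal isomorphism again.\<close>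

lemma (in real_closed_pair) maximal_iso_roots_matched:
  assumes G: "maximal_iso G"
  shows "roots_matched G n"
proof (induction n)
  case 0
  show ?case by (simp add: roots_matched_def)
next
  case (Suc n)
  interpret S: real_closed_pair F2 T2 F1 T1 ..
  have sw: "S.same_sign (prod.swap z) \<longleftrightarrow> same_sign z" for z
    by (auto simp: same_sign_def S.same_sign_def)
  have swap_swap: "prod.swap ` prod.swap ` H = H" for H :: "('x \<times> 'y) set"
    by (simp add: image_image)
  have subr: "unital_subring (prod.swap ` H)" if "unital_subring H"
    for H :: "('x::comm_ring_1 \<times> 'y::comm_ring_1) set"
  proof -
    have "prod.swap z - prod.swap w \<in> prod.swap ` H" "prod.swap z * prod.swap w \<in> prod.swap ` H"
      if "z \<in> H" "w \<in> H" for z w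
      by (rule image_eqI[of _ _ "z - w"] image_eqI[of _ _ "z * w"];
          use that \<open>unital_subring H\<close> in \<open>simp add: prod_eq_iff unital_subring_def\<close>)+
    moreover have "1 \<in> prod.swap ` H"
      using that by (intro image_eqI[of _ _ 1]) (simp_all add: prod_eq_iff unital_subring_def)
    ultimately show ?thesis by (auto simp: unital_subring_def)
  qed
  have iso: "S.partial_iso (prod.swap ` H) \<longleftrightarrow> partial_iso H" for H
    using subr[of H] subr[of "prod.swap ` H"] by (auto simp: partial_iso_def S.partial_iso_def sw swap_swap)
  have max: "S.maximal_iso (prod.swap ` G)"
    unfolding S.maximal_iso_def
  proof (intro conjI allI impI)
    show "S.partial_iso (prod.swap ` G)" using G iso by (simp add: maximal_iso_def)
    fix H assume H: "S.partial_iso H" "prod.swap ` G \<subseteq> H"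
    then have "partial_iso (prod.swap ` H)" "G \<subseteq> prod.swap ` H"
      using iso[of "prod.swap ` H"] image_mono[OF H(2), of prod.swap] by (simp_all add: swap_swap)
    then have "prod.swap ` H = G" using G by (simp add: maximal_iso_def)
    then show "H = prod.swap ` G" using swap_swap[of H] by simp
  qed
  have pol: "\<exists>q\<in>polys_over G. p = map_poly prod.swap q" if "p \<in> polys_over (prod.swap ` G)" for p
  proof (rule bexI[of _ "map_poly prod.swap p"])
    show "map_poly prod.swap p \<in> polys_over G"
      using polys_over_swap[OF that] by (simp add: swap_swap)
    show "p = map_poly prod.swap (map_poly prod.swap p)"
      by (simp add: poly_eq_iff coeff_map_poly prod_eq_iff)
  qed
  have matched: "S.roots_matched (prod.swap ` G) k" if "roots_matched G k" for k
    unfolding S.roots_matched_def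
  proof (intro ballI impI)
    fix p assume p: "p \<in> polys_over (prod.swap ` G)" "p \<noteq> 0" "degree p < k"
    then obtain q where q: "q \<in> polys_over G" "p = map_poly prod.swap q" using pol by blast
    have img: "fst ` prod.swap ` G = snd ` G" "snd ` prod.swap ` G = fst ` G"
      by (simp_all add: image_image)
    show "(\<forall>x\<in>F2. poly (fst_poly p) x = 0 \<longrightarrow> x \<in> fst ` prod.swap ` G) \<and>
        (\<forall>x\<in>F1. poly (snd_poly p) x = 0 \<longrightarrow> x \<in> snd ` prod.swap ` G)"
      using that p q unfolding roots_matched_def img by (simp add: map_poly_swap)
  qed
  have mono: "roots_matched G k" if "k \<le> n" for k
    using Suc.IH that by (auto simp: roots_matched_def)
  show ?case
    unfolding roots_matched_def
  proof (intro ballI impI conjI)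
    fix p assume p: "p \<in> polys_over G" "p \<noteq> 0" "degree p < Suc n"
    then have m: "roots_matched G (degree p)" using mono by simp
    show "x \<in> fst ` G" if "x \<in> F1" "poly (fst_poly p) x = 0" for x
      using maximal_iso_root_in_fst[OF G p(1,2) m that] .
    show "x \<in> snd ` G" if "x \<in> F2" "poly (snd_poly p) x = 0" for x
    proof -
      have "x \<in> fst ` prod.swap ` G"
        using S.maximal_iso_root_in_fst[OF max polys_over_swap[OF p(1)]] p(2) matched[OF m] that
        by (simp add: map_poly_swap)
      then show ?thesis by (simp add: image_image)
    qed
  qed
qed

text \<open>With all roots matched, the sign of every polynomial at \<open>x\<close> depends only on
  the cut of \<open>x\<close> in \<open>G\<close>. So any \<open>y\<close> in the corresponding cut
  can be adjoined together with \<open>x\<close>, and maximality puts the pair into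
  \<open>G\<close>.\<close>

theorem (in real_closed_pair) maximal_iso_total:
  assumes G: "maximal_iso G"
    and cuts: "\<And>x. x \<in> F1 \<Longrightarrow> \<exists>y\<in>F2. \<forall>z\<in>G. A.sg (x - fst z) = B.sg (y - snd z)"
  shows "fst ` G = F1"
proof
  have P: "partial_iso G" using G by (simp add: maximal_iso_def)
  show "fst ` G \<subseteq> F1" using partial_isoD(3)[OF P] by auto
  show "F1 \<subseteq> fst ` G"
  proof
    fix x assume x: "x \<in> F1"
    then obtain y where y: "y \<in> F2" "\<forall>z\<in>G. A.sg (x - fst z) = B.sg (y - snd z)" using cuts by blast
    then have "same_sign ((x, y) - z)" if "z \<in> G" for z
      using that x partial_isoD(3,4)[OF P] A.closed B.closed by (simp add: same_sign_def)
    then have "same_sign (poly p (x, y))" if "p \<in> polys_over G" for p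
      using same_sign_poly[OF P maximal_iso_roots_matched[OF G] _ _ _ that lessI] x y(1) by simp
    then have "(x, y) \<in> G" using maximal_isoI[OF G] by blast
    then show "x \<in> fst ` G" by force
  qed
qed

section \<open>Artin-Schreier theory: a maximal cone is the cone of a real closed field\<close>

section \<open>Maximal cones in the complex numbers\<close>

text \<open>The ambient field may have no order, so the ordered subfield is not given in advance: it
  will consist of the differences of elements of \<open>T\<close>. Accordingly \<open>T\<close> has
  to contain the squares of such differences rather than all squares.\<close>

definition pos_cone :: "'a::field_char_0 set \<Rightarrow> bool" where
  "pos_cone T \<longleftrightarrow> 0 \<in> T \<and> 1 \<in> T \<and> (\<forall>x\<in>T. \<forall>y\<in>T. x + y \<in> T \<and> x * y \<in> T \<and> (x - y) ^ 2 \<in> T) \<and>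
     (\<forall>x\<in>T. - x \<in> T \<longrightarrow> x = 0)"

definition maximal_cone :: "'a::field_char_0 set \<Rightarrow> bool" where
  "maximal_cone T \<longleftrightarrow> pos_cone T \<and> (\<forall>U. pos_cone U \<longrightarrow> T \<subseteq> U \<longrightarrow> U = T)"

lemma pos_coneD:
  assumes "pos_cone T"
  shows "0 \<in> T" "1 \<in> T" "x \<in> T \<Longrightarrow> y \<in> T \<Longrightarrow> x + y \<in> T" "x \<in> T \<Longrightarrow> y \<in> T \<Longrightarrow> x * y \<in> T"
    "x \<in> T \<Longrightarrow> y \<in> T \<Longrightarrow> (x - y) ^ 2 \<in> T" "x \<in> T \<Longrightarrow> - x \<in> T \<Longrightarrow> x = 0"
  using assms by (auto simp: pos_cone_def)

lemma pos_cone_Union: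
  assumes "C \<noteq> {}" "subset.chain {T. pos_cone T} C"
  shows "pos_cone (\<Union>C)"
proof -
  have c: "pos_cone T" if "T \<in> C" for T using assms(2) that by (auto simp: subset.chain_def)
  have two: "\<exists>T\<in>C. x \<in> T \<and> y \<in> T" if "x \<in> \<Union>C" "y \<in> \<Union>C" for x y
    using that assms(2) unfolding subset.chain_def by blast
  obtain T0 where "T0 \<in> C" using assms(1) by blast
  then have "0 \<in> \<Union>C" "1 \<in> \<Union>C" using pos_coneD(1,2)[OF c] by auto
  moreover have "x + y \<in> \<Union>C \<and> x * y \<in> \<Union>C \<and> (x - y) ^ 2 \<in> \<Union>C" if xy: "x \<in> \<Union>C" "y \<in> \<Union>C" for x y
    using two[OF xy] pos_coneD(3-5)[OF c, of _ x y] by blast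
  moreover have "x = 0" if xy: "x \<in> \<Union>C" "- x \<in> \<Union>C" for x
    using two[OF xy] pos_coneD(6)[OF c, of _ x] by blast
  ultimately show ?thesis by (simp add: pos_cone_def)
qed

lemma maximal_cone_exists:
  assumes "pos_cone T0"
  obtains T where "maximal_cone T" "T0 \<subseteq> T"
proof -
  let ?A = "{T. pos_cone T \<and> T0 \<subseteq> T}"
  have "\<exists>M\<in>?A. \<forall>X\<in>?A. M \<subseteq> X \<longrightarrow> X = M"
  proof (rule subset_Zorn_nonempty)
    show "?A \<noteq> {}" using assms by blast
    fix C assume C: "C \<noteq> {}" "subset.chain ?A C"
    then have "pos_cone (\<Union>C)" by (intro pos_cone_Union) (auto simp: subset.chain_def)
    moreover have "T0 \<subseteq> \<Union>C" using C unfolding subset.chain_def by blast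
    ultimately show "\<Union>C \<in> ?A" by blast
  qed
  then obtain M where "pos_cone M" "T0 \<subseteq> M" "\<forall>X\<in>?A. M \<subseteq> X \<longrightarrow> X = M" by blast
  then show ?thesis using that[of M] by (auto simp: maximal_cone_def)
qed

inductive_set weighted_squares :: "'a::comm_ring_1 set \<Rightarrow> 'a set \<Rightarrow> 'a set" for T A where
  zero: "0 \<in> weighted_squares T A"
| step: "t \<in> T \<Longrightarrow> y \<in> A \<Longrightarrow> x \<in> weighted_squares T A \<Longrightarrow> t * y ^ 2 + x \<in> weighted_squares T A"

lemma weighted_squares_add:
  "x \<in> weighted_squares T A \<Longrightarrow> y \<in> weighted_squares T A \<Longrightarrow> x + y \<in> weighted_squares T A"
proof (induction rule: weighted_squares.induct)
  case (step t z x)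
  then show ?case using weighted_squares.step[OF step(1,2) step.IH[OF step.prems]] by (simp add: add.assoc)
qed simp

lemma weighted_squares_scale:
  assumes "\<And>x y. x \<in> T \<Longrightarrow> y \<in> T \<Longrightarrow> x * y \<in> T" "\<And>x y. x \<in> A \<Longrightarrow> y \<in> A \<Longrightarrow> x * y \<in> A"
    and "t \<in> T" "z \<in> A" "y \<in> weighted_squares T A"
  shows "t * z ^ 2 * y \<in> weighted_squares T A"
  using assms(5)
proof induction
  case zero
  show ?case by (simp add: weighted_squares.zero)
next
  case (step s w x)
  have "t * z ^ 2 * (s * w ^ 2 + x) = (t * s) * (z * w) ^ 2 + t * z ^ 2 * x"
    by (simp add: algebra_simps power2_eq_square)
  then show ?case using step assms by (simp add: weighted_squares.step)
qed

lemma weighted_squares_mult: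
  assumes "\<And>x y. x \<in> T \<Longrightarrow> y \<in> T \<Longrightarrow> x * y \<in> T" "\<And>x y. x \<in> A \<Longrightarrow> y \<in> A \<Longrightarrow> x * y \<in> A"
    and "x \<in> weighted_squares T A" "y \<in> weighted_squares T A"
  shows "x * y \<in> weighted_squares T A"
  using assms(3)
proof induction
  case zero
  show ?case by (simp add: weighted_squares.zero)
next
  case (step t z x)
  have "t * z ^ 2 * y \<in> weighted_squares T A"
    by (rule weighted_squares_scale) (use assms step in auto)
  then show ?case
    using weighted_squares_add step.IH by (simp add: distrib_right)
qed

lemma weighted_squares_list:
  assumes "x \<in> weighted_squares T A"
  obtains L where "set L \<subseteq> T \<times> A" "x = (\<Sum>(t, y)\<leftarrow>L. t * y ^ 2)"
proof -
  have "\<exists>L. set L \<subseteq> T \<times> A \<and> x = (\<Sum>(t, y)\<leftarrow>L. t * y ^ 2)"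
    using assms
  proof induction
    case zero
    show ?case by (intro exI[of _ "[]"]) simp
  next
    case (step t y x)
    then obtain L where "set L \<subseteq> T \<times> A" "x = (\<Sum>(t, y)\<leftarrow>L. t * y ^ 2)" by blast
    then show ?case using step by (intro exI[of _ "(t, y) # L"]) simp
  qed
  then show ?thesis using that by blast
qed

definition cone_field :: "'a::field_char_0 set \<Rightarrow> 'a set" where
  "cone_field T = {x - y | x y. x \<in> T \<and> y \<in> T}"

context
  fixes T :: "'a::field_char_0 set"
  assumes T: "maximal_cone T"
begin

lemma maximal_coneD: "pos_cone T"
  using T by (simp add: maximal_cone_def)

lemmas coneD = pos_coneD[OF maximal_coneD]

lemma cone_subset_cone_field: "T \<subseteq> cone_field T"
  using coneD(1) by (force simp: cone_field_def)

lemma unital_subring_cone_field: "unital_subring (cone_field T)"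
  unfolding unital_subring_def
proof (intro conjI ballI)
  show "1 \<in> cone_field T" using coneD(2) cone_subset_cone_field by blast
  fix x y assume "x \<in> cone_field T" "y \<in> cone_field T"
  then obtain a b c d where *: "x = a - b" "y = c - d" "a \<in> T" "b \<in> T" "c \<in> T" "d \<in> T"
    unfolding cone_field_def by blast
  have "x - y = (a + d) - (b + c)" "x * y = (a * c + b * d) - (a * d + b * c)"
    by (simp_all add: * algebra_simps)
  moreover have "a + d \<in> T" "b + c \<in> T" "a * c + b * d \<in> T" "a * d + b * c \<in> T"
    using * by (auto intro!: coneD(3,4))
  ultimately show "x - y \<in> cone_field T" "x * y \<in> cone_field T"
    unfolding cone_field_def by blast+
qed

lemma square_in_cone: "x \<in> cone_field T \<Longrightarrow> x ^ 2 \<in> T"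
  using coneD(5) unfolding cone_field_def by blast

text \<open>The quotients of elements of \<open>T\<close> again form a cone that contains
  \<open>T\<close>, so by maximality they all lie in \<open>T\<close>.\<close>

lemma cone_divide:
  assumes "x \<in> T" "y \<in> T" "y \<noteq> 0"
  shows "x / y \<in> T"
proof -
  define U where "U = {x / y | x y. x \<in> T \<and> y \<in> T \<and> y \<noteq> 0}"
  have UI: "x / y \<in> U" if "x \<in> T" "y \<in> T" "y \<noteq> 0" for x y using that unfolding U_def by blast
  have "pos_cone U"
    unfolding pos_cone_def
  proof (intro conjI ballI impI)
    show "0 \<in> U" "1 \<in> U" using UI[of 0 1] UI[of 1 1] coneD(1,2) by simp_all
    fix x assume "x \<in> U"
    then obtain a b where x: "x = a / b" "a \<in> T" "b \<in> T" "b \<noteq> 0" unfolding U_def by blast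
    fix y assume "y \<in> U"
    then obtain c d where y: "y = c / d" "c \<in> T" "d \<in> T" "d \<noteq> 0" unfolding U_def by blast
    have "x + y = (a * d + c * b) / (b * d)" "x * y = (a * c) / (b * d)"
      "(x - y) ^ 2 = (a * d - c * b) ^ 2 / (b * d) ^ 2"
      using x y by (simp_all add: add_frac_eq diff_frac_eq power_divide)
    moreover have "(b * d) ^ 2 \<in> T"
      unfolding power2_eq_square using x y coneD(4) by blast
    ultimately show "x + y \<in> U" "x * y \<in> U" "(x - y) ^ 2 \<in> U"
      using x y coneD(3-5) by (auto intro!: UI)
  next
    fix x assume "x \<in> U" "- x \<in> U"
    then obtain a b c d where x: "x = a / b" "a \<in> T" "b \<in> T" "b \<noteq> 0"
      and y: "- x = c / d" "c \<in> T" "d \<in> T" "d \<noteq> 0" unfolding U_def by blast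
    have "- (a / b) = c / d" using x(1) y(1) by simp
    then have "- (a * d) = c * b" using x(4) y(4) by (simp add: field_simps)
    moreover have "a * d \<in> T" "c * b \<in> T" using x y coneD(4) by blast+
    ultimately have "a * d = 0" using coneD(6)[of "a * d"] by simp
    then show "x = 0" using x y by simp
  qed
  moreover have "T \<subseteq> U" using UI[OF _ coneD(2)] by force
  ultimately have "U = T" using T by (simp add: maximal_cone_def)
  then show ?thesis using UI assms by blast
qed

text \<open>The set \<open>T + x T\<close> is larger than \<open>T\<close>, so it is no cone, and
  only the last condition can fail: it contains some nonzero \<open>a\<close> together with
  \<open>- a\<close>. Adding the representations of both gives
  \<open>(s + s') + x (t + t') = 0\<close>, which exhibits \<open>- x\<close> as a quotient of
  elements of \<open>T\<close>.\<close>

lemma cone_total: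
  assumes "x \<in> cone_field T" "x \<notin> T"
  shows "- x \<in> T"
proof -
  define U where "U = {s + x * t | s t. s \<in> T \<and> t \<in> T}"
  have UI: "s + x * t \<in> U" if "s \<in> T" "t \<in> T" for s t using that unfolding U_def by blast
  note x2 = square_in_cone[OF assms(1)]
  note F = unital_subring_closed[OF unital_subring_cone_field]
  have sub: "T \<subseteq> U" using UI[OF _ coneD(1)] by force
  have "x \<in> U" using UI[OF coneD(1,2)] by simp
  then have "U \<noteq> T" using assms(2) by blast
  then have "\<not> pos_cone U" using T sub by (auto simp: maximal_cone_def)
  moreover have "0 \<in> U" "1 \<in> U" using sub coneD(1,2) by auto
  moreover have "a + b \<in> U \<and> a * b \<in> U \<and> (a - b) ^ 2 \<in> U" if "a \<in> U" "b \<in> U" for a b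
  proof -
    obtain s t s' t' where ab: "a = s + x * t" "b = s' + x * t'" "s \<in> T" "t \<in> T" "s' \<in> T" "t' \<in> T"
      using \<open>a \<in> U\<close> \<open>b \<in> U\<close> unfolding U_def by blast
    have "a + b = (s + s') + x * (t + t')" "a * b = (s * s' + x ^ 2 * (t * t')) + x * (s * t' + t * s')"
      by (simp_all add: ab algebra_simps power2_eq_square)
    moreover have "s + s' \<in> T" "t + t' \<in> T" "s * s' + x ^ 2 * (t * t') \<in> T" "s * t' + t * s' \<in> T"
      using ab x2 by (auto intro!: coneD(3,4))
    ultimately have "a + b \<in> U" "a * b \<in> U" by (auto intro: UI)
    moreover have "a - b \<in> cone_field T"
      using ab assms(1) cone_subset_cone_field by (auto intro!: F)
    then have "(a - b) ^ 2 \<in> U" using square_in_cone sub by blast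
    ultimately show ?thesis by blast
  qed
  ultimately obtain a where a: "a \<in> U" "- a \<in> U" "a \<noteq> 0"
    unfolding pos_cone_def by blast
  then obtain s t s' t' where ab: "a = s + x * t" "- a = s' + x * t'" "s \<in> T" "t \<in> T" "s' \<in> T" "t' \<in> T"
    unfolding U_def by blast
  have sum: "(s + s') + x * (t + t') = 0"
  proof -
    have "(s + x * t) + (s' + x * t') = 0" using ab(1,2) by (metis add.right_inverse)
    then show ?thesis by (simp add: algebra_simps)
  qed
  have "t + t' \<noteq> 0"
  proof
    assume 0: "t + t' = 0"
    then have "t = 0" "t' = 0" using coneD(6)[of t] ab by (auto simp: add_eq_0_iff)
    moreover have "s = 0" using sum 0 coneD(6)[of s] ab by (auto simp: add_eq_0_iff)
    ultimately show False using a ab by simp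
  qed
  moreover have "- x * (t + t') = s + s'"
    unfolding mult_minus_left using sum[unfolded add_eq_0_iff] by (metis minus_minus)
  ultimately have "- x = (s + s') / (t + t')"
    by (simp add: nonzero_eq_divide_eq del: mult_minus_left)
  then show ?thesis
    using cone_divide coneD(3) ab \<open>t + t' \<noteq> 0\<close> by metis
qed

lemma ordered_subfield_cone_field: "ordered_subfield (cone_field T) T"
proof
  show "unital_subring (cone_field T)" by (rule unital_subring_cone_field)
  show "T \<subseteq> cone_field T" by (rule cone_subset_cone_field)
  note F = unital_subring_closed[OF unital_subring_cone_field]
  show "inverse x \<in> cone_field T" if "x \<in> cone_field T" for x
  proof -
    have pos: "inverse x \<in> T" if "x \<in> T" for x
      using cone_divide[OF coneD(2) that] that by (cases "x = 0") (simp_all add: divide_inverse)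
    show ?thesis
    proof (cases "x \<in> T")
      case True
      then show ?thesis using pos cone_subset_cone_field by blast
    next
      case False
      then have "inverse (- x) \<in> cone_field T"
        using pos cone_total that cone_subset_cone_field by blast
      then show ?thesis using F(5) by fastforce
    qed
  qed
  show "x + y \<in> T" "x * y \<in> T" if "x \<in> T" "y \<in> T" for x y
    using coneD(3,4)[OF that] .
  show "x \<in> T \<or> - x \<in> T" if "x \<in> cone_field T" for x
    using cone_total[OF that] by blast
  show "x = 0" if "x \<in> T" "- x \<in> T" for x
    using coneD(6)[OF that] .
qed

end

lemma (in ordered_subfield) root_of_linear_change:
  assumes "a \<in> F" "b \<in> F" "x \<in> F" "c \<in> F" "sg (b - a) = 1"
    and "sg ((a - x) * c) = - 1" "sg ((b - x) * c) = 1"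
  shows "sg (x - a) = 1 \<and> sg (b - x) = 1"
proof -
  have 1: "sg (a - x) * sg c = - 1" "sg (b - x) * sg c = 1"
    using assms by (simp_all add: sg_mult closed)
  have 2: "sg (x - a) = - sg (a - x)" using sg_minus_commute assms by blast
  show ?thesis
  proof (cases "sg (b - x) = 1")
    case True
    then show ?thesis using 1 2 by simp
  next
    case False
    then have "sg (a - x) = 1" "sg (x - b) = 1"
      using 1 sg_cases[of "b - x"] sg_minus_commute[of x b] assms by auto
    then have "sg (a - b) = 1" using sg_add[of "a - x" "x - b"] assms closed by simp
    then show ?thesis using sg_minus_commute[of a b] assms by simp
  qed
qed

text \<open>Having least degree, such a polynomial is irreducible, and the order extends to the field
  generated by one of its complex roots. A maximal cone therefore admits none.\<close>

locale bad_polynomial = ordered_subfield F T for F T :: "complex set" +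
  fixes f a b
  assumes f: "f \<in> polys_over F" and ab: "a \<in> F" "b \<in> F" "sg (b - a) = 1"
    and signs: "sg (poly f a) = - 1" "sg (poly f b) = 1"
    and no_root: "\<And>c. c \<in> F \<Longrightarrow> sg (c - a) = 1 \<Longrightarrow> sg (b - c) = 1 \<Longrightarrow> poly f c \<noteq> 0"
    and minimal: "\<And>g. g \<in> polys_over F \<Longrightarrow> degree g < degree f \<Longrightarrow> sg (poly g a) = - 1 \<Longrightarrow>
      sg (poly g b) = 1 \<Longrightarrow> \<exists>c\<in>F. sg (c - a) = 1 \<and> sg (b - c) = 1 \<and> poly g c = 0"
begin

lemma smaller_degree_root:
  assumes g: "g \<in> polys_over F" "degree g < degree f"
    and "poly g a \<noteq> 0" "poly g b \<noteq> 0" "sg (poly g a) \<noteq> sg (poly g b)"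
  obtains c where "c \<in> F" "sg (c - a) = 1" "sg (b - c) = 1" "poly g c = 0"
proof -
  consider "sg (poly g a) = - 1" "sg (poly g b) = 1" | "sg (poly (- g) a) = - 1" "sg (poly (- g) b) = 1"
    using assms(3-5) sg_cases[of "poly g a"] sg_cases[of "poly g b"] sg_minus poly_closed[OF g(1)] ab
    by auto
  then show ?thesis
  proof cases
    case 1
    then show ?thesis using minimal[OF g] that by blast
  next
    case 2
    have "\<exists>c\<in>F. sg (c - a) = 1 \<and> sg (b - c) = 1 \<and> poly (- g) c = 0"
      by (rule minimal[OF polys_over_uminus[OF subring g(1)] _ 2]) (use g in simp)
    then show ?thesis using that by auto
  qed
qed

lemma degree_pos: "degree f > 0"
proof (rule ccontr)
  assume "\<not> ?thesis"
  then obtain c where "f = [:c:]" by (metis degree_eq_zeroE gr0I)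
  then show False using signs by simp
qed

context
  fixes \<theta> :: complex
  assumes \<theta>: "poly f \<theta> = 0"
begin

text \<open>In effect \<open>f\<close> is the minimal polynomial of \<open>\<theta>\<close> up to a
  scalar. If it were, up to a scalar, a product of polynomials of smaller degree, one of these would
  change its sign from \<open>a\<close> to \<open>b\<close> and so have a root in between, which
  would be a root of \<open>f\<close>.\<close>

lemma small_poly_zero:
  assumes "g \<in> polys_over F" "degree g < degree f" "poly g \<theta> = 0"
  shows "g = 0"
proof (rule ccontr)
  assume "g \<noteq> 0"
  define M where "M = {g \<in> polys_over F. g \<noteq> 0 \<and> degree g < degree f \<and> poly g \<theta> = 0}"
  have "g \<in> M" using assms \<open>g \<noteq> 0\<close> by (simp add: M_def)
  then obtain r where "r \<in> M" and least: "\<And>g. g \<in> M \<Longrightarrow> degree r \<le> degree g"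
    using exists_least_iff[of "\<lambda>n. \<exists>g\<in>M. degree g = n"] by (metis (mono_tags, lifting) not_le)
  then have r: "r \<in> polys_over F" "r \<noteq> 0" "degree r < degree f" "poly r \<theta> = 0"
    by (auto simp: M_def)
  have deg_r: "degree r > 0"
  proof (rule ccontr)
    assume "\<not> ?thesis"
    then obtain c where "r = [:c:]" by (metis degree_eq_zeroE gr0I)
    then show False using r by simp
  qed
  obtain k u s where *: "u \<in> polys_over F" "s \<in> polys_over F" "degree s < degree r"
    "smult (lead_coeff r ^ k) f = u * r + s"
    using pseudo_division[OF subring r(1) deg_r f] .
  have "poly s \<theta> = 0" using arg_cong[OF *(4), of "\<lambda>p. poly p \<theta>"] r(4) \<theta> by simp
  then have "s = 0" using least[of s] * r(3) by (auto simp: M_def)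
  define c where "c = lead_coeff r ^ k"
  have c: "c \<noteq> 0" "c \<in> F"
    using r unfolding c_def by (auto intro!: closed simp: polys_over_def)
  have cf: "smult c f = u * r" using * \<open>s = 0\<close> by (simp add: c_def)
  have f0: "f \<noteq> 0" using degree_pos by auto
  then have "u \<noteq> 0" using cf c(1) by auto
  then have "degree f = degree u + degree r"
    using arg_cong[OF cf, of degree] c(1) r(2) by (simp add: degree_mult_eq)
  then have deg_u: "degree u < degree f" using deg_r by simp
  have val: "c * poly f x = poly u x * poly r x" for x
    using arg_cong[OF cf, of "\<lambda>p. poly p x"] by simp
  have sgv: "sg c * sg (poly f x) = sg (poly u x) * sg (poly r x)" if "x \<in> F" for x
    using val[of x] sg_mult that c(2) poly_closed f *(1) r(1) by metis
  have sgc: "sg c \<noteq> 0" using c(1) by simp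
  have "poly f a \<noteq> 0" "poly f b \<noteq> 0" using signs by auto
  then have nz: "poly u a \<noteq> 0" "poly r a \<noteq> 0" "poly u b \<noteq> 0" "poly r b \<noteq> 0"
    using val[of a] val[of b] c(1) by auto
  have "sg (poly u a) \<noteq> sg (poly u b) \<or> sg (poly r a) \<noteq> sg (poly r b)"
  proof (rule ccontr)
    assume "\<not> ?thesis"
    then have "sg c * sg (poly f a) = sg c * sg (poly f b)"
      using sgv ab by simp
    then show False using signs sgc by simp
  qed
  then obtain x where "x \<in> F" "sg (x - a) = 1" "sg (b - x) = 1" "poly u x = 0 \<or> poly r x = 0"
    using smaller_degree_root[OF *(1) deg_u] smaller_degree_root[OF r(1,3)] nz by metis
  then show False using val[of x] c(1) no_root by auto
qed

lemma vanishing_poly_multiple: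
  assumes g: "g \<in> polys_over F" "poly g \<theta> = 0"
  obtains c u where "c \<in> F" "c \<noteq> 0" "u \<in> polys_over F" "smult c g = u * f"
proof -
  obtain k u r where *: "u \<in> polys_over F" "r \<in> polys_over F" "degree r < degree f"
    "smult (lead_coeff f ^ k) g = u * f + r"
    using pseudo_division[OF subring f degree_pos g(1)] .
  have "poly r \<theta> = 0" using arg_cong[OF *(4), of "\<lambda>p. poly p \<theta>"] g(2) \<theta> by simp
  then have "r = 0" using small_poly_zero * by blast
  moreover have "lead_coeff f ^ k \<in> F" using f by (auto intro!: closed simp: polys_over_def)
  moreover have "lead_coeff f ^ k \<noteq> 0" using degree_pos by auto
  ultimately show ?thesis using that *(1,4) by simp
qed

lemma reduce_degree:
  assumes g: "g \<in> polys_over F"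
  obtains r where "r \<in> polys_over F" "degree r < degree f" "poly r \<theta> = poly g \<theta>"
proof -
  obtain k u r where *: "u \<in> polys_over F" "r \<in> polys_over F" "degree r < degree f"
    "smult (lead_coeff f ^ k) g = u * f + r"
    using pseudo_division[OF subring f degree_pos g(1)] .
  define c where "c = lead_coeff f ^ k"
  have c: "c \<noteq> 0" "c \<in> F"
    using degree_pos f unfolding c_def by (auto intro!: closed simp: polys_over_def)
  have "poly r \<theta> = c * poly g \<theta>" using arg_cong[OF *(4), of "\<lambda>p. poly p \<theta>"] \<theta> by (simp add: c_def)
  then have "poly (smult (inverse c) r) \<theta> = poly g \<theta>" using c(1) by simp
  moreover have "smult (inverse c) r \<in> polys_over F"
    by (intro polys_over_smult subring *(2) inverse_closed c(2))
  ultimately show ?thesis using that[of "smult (inverse c) r"] *(3) by (simp add: degree_smult_eq)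
qed

text \<open>As a polynomial, the sum of squares \<open>S\<close> has degree at most
  \<open>2 * (degree f - 1)\<close> and vanishes at \<open>\<theta>\<close>, so it is up to a scalar
  \<open>f\<close> times a cofactor of degree below that of \<open>f\<close>. If \<open>S\<close> is
  positive at all points of \<open>F\<close> that are not roots of \<open>f\<close>, the cofactor
  changes its sign together with \<open>f\<close>, hence has a root between \<open>a\<close> and
  \<open>b\<close>, where \<open>S\<close> would vanish. Otherwise the \<open>g\<close> have a
  common root \<open>c\<close> with \<open>poly f c \<noteq> 0\<close>, and dividing all of them by
  \<open>X - c\<close> lowers the sum of the degrees.\<close>

lemma sum_squares_poly_zero:
  assumes "set L \<subseteq> (T - {0}) \<times> {g \<in> polys_over F. degree g < degree f}"
    and "(\<Sum>(t, g)\<leftarrow>L. t * poly g \<theta> ^ 2) = 0"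
  shows "\<forall>(t, g)\<in>set L. g = 0"
  using assms
proof (induction "\<Sum>(t, g)\<leftarrow>L. degree g" arbitrary: L rule: less_induct)
  case less
  define S where "S = (\<Sum>(t, g)\<leftarrow>L. smult t (g ^ 2))"
  have Sx: "poly S x = (\<Sum>(t, g)\<leftarrow>L. t * poly g x ^ 2)" for x
    unfolding S_def by (induction L) auto
  have L: "t \<in> T" "t \<in> F" "t \<noteq> 0" "g \<in> polys_over F" "degree g < degree f" if "(t, g) \<in> set L" for t g
    using less.prems(1) that cone_subset by auto
  have S: "S \<in> polys_over F" "degree S \<le> 2 * (degree f - 1)"
  proof -
    have "S \<in> polys_over F \<and> degree S \<le> 2 * (degree f - 1)"
      unfolding S_def using L(2,4,5)
    proof (induction L)
      case Nil
      show ?case by (simp add: polys_over_zero subring)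
    next
      case (Cons x L)
      obtain t g where x: "x = (t, g)" by (cases x)
      have g: "t \<in> F" "g \<in> polys_over F" "degree g < degree f" using Cons.prems[of t g] x by auto
      have "degree (g ^ 2) \<le> 2 * (degree f - 1)"
        using degree_power_le[of g 2] g(3) by simp
      then have "degree (smult t (g ^ 2)) \<le> 2 * (degree f - 1)"
        using degree_smult_le[of t "g ^ 2"] by simp
      moreover have "smult t (g ^ 2) \<in> polys_over F"
        using g by (intro polys_over_smult polys_over_power subring)
      moreover have "(\<Sum>(t, g)\<leftarrow>L. smult t (g ^ 2)) \<in> polys_over F \<and>
          degree (\<Sum>(t, g)\<leftarrow>L. smult t (g ^ 2)) \<le> 2 * (degree f - 1)"
        by (rule Cons.IH) (meson Cons.prems list.set_intros(2))+
      ultimately show ?case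
        unfolding x list.map sum_list.Cons prod.case
        by (blast intro!: polys_over_add subring degree_add_le)
    qed
    then show "S \<in> polys_over F" "degree S \<le> 2 * (degree f - 1)" by blast+
  qed
  have pos: "poly S x \<in> T \<and> (poly S x = 0 \<longrightarrow> (\<forall>(t, g)\<in>set L. poly g x = 0))" if "x \<in> F" for x
    unfolding Sx using L(1,3,4)
  proof (induction L)
    case Nil
    show ?case by (simp add: cone_zero)
  next
    case (Cons y L)
    obtain t g where y: "y = (t, g)" by (cases y)
    have g: "t \<in> T" "t \<noteq> 0" "g \<in> polys_over F" using Cons.prems[of t g] y by auto
    let ?s = "t * poly g x ^ 2" and ?r = "\<Sum>(t, g)\<leftarrow>L. t * poly g x ^ 2"
    have s: "?s \<in> T" using g that by (intro cone_mult cone_power2 poly_closed)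
    have r: "?r \<in> T \<and> (?r = 0 \<longrightarrow> (\<forall>(t, g)\<in>set L. poly g x = 0))"
      by (rule Cons.IH) (meson Cons.prems list.set_intros(2))+
    have "?s = 0 \<and> ?r = 0" if "?s + ?r = 0"
      using that s r cone_antisym[of ?s] by (auto simp: add_eq_0_iff)
    then show ?case using s r g y by (auto intro: cone_add)
  qed
  show ?case
  proof (cases "\<exists>c\<in>F. poly f c \<noteq> 0 \<and> (\<forall>(t, g)\<in>set L. poly g c = 0)")
    case True
    then obtain c where c: "c \<in> F" "poly f c \<noteq> 0" "\<And>t g. (t, g) \<in> set L \<Longrightarrow> poly g c = 0" by blast
    define L' where "L' = map (\<lambda>(t, g). (t, synthetic_div g c)) L"
    have div: "g = [:- c, 1:] * synthetic_div g c" if "(t, g) \<in> set L" for t g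
      using synthetic_div_correct'[of c g] c(3)[OF that] by simp
    have eval: "poly g x = (x - c) * poly (synthetic_div g c) x" if "(t, g) \<in> set L" for t g x
      using arg_cong[OF div[OF that], of "\<lambda>p. poly p x"] by (simp add: algebra_simps)
    have "(\<Sum>(t, g)\<leftarrow>M. t * poly g \<theta> ^ 2) =
        (\<theta> - c) ^ 2 * (\<Sum>(t, g)\<leftarrow>map (\<lambda>(t, g). (t, synthetic_div g c)) M. t * poly g \<theta> ^ 2)"
      if "set M \<subseteq> set L" for M
      using that
    proof (induction M)
      case (Cons y M)
      obtain t g where y: "y = (t, g)" by (cases y)
      have "poly g \<theta> = (\<theta> - c) * poly (synthetic_div g c) \<theta>"
        using eval[of t g] Cons.prems y by auto
      then show ?case
        using Cons by (simp add: y power_mult_distrib distrib_left)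
    qed simp
    then have "(\<Sum>(t, g)\<leftarrow>L. t * poly g \<theta> ^ 2) = (\<theta> - c) ^ 2 * (\<Sum>(t, g)\<leftarrow>L'. t * poly g \<theta> ^ 2)"
      unfolding L'_def by blast
    moreover have "\<theta> \<noteq> c" using c(2) \<theta> by auto
    ultimately have sum': "(\<Sum>(t, g)\<leftarrow>L'. t * poly g \<theta> ^ 2) = 0" using less.prems(2) by simp
    have sub': "set L' \<subseteq> (T - {0}) \<times> {g \<in> polys_over F. degree g < degree f}"
      using L synthetic_div_polys_over[OF subring _ c(1)] degree_synthetic_div[of _ c]
      unfolding L'_def by (fastforce intro: le_less_trans)
    show ?thesis
    proof (rule ccontr)
      assume "\<not> ?thesis"
      then obtain t g where tg: "(t, g) \<in> set L" "g \<noteq> 0" by blast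
      have "degree g \<noteq> 0"
      proof
        assume "degree g = 0"
        then obtain d where "g = [:d:]" by (rule degree_eq_zeroE)
        then show False using c(3)[OF tg(1)] tg(2) by simp
      qed
      have sum_deg: "(\<Sum>(t, g)\<leftarrow>L'. degree g) = (\<Sum>(t, g)\<leftarrow>L. degree g - 1)"
        unfolding L'_def by (induction L) (auto simp: degree_synthetic_div)
      have "(\<Sum>(t, g)\<leftarrow>L. degree g - 1) < (\<Sum>(t, g)\<leftarrow>L. degree g)"
      proof -
        obtain L1 L2 where "L = L1 @ (t, g) # L2" using split_list[OF tg(1)] by blast
        moreover have "(\<Sum>(t, g)\<leftarrow>M. degree g - 1) \<le> (\<Sum>(t, g)\<leftarrow>M. degree g)"
          for M :: "(complex \<times> complex poly) list"
          by (induction M) auto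
        from this[of L1] this[of L2] have "(\<Sum>(t, g)\<leftarrow>L1. degree g - 1) + ((degree g - 1) + (\<Sum>(t, g)\<leftarrow>L2. degree g - 1))
            < (\<Sum>(t, g)\<leftarrow>L1. degree g) + (degree g + (\<Sum>(t, g)\<leftarrow>L2. degree g))"
          using \<open>degree g \<noteq> 0\<close> by linarith
        ultimately show ?thesis by simp
      qed
      then have "\<forall>(t, g)\<in>set L'. g = 0"
        using less.hyps[OF _ sub' sum'] sum_deg by simp
      then have "synthetic_div g c = 0" using tg(1) unfolding L'_def by fastforce
      then show False using div[OF tg(1)] tg(2) by simp
    qed
  next
    case False
    show ?thesis
    proof (cases "L = []")
      case nonempty: False
      have "poly S \<theta> = 0" using less.prems(2) by (simp add: Sx)
      then obtain c u where cu: "c \<in> F" "c \<noteq> 0" "u \<in> polys_over F" "smult c S = u * f"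
        using vanishing_poly_multiple[OF S(1)] by blast
      \<comment> \<open>The additional factor turns the scalar into a square,
        \<open>c ^ 2 * S = h * f\<close>, so the sign of \<open>c\<close> does not matter.\<close>
      define h where "h = smult c u"
      have h: "h \<in> polys_over F" unfolding h_def by (intro polys_over_smult subring cu)
      have "smult (c ^ 2) S = smult c (smult c S)" by (simp add: power2_eq_square)
      then have hS: "smult (c ^ 2) S = h * f" by (simp only: cu(4) h_def mult_smult_left)
      have val: "c ^ 2 * poly S x = poly h x * poly f x" for x
        using arg_cong[OF hS, of "\<lambda>p. poly p x"] by simp
      have Spos: "sg (poly S x) = 1" if "x \<in> F" "poly f x \<noteq> 0" for x
        using False pos[OF that(1)] that by (auto simp: sg_eq_1_iff)
      have f_ab: "poly f a \<noteq> 0" "poly f b \<noteq> 0" using signs by auto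
      have "S \<noteq> 0" using Spos[OF ab(1) f_ab(1)] by auto
      then have "h \<noteq> 0" using hS cu(2) by auto
      moreover have "f \<noteq> 0" using degree_pos by auto
      ultimately have "degree S = degree h + degree f"
        using arg_cong[OF hS, of degree] cu(2) by (simp add: degree_mult_eq)
      then have deg_h: "degree h < degree f" using S(2) degree_pos by linarith
      have c2: "sg (c ^ 2) = 1" using cone_power2[OF cu(1)] cu(2) by (simp add: sg_eq_1_iff)
      have "sg (poly h x) * sg (poly f x) = 1" if "x \<in> F" "poly f x \<noteq> 0" for x
      proof -
        have "poly h x \<in> F" "poly f x \<in> F" "poly S x \<in> F" "c ^ 2 \<in> F"
          using that h f S(1) cu(1) by (auto intro: poly_closed closed)
        then show ?thesis
          using arg_cong[OF val[of x], of sg] Spos[OF that] c2 by (simp add: sg_mult)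
      qed
      then have hs: "sg (poly h a) = - 1" "sg (poly h b) = 1"
        using signs ab f_ab by fastforce+
      then obtain x where x: "x \<in> F" "sg (x - a) = 1" "sg (b - x) = 1" "poly h x = 0"
        using minimal[OF h deg_h] by blast
      then have "poly f x \<noteq> 0" using no_root by blast
      then have "poly S x \<noteq> 0" using Spos[OF x(1)] by auto
      then show ?thesis using val[of x] x(4) cu(2) by simp
    qed simp
  qed
qed

text \<open>Every element of \<open>adjoin F \<theta>\<close> is the value of a polynomial of degree
  below that of \<open>f\<close>, which carries the sum over to polynomials. Terms of weight 0 are
  removed before, since they say nothing about \<open>y\<close>.\<close>

lemma sum_squares_adjoin_zero:
  assumes "set L \<subseteq> T \<times> adjoin F \<theta>" and "(\<Sum>(t, y)\<leftarrow>L. t * y ^ 2) = 0" and "(t, y) \<in> set L"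
  shows "t * y ^ 2 = 0"
proof -
  have "\<exists>g. g \<in> polys_over F \<and> degree g < degree f \<and> poly g \<theta> = y" if "y \<in> adjoin F \<theta>" for y
    using that reduce_degree unfolding adjoin_def by (metis imageE)
  then obtain r where r: "\<And>y. y \<in> adjoin F \<theta> \<Longrightarrow> r y \<in> polys_over F \<and> degree (r y) < degree f \<and> poly (r y) \<theta> = y"
    by metis
  define L' where "L' = map (\<lambda>(t, y). (t, r y)) (filter (\<lambda>(t, y). t \<noteq> 0) L)"
  have "(\<Sum>(t, g)\<leftarrow>L'. t * poly g \<theta> ^ 2) = (\<Sum>(t, y)\<leftarrow>L. t * y ^ 2)"
    unfolding L'_def using assms(1) r by (induction L) auto
  moreover have "set L' \<subseteq> (T - {0}) \<times> {g \<in> polys_over F. degree g < degree f}"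
    unfolding L'_def using assms(1) r by auto
  ultimately have *: "\<forall>(t, g)\<in>set L'. g = 0" using sum_squares_poly_zero assms(2) by simp
  show ?thesis
  proof (cases "t = 0")
    case False
    then have "(t, r y) \<in> set L'" using assms(3) unfolding L'_def by force
    then have "r y = 0" using * by blast
    then show ?thesis using r assms(1,3) by force
  qed simp
qed

text \<open>The condition with content is the last one: representations of \<open>x\<close> and
  \<open>- x\<close> together form a sum equal to 0, so each of its terms is 0.\<close>

lemma pos_cone_weighted_squares: "pos_cone (weighted_squares T (adjoin F \<theta>))"
proof -
  note A = unital_subring_closed[OF unital_subring_adjoin[OF subring, of \<theta>]]
  let ?W = "weighted_squares T (adjoin F \<theta>)"
  have sq: "y ^ 2 \<in> ?W" if "y \<in> adjoin F \<theta>" for y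
    using weighted_squares.step[OF cone_one that weighted_squares.zero] by simp
  have sub: "?W \<subseteq> adjoin F \<theta>"
  proof
    fix x assume "x \<in> ?W"
    then show "x \<in> adjoin F \<theta>"
      by induction (use cone_subset subset_adjoin[OF subring, of \<theta>] in \<open>auto intro!: A\<close>)
  qed
  have antisym: "x = 0" if x: "x \<in> ?W" "- x \<in> ?W" for x
  proof -
    obtain L where L: "set L \<subseteq> T \<times> adjoin F \<theta>" "x = (\<Sum>(t, y)\<leftarrow>L. t * y ^ 2)"
      using weighted_squares_list[OF x(1)] .
    obtain L' where L': "set L' \<subseteq> T \<times> adjoin F \<theta>" "- x = (\<Sum>(t, y)\<leftarrow>L'. t * y ^ 2)"
      using weighted_squares_list[OF x(2)] .
    have "(\<Sum>(t, y)\<leftarrow>L @ L'. t * y ^ 2) = 0"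
      by (simp only: map_append sum_list_append L(2)[symmetric] L'(2)[symmetric] add.right_inverse)
    then have zero: "t * y ^ 2 = 0" if "(t, y) \<in> set L" for t y
      using sum_squares_adjoin_zero[of "L @ L'" t y] L(1) L'(1) that by auto
    have "(\<Sum>(t, y)\<leftarrow>M. t * y ^ 2) = 0" if "set M \<subseteq> set L" for M
      using that
    proof (induction M)
      case (Cons z M)
      then show ?case using zero[of "fst z" "snd z"] by (cases z) auto
    qed simp
    then show ?thesis by (simp only: L(2) order_refl)
  qed
  show ?thesis
    unfolding pos_cone_def
  proof (intro conjI ballI impI)
    show "0 \<in> ?W" by (rule weighted_squares.zero)
    show "1 \<in> ?W" using sq[OF A(1)] by simp
    fix x assume x: "x \<in> ?W"
    show "x = 0" if "- x \<in> ?W" using antisym[OF x that] .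
    fix y assume y: "y \<in> ?W"
    show "x + y \<in> ?W" by (rule weighted_squares_add[OF x y])
    show "x * y \<in> ?W" by (rule weighted_squares_mult[OF cone_mult A(6) x y])
    show "(x - y) ^ 2 \<in> ?W" using x y sub by (intro sq A(4)) auto
  qed
qed

end

end

text \<open>For a bad polynomial \<open>f\<close> with root \<open>\<theta>\<close>, the weighted
  squares form a cone containing \<open>T\<close>, hence equal to \<open>T\<close>. So the squares
  of \<open>adjoin F \<theta>\<close> lie in \<open>F\<close>, by polarisation
  \<open>\<theta>\<close> does, and irreducibility makes \<open>f\<close> linear. But the root of a
  linear polynomial lies where the sign changes, between \<open>a\<close> and
  \<open>b\<close>.\<close>

theorem real_closed_cone_field:
  fixes T :: "complex set"
  assumes T: "maximal_cone T"
  shows "real_closed_subfield (cone_field T) T"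
proof -
  define F where "F = cone_field T"
  interpret ordered_subfield F T
    unfolding F_def by (rule ordered_subfield_cone_field[OF T])
  have False if bad: "bad_polynomial F T f a b" for f a b
  proof -
    interpret bad_polynomial F T f a b by (rule bad)
    obtain \<theta> where \<theta>: "poly f \<theta> = 0"
      using degree_pos fundamental_theorem_of_algebra[of f] by (auto simp: constant_degree)
    let ?W = "weighted_squares T (adjoin F \<theta>)"
    note A = unital_subring_closed[OF unital_subring_adjoin[OF subring, of \<theta>]]
    have "T \<subseteq> ?W"
      using weighted_squares.step[OF _ A(1) weighted_squares.zero] by force
    then have WT: "?W = T"
      using T pos_cone_weighted_squares[OF \<theta>] by (simp add: maximal_cone_def)
    have sq: "y ^ 2 \<in> F" if "y \<in> adjoin F \<theta>" for y
      using weighted_squares.step[OF cone_one that weighted_squares.zero] cone_subset WT by auto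
    note \<theta>A = in_adjoin[OF subring, of \<theta>]
    have \<theta>F: "\<theta> \<in> F"
      by (rule in_subfield_if_squares[OF sq sq]) (intro A \<theta>A)+
    have "degree f \<le> 1"
    proof (rule ccontr)
      assume "\<not> ?thesis"
      then have "[:- \<theta>, 1:] = 0"
        by (intro small_poly_zero[OF \<theta>] polys_over_linear subring \<theta>F) simp_all
      then show False by simp
    qed
    then have "degree (synthetic_div f \<theta>) = 0" by (simp add: degree_synthetic_div)
    then obtain c where c: "synthetic_div f \<theta> = [:c:]" by (rule degree_eq_zeroE)
    have "synthetic_div f \<theta> \<in> polys_over F" by (rule synthetic_div_polys_over[OF subring f \<theta>F])
    then have "c \<in> F" using c by (simp add: polys_over_pCons_iff subring)
    have "poly f x = (x - \<theta>) * c" for x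
      using arg_cong[OF synthetic_div_correct'[of \<theta> f], of "\<lambda>p. poly p x"] \<theta>
      by (simp add: c algebra_simps)
    then have "sg (\<theta> - a) = 1 \<and> sg (b - \<theta>) = 1"
      using root_of_linear_change[OF ab(1,2) \<theta>F \<open>c \<in> F\<close> ab(3)] signs by simp
    then show False using no_root[OF \<theta>F] \<theta> by blast
  qed
  note no_bad = this
  have ivt: "\<exists>c\<in>F. sg (c - a) = 1 \<and> sg (b - c) = 1 \<and> poly p c = 0"
    if "p \<in> polys_over F" "a \<in> F" "b \<in> F" "sg (b - a) = 1" "sg (poly p a) = - 1" "sg (poly p b) = 1"
    for p a b
    using that
  proof (induction "degree p" arbitrary: p rule: less_induct)
    case less
    show ?case
    proof (rule ccontr)
      assume neg: "\<not> ?thesis"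
      \<comment> \<open>The minimality demanded of a bad polynomial is the induction
        hypothesis.\<close>
      have "bad_polynomial F T p a b"
        by unfold_locales (use neg less in blast)+
      then show False by (rule no_bad)
    qed
  qed
  show ?thesis
    unfolding F_def[symmetric] by unfold_locales (rule ivt)
qed

section \<open>Descent to a countable real closed subfield\<close>

section \<open>Countable real closed subfields\<close>

context real_closed_subfield
begin

definition closure_step :: "'a set \<Rightarrow> 'a set" where
  "closure_step C = C \<union> {1} \<union> (\<lambda>(x, y). x - y) ` (C \<times> C) \<union> (\<lambda>(x, y). x * y) ` (C \<times> C) \<union> inverse ` C \<union>
     (\<Union>p\<in>polys_over C - {0}. {x \<in> F. poly p x = 0})"

lemma closure_step_countable: "countable C \<Longrightarrow> countable (closure_step C)"
  unfolding closure_step_def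
proof (intro countable_Un countable_UN)
  fix p assume "p \<in> polys_over C - {0}"
  then have "p \<noteq> 0" by blast
  have "{x \<in> F. poly p x = 0} \<subseteq> {x. poly p x = 0}" by blast
  from finite_subset[OF this poly_roots_finite[OF \<open>p \<noteq> 0\<close>]]
  show "countable {x \<in> F. poly p x = 0}" by (rule countable_finite)
qed (simp_all add: countable_polys_over countable_Diff)

lemma closure_step_subset: "C \<subseteq> F \<Longrightarrow> closure_step C \<subseteq> F"
  unfolding closure_step_def by (auto intro!: closed)

text \<open>Closing under field operations and roots countably often keeps the set countable, and a
  polynomial over the union has its finitely many coefficients in a single stage. The intermediate
  value property is inherited, because the root found in \<open>F\<close> is a root of a nonzero
  polynomial over \<open>F0\<close> and so belongs to \<open>F0\<close>.\<close>

theorem countable_real_closed_subfield: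
  assumes "B \<subseteq> F" "countable B"
  obtains F0 where "B \<subseteq> F0" "F0 \<subseteq> F" "countable F0" "real_closed_subfield F0 (T \<inter> F0)"
proof -
  define S where "S n = (closure_step ^^ n) B" for n
  define F0 where "F0 = (\<Union>n. S n)"
  have S_Suc: "S (Suc n) = closure_step (S n)" and S_0: "S 0 = B" for n by (simp_all add: S_def)
  have SF: "S n \<subseteq> F" for n by (induction n) (simp_all add: S_0 S_Suc assms closure_step_subset)
  have "countable (S n)" for n by (induction n) (simp_all add: S_0 S_Suc assms closure_step_countable)
  then have count: "countable F0" unfolding F0_def by blast
  have step: "S n \<subseteq> S (Suc n)" for n unfolding S_Suc closure_step_def by blast
  have mono: "S m \<subseteq> S n" if "m \<le> n" for m n using lift_Suc_mono_le[of S, OF step that] .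
  have two: "\<exists>n. x \<in> S n \<and> y \<in> S n" if xy: "x \<in> F0" "y \<in> F0" for x y
  proof -
    obtain i j where "x \<in> S i" "y \<in> S j" using xy unfolding F0_def by blast
    then have "x \<in> S (max i j)" "y \<in> S (max i j)" using mono[of i "max i j"] mono[of j "max i j"] by auto
    then show ?thesis by blast
  qed
  have F0F: "F0 \<subseteq> F" unfolding F0_def using SF by blast
  have in_F0: "closure_step (S n) \<subseteq> F0" for n unfolding F0_def using S_Suc by blast
  have "x - y \<in> F0" "x * y \<in> F0" if xy: "x \<in> F0" "y \<in> F0" for x y
  proof -
    obtain n where "x \<in> S n" "y \<in> S n" using two[OF xy] by blast
    then have "x - y \<in> closure_step (S n)" "x * y \<in> closure_step (S n)"
      unfolding closure_step_def by auto
    then show "x - y \<in> F0" "x * y \<in> F0" using in_F0 by blast+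
  qed
  moreover have "1 \<in> F0" using in_F0[of 0] unfolding closure_step_def by blast
  ultimately have sub: "unital_subring F0" by (simp add: unital_subring_def)
  have inv: "inverse x \<in> F0" if x: "x \<in> F0" for x
  proof -
    obtain n where "x \<in> S n" using x unfolding F0_def by blast
    then have "inverse x \<in> closure_step (S n)" unfolding closure_step_def by blast
    then show ?thesis using in_F0 by blast
  qed
  have roots: "x \<in> F0" if p: "p \<in> polys_over F0" "p \<noteq> 0" "x \<in> F" "poly p x = 0" for p x
  proof -
    have "\<exists>n. q \<in> polys_over (S n)" if "q \<in> polys_over F0" for q
      using that
    proof (induction q)
      case 0
      obtain n where "0 \<in> S n" using unital_subring_zero[OF sub] unfolding F0_def by blast
      then have "0 \<in> polys_over (S n)" by (simp add: polys_over_def)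
      then show ?case by blast
    next
      case (pCons c q)
      then obtain i where i: "q \<in> polys_over (S i)" by (auto simp: polys_over_pCons_iff sub)
      have "c \<in> F0" using pCons.prems by (simp add: polys_over_pCons_iff sub)
      then obtain j where j: "c \<in> S j" unfolding F0_def by blast
      have "pCons c q \<in> polys_over (S (max i j))"
        using i j mono[of i "max i j"] mono[of j "max i j"]
        by (auto simp: polys_over_def coeff_pCons split: nat.splits)
      then show ?case by blast
    qed
    then obtain n where "p \<in> polys_over (S n)" using p(1) by blast
    then have "x \<in> closure_step (S n)" unfolding closure_step_def using p by blast
    then show ?thesis using in_F0 by blast
  qed
  interpret R: ordered_subfield F0 "T \<inter> F0"
  proof
    show "x \<in> T \<inter> F0 \<or> - x \<in> T \<inter> F0" if "x \<in> F0" for x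
      using that cone_total[of x] F0F unital_subring_uminus[OF sub that] by auto
  qed (use sub inv cone_add cone_mult cone_antisym unital_subring_closed[OF sub] in auto)
  have sg: "R.sg x = sg x" if "x \<in> F0" for x using that by (simp add: R.sg_def sg_def)
  have "real_closed_subfield F0 (T \<inter> F0)"
  proof
    fix p a b
    assume *: "p \<in> polys_over F0" "a \<in> F0" "b \<in> F0" "R.sg (b - a) = 1" "R.sg (poly p a) = - 1"
      "R.sg (poly p b) = 1"
    have cl: "poly p x \<in> F0" "x - y \<in> F0" if "x \<in> F0" "y \<in> F0" for x y
      using that * by (auto intro: poly_in_subring[OF sub] unital_subring_diff[OF sub])
    have "p \<in> polys_over F" "a \<in> F" "b \<in> F" using * F0F by (auto intro: polys_over_mono)
    moreover have "sg (b - a) = 1" "sg (poly p a) = - 1" "sg (poly p b) = 1"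
      using * cl by (simp_all add: sg)
    ultimately obtain c where c: "c \<in> F" "sg (c - a) = 1" "sg (b - c) = 1" "poly p c = 0"
      using ivt by blast
    have "p \<noteq> 0" using *(5) by auto
    then have "c \<in> F0" using roots *(1) c by blast
    then show "\<exists>c\<in>F0. R.sg (c - a) = 1 \<and> R.sg (b - c) = 1 \<and> poly p c = 0"
      using c * cl by (auto simp: sg)
  qed
  then show ?thesis using that F0F count S_0 unfolding F0_def by blast
qed

end

section \<open>A nonprincipal ultrafilter, the hyperreal field and its saturation\<close>

section \<open>An ultrapower of the real numbers\<close>

text \<open>The maximal families of this kind are the nonprincipal ultrafilters on the natural
  numbers; infinite instead of nonempty intersections force all cofinite sets into them.\<close>

definition large_family :: "nat set set \<Rightarrow> bool" where
  "large_family U \<longleftrightarrow> (\<forall>B. finite B \<longrightarrow> B \<subseteq> U \<longrightarrow> infinite (\<Inter>B))"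

lemma maximal_large_family:
  "\<exists>U. large_family U \<and> (\<forall>V. large_family V \<longrightarrow> U \<subseteq> V \<longrightarrow> V = U)"
proof -
  have "\<exists>U\<in>Collect large_family. \<forall>V\<in>Collect large_family. U \<subseteq> V \<longrightarrow> V = U"
  proof (rule subset_Zorn_nonempty)
    show "Collect large_family \<noteq> {}" by (auto simp: large_family_def intro!: exI[of _ "{}"])
    fix C assume C: "C \<noteq> {}" "subset.chain (Collect large_family) C"
    have "infinite (\<Inter>B)" if B: "finite B" "B \<subseteq> \<Union>C" for B
    proof -
      obtain V where "V \<in> C" "B \<subseteq> V"
        using finite_subset_Union_chain[OF B C] .
      then show ?thesis using C B(1) by (auto simp: subset.chain_def large_family_def)
    qed
    then show "\<Union>C \<in> Collect large_family" by (simp add: large_family_def)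
  qed
  then show ?thesis by blast
qed

definition ultra :: "nat set set" where
  "ultra = (SOME U. large_family U \<and> (\<forall>V. large_family V \<longrightarrow> U \<subseteq> V \<longrightarrow> V = U))"

lemma ultra: "large_family ultra" "large_family V \<Longrightarrow> ultra \<subseteq> V \<Longrightarrow> V = ultra"
  using someI_ex[OF maximal_large_family] unfolding ultra_def by blast+

lemma ultra_infinite_Inter: "finite B \<Longrightarrow> B \<subseteq> ultra \<Longrightarrow> infinite (\<Inter>B)"
  using ultra(1) by (simp add: large_family_def)

text \<open>The assumption keeps the family large when \<open>A\<close> is adjoined, so
  \<open>A\<close> belongs to it by maximality.\<close>

lemma in_ultraI:
  assumes "\<And>B. finite B \<Longrightarrow> B \<subseteq> ultra \<Longrightarrow> infinite (A \<inter> \<Inter>B)"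
  shows "A \<in> ultra"
proof -
  have "infinite (\<Inter>B)" if "finite B" "B \<subseteq> insert A ultra" for B
  proof -
    have "infinite (A \<inter> \<Inter>(B - {A}))" using that by (intro assms) auto
    moreover have "A \<inter> \<Inter>(B - {A}) \<subseteq> \<Inter>B" by blast
    ultimately show ?thesis by (metis infinite_super)
  qed
  then have "large_family (insert A ultra)" by (simp add: large_family_def)
  then show ?thesis using ultra(2) by blast
qed

lemma ultra_Int: 
  assumes "A \<in> ultra" "B \<in> ultra"
  shows "A \<inter> B \<in> ultra"
proof (rule in_ultraI)
  fix C assume "finite C" "C \<subseteq> ultra"
  then show "infinite (A \<inter> B \<inter> \<Inter>C)"
    using ultra_infinite_Inter[of "insert A (insert B C)"] assms by (simp add: Int_assoc)
qed

lemma ultra_mono: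
  assumes "A \<in> ultra" "A \<subseteq> B"
  shows "B \<in> ultra"
proof (rule in_ultraI)
  fix C assume "finite C" "C \<subseteq> ultra"
  then have "infinite (A \<inter> \<Inter>C)" using ultra_infinite_Inter[of "insert A C"] assms by simp
  moreover have "A \<inter> \<Inter>C \<subseteq> B \<inter> \<Inter>C" using assms by blast
  ultimately show "infinite (B \<inter> \<Inter>C)" by (metis infinite_super)
qed

lemma ultra_infinite: "A \<in> ultra \<Longrightarrow> infinite A"
  using ultra_infinite_Inter[of "{A}"] by simp

lemma cofinite_in_ultra: "finite (- A) \<Longrightarrow> A \<in> ultra"
proof (rule in_ultraI)
  fix B assume "finite (- A)" and B: "finite B" "B \<subseteq> ultra"
  then have "infinite (\<Inter>B - (- A))" using ultra_infinite_Inter[OF B] by (intro Diff_infinite_finite)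
  moreover have "\<Inter>B - (- A) = A \<inter> \<Inter>B" by blast
  ultimately show "infinite (A \<inter> \<Inter>B)" by simp
qed

text \<open>Finite subfamilies \<open>B\<close> witnessing against \<open>A\<close> and
  \<open>C\<close> against its complement would together have a finite intersection.\<close>

lemma ultra_Compl: "A \<notin> ultra \<Longrightarrow> - A \<in> ultra"
proof -
  assume "A \<notin> ultra"
  then obtain B where B: "finite B" "B \<subseteq> ultra" "finite (A \<inter> \<Inter>B)" using in_ultraI by blast
  show ?thesis
  proof (rule in_ultraI)
    fix C assume C: "finite C" "C \<subseteq> ultra"
    have "infinite (\<Inter>(B \<union> C))" using B C by (intro ultra_infinite_Inter) auto
    moreover have "\<Inter>(B \<union> C) \<subseteq> (A \<inter> \<Inter>B) \<union> (- A \<inter> \<Inter>C)" by blast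
    ultimately show "infinite (- A \<inter> \<Inter>C)" using B(3) by (metis finite_Un infinite_super)
  qed
qed

definition almost_all :: "(nat \<Rightarrow> bool) \<Rightarrow> bool" where
  "almost_all P \<longleftrightarrow> {n. P n} \<in> ultra"

lemma almost_all_mono: "almost_all P \<Longrightarrow> (\<And>n. P n \<Longrightarrow> Q n) \<Longrightarrow> almost_all Q"
  unfolding almost_all_def by (erule ultra_mono) auto

lemma almost_all_conj: "almost_all P \<Longrightarrow> almost_all Q \<Longrightarrow> almost_all (\<lambda>n. P n \<and> Q n)"
  unfolding almost_all_def using ultra_Int by (simp add: Collect_conj_eq)

lemma almost_all_mono2: "almost_all P \<Longrightarrow> almost_all Q \<Longrightarrow> (\<And>n. P n \<Longrightarrow> Q n \<Longrightarrow> R n) \<Longrightarrow> almost_all R"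
  using almost_all_mono[OF almost_all_conj] by blast

lemma almost_all_cofinite: "finite {n. \<not> P n} \<Longrightarrow> almost_all P"
  unfolding almost_all_def by (rule cofinite_in_ultra) (simp add: Collect_neg_eq)

lemma almost_all_True: "(\<And>n. P n) \<Longrightarrow> almost_all P"
  by (rule almost_all_cofinite) simp

lemma not_aa: "\<not> almost_all P \<longleftrightarrow> almost_all (\<lambda>n. \<not> P n)"
proof
  assume "\<not> almost_all P"
  then show "almost_all (\<lambda>n. \<not> P n)" unfolding almost_all_def using ultra_Compl by (simp add: Collect_neg_eq)
next
  assume *: "almost_all (\<lambda>n. \<not> P n)"
  show "\<not> almost_all P"
  proof
    assume "almost_all P"
    with * have "almost_all (\<lambda>n. False)" by (rule almost_all_mono2) simp
    then show False unfolding almost_all_def using ultra_infinite by fastforce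
  qed
qed

lemma almost_all_disj: "almost_all (\<lambda>n. P n \<or> Q n) \<Longrightarrow> almost_all P \<or> almost_all Q"
  using almost_all_mono2[of "\<lambda>n. P n \<or> Q n" "\<lambda>n. \<not> P n" Q] not_aa[of P] by blast

lemma almost_all_const [simp]: "almost_all (\<lambda>n. P) \<longleftrightarrow> P"
  using almost_all_True[of "\<lambda>n. P"] not_aa[of "\<lambda>n. P"] almost_all_True[of "\<lambda>n. \<not> P"] by blast

lemma almost_all_ex: "almost_all P \<Longrightarrow> \<exists>n. P n"
  using not_aa[of P] almost_all_True[of "\<lambda>n. \<not> P n"] by blast

lemma almost_all_all_le: "(\<And>i. i \<le> (k::nat) \<Longrightarrow> almost_all (P i)) \<Longrightarrow> almost_all (\<lambda>n. \<forall>i\<le>k. P i n)"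
proof (induction k)
  case (Suc k)
  then have "almost_all (\<lambda>n. \<forall>i\<le>k. P i n)" "almost_all (P (Suc k))" by auto
  then show ?case by (rule almost_all_mono2) (auto simp: le_Suc_eq)
qed simp

quotient_type hyper = "nat \<Rightarrow> real" / "\<lambda>x y. almost_all (\<lambda>n. x n = y n)"
  morphisms rep_hyper hyper_of
proof (rule equivpI)
  show "reflp (\<lambda>x y. almost_all (\<lambda>n. x n = y n))" by (rule reflpI) simp
  show "symp (\<lambda>x y. almost_all (\<lambda>n. x n = y n))" by (rule sympI) (simp add: eq_commute)
  show "transp (\<lambda>x y. almost_all (\<lambda>n. x n = y n))" by (rule transpI) (erule almost_all_mono2, assumption, simp)
qed

instantiation hyper :: linordered_field
begin

lift_definition zero_hyper :: hyper is "\<lambda>n. 0" .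
lift_definition one_hyper :: hyper is "\<lambda>n. 1" .
lift_definition plus_hyper :: "hyper \<Rightarrow> hyper \<Rightarrow> hyper" is "\<lambda>x y n. x n + y n"
  by (erule almost_all_mono2, assumption) simp
lift_definition times_hyper :: "hyper \<Rightarrow> hyper \<Rightarrow> hyper" is "\<lambda>x y n. x n * y n"
  by (erule almost_all_mono2, assumption) simp
lift_definition minus_hyper :: "hyper \<Rightarrow> hyper \<Rightarrow> hyper" is "\<lambda>x y n. x n - y n"
  by (erule almost_all_mono2, assumption) simp
lift_definition uminus_hyper :: "hyper \<Rightarrow> hyper" is "\<lambda>x n. - x n"
  by (erule almost_all_mono) simp
lift_definition inverse_hyper :: "hyper \<Rightarrow> hyper" is "\<lambda>x n. inverse (x n)"
  by (erule almost_all_mono) simp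
definition divide_hyper :: "hyper \<Rightarrow> hyper \<Rightarrow> hyper" where
  "divide_hyper x y = x * inverse y"
lift_definition less_eq_hyper :: "hyper \<Rightarrow> hyper \<Rightarrow> bool" is "\<lambda>x y. almost_all (\<lambda>n. x n \<le> y n)"
  by (intro iffI; erule almost_all_mono2, erule almost_all_conj, assumption) auto
lift_definition less_hyper :: "hyper \<Rightarrow> hyper \<Rightarrow> bool" is "\<lambda>x y. almost_all (\<lambda>n. x n < y n)"
  by (intro iffI; erule almost_all_mono2, erule almost_all_conj, assumption) auto
definition abs_hyper :: "hyper \<Rightarrow> hyper" where
  "abs_hyper x = (if x < 0 then - x else x)"
definition sgn_hyper :: "hyper \<Rightarrow> hyper" where
  "sgn_hyper x = (if x = 0 then 0 else if 0 < x then 1 else - 1)"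

instance
proof
  fix x y z :: hyper
  show "x + y + z = x + (y + z)" "x + y = y + x" "0 + x = x" "- x + x = 0" "x - y = x + - y"
    "x * y * z = x * (y * z)" "x * y = y * x" "1 * x = x" "(x + y) * z = x * z + y * z"
    "x + y - x = y" "x - y - z = x - (y + z)" "0 * x = 0" "x * 0 = 0"
    "(0::hyper) \<noteq> 1" "inverse (0::hyper) = 0"
    by (transfer; simp add: algebra_simps)+
  show "x div y = x * inverse y" by (rule divide_hyper_def)
  show "x \<noteq> 0 \<Longrightarrow> inverse x * x = 1"
    by transfer (auto simp: not_aa elim: almost_all_mono)
  show "x \<le> x" by transfer simp
  show "x \<le> y \<Longrightarrow> y \<le> z \<Longrightarrow> x \<le> z" by transfer (erule almost_all_mono2, assumption, simp)
  show "x \<le> y \<Longrightarrow> y \<le> x \<Longrightarrow> x = y" by transfer (erule almost_all_mono2, assumption, simp)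
  show "x \<le> y \<or> y \<le> x" by transfer (rule almost_all_disj, rule almost_all_True, rule linear)
  show "x < y \<longleftrightarrow> x \<le> y \<and> \<not> y \<le> x"
    by transfer (auto simp: not_aa not_le intro: almost_all_mono elim: almost_all_mono less_imp_le)
  show "x \<le> y \<Longrightarrow> z + x \<le> z + y" by transfer (erule almost_all_mono, simp)
  show "x < y \<Longrightarrow> 0 < z \<Longrightarrow> z * x < z * y" by transfer (erule almost_all_mono2, assumption, simp)
  show "\<bar>x\<bar> = (if x < 0 then - x else x)" by (rule abs_hyper_def)
  show "sgn x = (if x = 0 then 0 else if 0 < x then 1 else - 1)" by (rule sgn_hyper_def)
qed

end

lift_definition star_of :: "real \<Rightarrow> hyper" is "\<lambda>c n. c" .

lemma star_of_hom:
  "star_of 1 = 1" "star_of (x - y) = star_of x - star_of y" "star_of (x * y) = star_of x * star_of y"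
  "star_of x = 0 \<longleftrightarrow> x = 0" "0 \<le> star_of x \<longleftrightarrow> 0 \<le> x"
  by (transfer; simp)+

text \<open>Representatives of the coefficients, taken index by index, form a sequence of real
  polynomials; questions about \<open>p\<close> become questions about almost all of these.\<close>

lemma hyper_poly_sequence: "\<exists>q. \<forall>x. poly p (hyper_of x) = hyper_of (\<lambda>n. poly (q n) (x n))"
proof (induction p)
  case 0
  show ?case by (intro exI[of _ "\<lambda>n. 0"]) (simp add: zero_hyper.abs_eq)
next
  case (pCons a p)
  then obtain q where q: "\<And>x. poly p (hyper_of x) = hyper_of (\<lambda>n. poly (q n) (x n))" by blast
  obtain c where c: "a = hyper_of c" by (metis Quotient_hyper Quotient_abs_rep)
  show ?case
    by (intro exI[of _ "\<lambda>n. pCons (c n) (q n)"])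
      (simp add: q c plus_hyper.abs_eq times_hyper.abs_eq)
qed

lemma hyper_poly_IVT:
  fixes p :: "hyper poly"
  assumes "a < b" "poly p a < 0" "0 < poly p b"
  shows "\<exists>c. a < c \<and> c < b \<and> poly p c = 0"
proof -
  obtain q where q: "\<And>x. poly p (hyper_of x) = hyper_of (\<lambda>n. poly (q n) (x n))"
    using hyper_poly_sequence by blast
  obtain x y where xy: "a = hyper_of x" "b = hyper_of y"
    by (metis Quotient_hyper Quotient_abs_rep)
  \<comment> \<open>At indices without such a root the choice is arbitrary; their complement is in
    the ultrafilter.\<close>
  define c where "c n = (SOME c. x n < c \<and> c < y n \<and> poly (q n) c = 0)" for n
  have "almost_all (\<lambda>n. x n < y n)" "almost_all (\<lambda>n. poly (q n) (x n) < 0)" "almost_all (\<lambda>n. 0 < poly (q n) (y n))"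
    using assms by (simp_all add: xy q less_hyper.abs_eq zero_hyper.abs_eq)
  then have "almost_all (\<lambda>n. x n < y n \<and> poly (q n) (x n) < 0 \<and> 0 < poly (q n) (y n))"
    by (intro almost_all_conj)
  then have "almost_all (\<lambda>n. \<exists>c. x n < c \<and> c < y n \<and> poly (q n) c = 0)"
    by (rule almost_all_mono) (use poly_IVT_pos in blast)
  then have "almost_all (\<lambda>n. x n < c n \<and> c n < y n \<and> poly (q n) (c n) = 0)"
    unfolding c_def by (rule almost_all_mono) (erule someI_ex)
  then have "a < hyper_of c \<and> hyper_of c < b \<and> poly p (hyper_of c) = 0"
    by (auto simp: xy q less_hyper.abs_eq zero_hyper.abs_eq hyper.abs_eq_iff elim: almost_all_mono)
  then show ?thesis by blast
qed

text \<open>Countable saturation: at index \<open>n\<close> as many of the first \<open>n\<close> conditions are satisfied as possible.\<close>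

lemma ultra_saturation:
  fixes C :: "nat \<Rightarrow> nat \<Rightarrow> real \<Rightarrow> bool"
  assumes "\<And>k. almost_all (\<lambda>n. \<exists>r. \<forall>i\<le>k. C i n r)"
  obtains t where "\<And>i. almost_all (\<lambda>n. C i n (t n))"
proof -
  define good where "good n k \<longleftrightarrow> (\<exists>r. \<forall>i<k. C i n r)" for n k
  define K where "K n = (GREATEST k. good n k \<and> k \<le> n)" for n
  have K: "good n (K n) \<and> K n \<le> n" for n
    unfolding K_def by (rule GreatestI_nat[where b = n and k = 0]) (auto simp: good_def)
  have max: "k \<le> K n" if "good n k" "k \<le> n" for n k
    unfolding K_def by (rule Greatest_le_nat[where b = n]) (use that in auto)
  obtain t where t: "\<And>n. \<forall>i<K n. C i n (t n)" using K unfolding good_def by metis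
  have "almost_all (\<lambda>n. C i n (t n))" for i
  proof (rule almost_all_mono2[OF assms[of i]])
    show "almost_all (\<lambda>n. Suc i \<le> n)"
      by (rule almost_all_cofinite) (simp add: not_less_eq_eq)
    fix n assume "\<exists>r. \<forall>j\<le>i. C j n r" "Suc i \<le> n"
    then have "Suc i \<le> K n" by (intro max) (auto simp: good_def less_Suc_eq_le)
    then show "C i n (t n)" using t by simp
  qed
  then show ?thesis using that by blast
qed

lemma separate_finite_sets:
  fixes A B :: "'a::linordered_field set"
  assumes "finite A" "finite B" "\<And>a b. a \<in> A \<Longrightarrow> b \<in> B \<Longrightarrow> a < b"
  obtains x where "\<And>a. a \<in> A \<Longrightarrow> a < x" "\<And>b. b \<in> B \<Longrightarrow> x < b"
proof -
  consider "A = {}" "B = {}" | "A = {}" "B \<noteq> {}" | "A \<noteq> {}" "B = {}" | "A \<noteq> {}" "B \<noteq> {}" by blast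
  then show ?thesis
  proof cases
    case 1
    then show ?thesis using that by blast
  next
    case 2
    obtain x where "x < Min B" using lt_ex by blast
    then show ?thesis using 2 that assms(2) by (metis Min_le empty_iff less_le_trans)
  next
    case 3
    obtain x where "Max A < x" using gt_ex by blast
    then show ?thesis using 3 that assms(1) by (metis Max_ge empty_iff le_less_trans)
  next
    case 4
    have "Max A < Min B" using assms 4 by (intro assms(3) Max_in Min_in)
    then obtain x where "Max A < x" "x < Min B" using dense by blast
    then show ?thesis using that assms(1,2) by (metis Max_ge Min_le le_less_trans less_le_trans)
  qed
qed

text \<open>The comparisons are imposed on representatives. Finitely many of them can be met at
  almost every index, since an ordered field has an element strictly between two finite sets;
  saturation then meets all of them.\<close>

lemma hyper_countable_cut:
  fixes s :: "nat \<Rightarrow> bool" and z :: "nat \<Rightarrow> hyper"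
  assumes "\<And>i j. s i \<Longrightarrow> \<not> s j \<Longrightarrow> z i < z j"
  obtains y where "\<And>i. if s i then z i < y else y < z i"
proof -
  define C where "C i n r = (if s i then rep_hyper (z i) n < r else r < rep_hyper (z i) n)" for i n r
  have rep: "x = hyper_of (rep_hyper x)" for x
    using Quotient_hyper by (simp add: Quotient_abs_rep)
  have C: "almost_all (\<lambda>n. C i n (t n)) \<longleftrightarrow> (if s i then z i < hyper_of t else hyper_of t < z i)" for i t
    unfolding C_def by (subst (1 2) rep[of "z i"]) (simp add: less_hyper.abs_eq)
  have "almost_all (\<lambda>n. \<exists>r. \<forall>i\<le>k. C i n r)" for k
  proof -
    obtain x where x: "\<And>a. a \<in> z ` {i. i \<le> k \<and> s i} \<Longrightarrow> a < x" "\<And>b. b \<in> z ` {i. i \<le> k \<and> \<not> s i} \<Longrightarrow> x < b"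
      using separate_finite_sets[of "z ` {i. i \<le> k \<and> s i}" "z ` {i. i \<le> k \<and> \<not> s i}"] assms by auto
    have "almost_all (\<lambda>n. C i n (rep_hyper x n))" if "i \<le> k" for i
      unfolding C rep[symmetric] using x that by auto
    then have "almost_all (\<lambda>n. \<forall>i\<le>k. C i n (rep_hyper x n))" by (rule almost_all_all_le)
    then show ?thesis by (rule almost_all_mono) blast
  qed
  then obtain t where "\<And>i. almost_all (\<lambda>n. C i n (t n))" using ultra_saturation by blast
  then show ?thesis using that[of "hyper_of t"] C by blast
qed

interpretation hyper: real_closed_subfield UNIV "{x::hyper. 0 \<le> x}"
  rewrites "ordered_subfield.sg {x::hyper. 0 \<le> x} = (\<lambda>x. if x = 0 then 0 else if 0 \<le> x then 1 else - 1)"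
proof -
  interpret ordered_subfield UNIV "{x::hyper. 0 \<le> x}"
    by unfold_locales (auto simp: unital_subring_def)
  show sg: "sg = (\<lambda>x. if x = 0 then 0 else if 0 \<le> x then 1 else - 1)"
    by (simp add: fun_eq_iff sg_def)
  show "real_closed_subfield UNIV {x::hyper. 0 \<le> x}"
  proof
    fix p and a b :: hyper
    assume "sg (b - a) = 1" "sg (poly p a) = - 1" "sg (poly p b) = 1"
    then have "a < b" "poly p a < 0" "0 < poly p b" by (auto simp: sg split: if_splits)
    then obtain c where "a < c" "c < b" "poly p c = 0" using hyper_poly_IVT by blast
    then show "\<exists>c\<in>UNIV. sg (c - a) = 1 \<and> sg (b - c) = 1 \<and> poly p c = 0"
      by (auto simp: sg)
  qed
qed

section \<open>The Artin-Lang theorem with values in the hyperreal field\<close>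

section \<open>Points with prescribed equations and inequations\<close>

abbreviation sums_of_squares :: "'a::comm_ring_1 set" where
  "sums_of_squares \<equiv> weighted_squares {1} UNIV"

lemma square_sum_of_squares: "a ^ 2 \<in> sums_of_squares"
  using weighted_squares.step[OF singletonI UNIV_I weighted_squares.zero, of 1 a] by simp

locale real_prime_ideal = prime_ideal_set p for p :: "'r::comm_ring_1 set" +
  fixes const :: "real \<Rightarrow> 'r"
  assumes const_one: "const 1 = 1"
    and const_diff: "const (x - y) = const x - const y"
    and const_mult: "const (x * y) = const x * const y"
    and real_ideal: "s \<in> sums_of_squares \<Longrightarrow> a ^ 2 + s \<in> p \<Longrightarrow> a \<in> p"
begin

lemma const_in: "const c \<in> p \<longleftrightarrow> c = 0"
proof
  assume "const c \<in> p"
  then have "const (inverse c * c) \<in> p" by (simp add: const_mult mult_in)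
  then show "c = 0" using const_one one_notin by (cases "c = 0") auto
next
  show "c = 0 \<Longrightarrow> const c \<in> p" using const_diff[of 0 0] zero_in by simp
qed

lemma const_of_int: "of_int n = const (of_int n)"
proof -
  have zero: "const 0 = 0" using const_diff[of 0 0] by simp
  have add: "const (x + y) = const x + const y" for x y
    using const_diff[of x "0 - y"] const_diff[of 0 y] zero by simp
  have nat: "of_nat k = const (of_nat k)" for k
    by (induction k) (simp_all add: zero add const_one)
  show ?thesis
  proof (cases n)
    case (nonneg k)
    then show ?thesis using nat[of k] by simp
  next
    case (neg k)
    have "const (- x) = - const x" for x using const_diff[of 0 x] zero by simp
    then show ?thesis using nat[of "Suc k"] by (simp only: neg of_int_minus of_int_of_nat_eq)
  qed
qed

lemma sum_of_squares_sum_in: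
  assumes "s \<in> sums_of_squares" "t \<in> sums_of_squares" "s + t \<in> p"
  shows "s \<in> p"
  using assms(1,3)
proof (induction rule: weighted_squares.induct)
  case zero
  show ?case by (rule zero_in)
next
  case (step u a s)
  then have *: "a ^ 2 + (s + t) \<in> p" by (simp add: add.assoc)
  have "a \<in> p" using real_ideal[OF weighted_squares_add[OF step(3) assms(2)] *] .
  then have a2: "a ^ 2 \<in> p" by (simp add: power2_eq_square mult_in)
  then have "s \<in> p" using step.IH add_in_iff[OF a2, of "s + t"] * by blast
  then show ?case using a2 step(1) by (simp add: add_in)
qed

text \<open>\<open>K\<close> is the graph of a homomorphism into the hyperreal field with kernel
  given by \<open>p\<close>, which fixes the real constants in its domain: a generic point as far as
  the finitely many elements of \<open>B\<close> are concerned. It is the composition of a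
  homomorphism \<open>H\<close> into the complex numbers with an order isomorphism \<open>G\<close>
  from a countable real closed field containing the image of \<open>H\<close>.\<close>

theorem hyperreal_point:
  assumes "finite B"
  obtains K :: "('r \<times> hyper) set" where "unital_subring K" "B \<subseteq> fst ` K"
    "\<And>z. z \<in> K \<Longrightarrow> fst z \<in> p \<longleftrightarrow> snd z = 0" "\<And>c b. (const c, b) \<in> K \<Longrightarrow> b = star_of c"
proof -
  obtain H :: "('r \<times> complex) set" where H: "residue_graph H" "countable H" "B \<subseteq> fst ` H"
    using residue_graph_exists[OF _ assms] const_of_int const_in by (metis of_int_eq_0_iff)
  have HS: "unital_subring H" and H0: "\<And>s z. (s, z) \<in> H \<Longrightarrow> s \<in> p \<longleftrightarrow> z = 0"
    using H(1) by (auto simp: residue_graph_def)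
  have Hadd: "(s + t, z + w) \<in> H" and Hdiff: "(s - t, z - w) \<in> H" and Hmult: "(s * t, z * w) \<in> H"
    if "(s, z) \<in> H" "(t, w) \<in> H" for s t z w
    using unital_subring_add[OF HS that] unital_subring_diff[OF HS that] unital_subring_mult[OF HS that]
    by (simp_all add: plus_prod_def minus_prod_def times_prod_def)
  have H1: "(1, 1) \<in> H" using unital_subring_one[OF HS] by (simp add: one_prod_def)
  \<comment> \<open>The squares come from the whole ring and not only from the domain of
    \<open>H\<close>. So a nonnegative constant in the domain has its image in \<open>T0\<close>,
    even if its square root is missing from the domain.\<close>
  define T0 where "T0 = {z. \<exists>s\<in>sums_of_squares. (s, z) \<in> H}"
  have T0I: "z \<in> T0" if "s \<in> sums_of_squares" "(s, z) \<in> H" for s z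
    using that unfolding T0_def by blast
  have T0sq: "z ^ 2 \<in> T0" if "(s, z) \<in> H" for s z
    using T0I[OF square_sum_of_squares, of s] Hmult[OF that that] by (simp add: power2_eq_square)
  have "pos_cone T0"
    unfolding pos_cone_def
  proof (intro conjI ballI impI)
    show "1 \<in> T0" using T0sq[OF H1] by simp
    show "0 \<in> T0" using T0I[OF weighted_squares.zero] Hdiff[OF H1 H1] by simp
    fix z assume "z \<in> T0"
    then obtain s where s: "s \<in> sums_of_squares" "(s, z) \<in> H" unfolding T0_def by blast
    fix w assume "w \<in> T0"
    then obtain t where t: "t \<in> sums_of_squares" "(t, w) \<in> H" unfolding T0_def by blast
    show "z + w \<in> T0" using T0I[OF weighted_squares_add[OF s(1) t(1)] Hadd[OF s(2) t(2)]] .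
    have "s * t \<in> sums_of_squares" by (rule weighted_squares_mult) (use s t in auto)
    then show "z * w \<in> T0" using T0I Hmult[OF s(2) t(2)] by blast
    show "(z - w) ^ 2 \<in> T0" using T0sq[OF Hdiff[OF s(2) t(2)]] .
  next
    \<comment> \<open>Here realness of \<open>p\<close> enters: if the sum of two sums of squares
      lies in \<open>p\<close>, then so does each of them.\<close>
    fix z assume "z \<in> T0" "- z \<in> T0"
    then obtain s t where s: "s \<in> sums_of_squares" "(s, z) \<in> H"
      and t: "t \<in> sums_of_squares" "(t, - z) \<in> H" unfolding T0_def by blast
    have "s + t \<in> p" using H0[OF Hadd[OF s(2) t(2)]] by simp
    then have "s \<in> p" using sum_of_squares_sum_in s(1) t(1) by blast
    then show "z = 0" using H0 s(2) by blast
  qed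
  then obtain T where T: "maximal_cone T" "T0 \<subseteq> T" using maximal_cone_exists by blast
  define F where "F = cone_field T"
  interpret F: real_closed_subfield F T unfolding F_def by (rule real_closed_cone_field[OF T(1)])
  \<comment> \<open>The squares of the image of \<open>H\<close> lie in \<open>T0\<close>, so
    polarisation puts the image into \<open>F\<close>.\<close>
  have "snd z \<in> F" if "z \<in> H" for z
  proof -
    have "(fst z, snd z) \<in> H" using that by simp
    from T0sq[OF Hadd[OF this H1]] T0sq[OF Hdiff[OF this H1]] show ?thesis
      using subset_trans[OF T(2) F.cone_subset] F.in_subfield_if_squares by blast
  qed
  then have "snd ` H \<subseteq> F" by blast
  obtain F0 where F0: "snd ` H \<subseteq> F0" "F0 \<subseteq> F" "countable F0" "real_closed_subfield F0 (T \<inter> F0)"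
    using F.countable_real_closed_subfield[OF \<open>snd ` H \<subseteq> F\<close> countable_image[OF H(2)]] .
  interpret A: real_closed_subfield F0 "T \<inter> F0" by (rule F0(4))
  interpret real_closed_pair F0 "T \<inter> F0" UNIV "{x::hyper. 0 \<le> x}" ..
  \<comment> \<open>The isomorphism starts from the real constants. Otherwise the point obtained
    would be a zero of polynomials with different coefficients.\<close>
  define G0 where "G0 = {(z, star_of c) | z c. (const c, z) \<in> H}"
  have G0I: "(z, star_of c) \<in> G0" if "(const c, z) \<in> H" for z c using that unfolding G0_def by blast
  have "unital_subring G0"
    unfolding unital_subring_def
  proof (intro conjI ballI)
    show "1 \<in> G0" using G0I[of 1 1] H1 by (simp add: const_one star_of_hom one_prod_def)
    fix x y assume "x \<in> G0" "y \<in> G0"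
    then obtain z c w d where "x = (z, star_of c)" "y = (w, star_of d)"
      "(const c, z) \<in> H" "(const d, w) \<in> H" unfolding G0_def by blast
    then show "x - y \<in> G0" "x * y \<in> G0"
      using G0I[of "c - d" "z - w"] G0I[of "c * d" "z * w"] Hdiff Hmult
      by (simp_all add: const_diff const_mult star_of_hom times_prod_def)
  qed
  moreover have "same_sign (z, star_of c)" if c: "(const c, z) \<in> H" for z c
  proof -
    have sq: "w \<in> T" if "(const d, w) \<in> H" "0 \<le> d" for d w
    proof -
      have "const d = const (sqrt d) ^ 2"
        using that(2) by (simp add: power2_eq_square flip: const_mult)
      then show ?thesis using T0I[OF square_sum_of_squares[of "const (sqrt d)"]] that(1) T(2) by auto
    qed
    have zF: "z \<in> F0" using F0(1) c by force
    have z0: "z = 0 \<longleftrightarrow> c = 0" using H0[OF c] const_in by simp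
    have "A.sg z = (if star_of c = 0 then 0 else if 0 \<le> star_of c then 1 else - 1)"
    proof (cases "0 \<le> c")
      case True
      then show ?thesis using sq[OF c] zF z0 by (auto simp: A.sg_def star_of_hom)
    next
      case False
      have "(const (0 - c), 0 - z) \<in> H"
        using Hdiff[OF Hdiff[OF H1 H1] c] const_diff[of 0 c] const_diff[of 0 0] by simp
      then have "- z \<in> T" using sq False by fastforce
      then have "z \<notin> T" using F.cone_antisym[of z] z0 False by auto
      then show ?thesis using False z0 by (auto simp: A.sg_def star_of_hom)
    qed
    then show ?thesis using zF by (simp add: same_sign_def)
  qed
  ultimately have "partial_iso G0" by (auto simp: partial_iso_def G0_def)
  then obtain G where G: "maximal_iso G" "G0 \<subseteq> G" using maximal_iso_exists by blast
  have P: "partial_iso G" using G(1) by (simp add: maximal_iso_def)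
  note GS = partial_isoD(1)[OF P]
  have inj: "inj_on fst G"
  proof (rule inj_onI)
    fix x y assume "x \<in> G" "y \<in> G" "fst x = fst y"
    then show "x = y"
      using partial_iso_zero(1)[OF P unital_subring_diff[OF GS, of x y]] by simp
  qed
  have GF: "fst ` G \<subseteq> F0" using partial_isoD(3)[OF P] by blast
  then have "countable (fst ` G)" using F0(3) countable_subset by blast
  then have countG: "countable G" using inj countable_image_inj_on by blast
  have "G \<noteq> {}" using unital_subring_one[OF GS] by blast
  have total: "fst ` G = F0"
  proof (rule maximal_iso_total[OF G(1)])
    fix x assume x: "x \<in> F0"
    show "\<exists>y\<in>UNIV. \<forall>z\<in>G. A.sg (x - fst z) =
        (if y - snd z = 0 then 0 else if 0 \<le> y - snd z then 1 else - 1)"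
    proof (cases "x \<in> fst ` G")
      case True
      then obtain y where y: "(x, y) \<in> G" by force
      show ?thesis
      proof (intro bexI[of _ y] ballI)
        fix z assume "z \<in> G"
        from partial_isoD(5)[OF P unital_subring_diff[OF GS y this]]
        show "A.sg (x - fst z) = (if y - snd z = 0 then 0 else if 0 \<le> y - snd z then 1 else - 1)"
          by simp
      qed simp
    next
      case False
      \<comment> \<open>\<open>G\<close> is in bijection with a subset of the countable field
        \<open>F0\<close>, so an element outside of its first projection gives a countable cut,
        which saturation fills strictly.\<close>
      define e where "e = from_nat_into G"
      have e: "e i \<in> G" for i unfolding e_def using \<open>G \<noteq> {}\<close> by (rule from_nat_into)
      have eF: "fst (e i) \<in> F0" for i using e GF by blast
      have sg: "A.sg (x - fst z) = 1 \<or> A.sg (x - fst z) = - 1" if "z \<in> G" for z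
        using A.sg_cases[of "x - fst z"] False that by auto
      have less: "snd (e i) < snd (e j)" if "A.sg (x - fst (e i)) = 1" "\<not> A.sg (x - fst (e j)) = 1" for i j
      proof -
        have "A.sg (fst (e j) - x) = 1"
          using sg[OF e[of j]] that(2) A.sg_minus_commute[OF x eF[of j]] by auto
        then have "A.sg (fst (e j) - fst (e i)) = 1"
          using A.less_trans[OF eF x eF that(1)] by blast
        then show ?thesis
          using partial_isoD(5)[OF P unital_subring_diff[OF GS e[of j] e[of i]]]
          by (auto split: if_splits)
      qed
      obtain y where y: "\<And>i. if A.sg (x - fst (e i)) = 1 then snd (e i) < y else y < snd (e i)"
        using hyper_countable_cut[of "\<lambda>i. A.sg (x - fst (e i)) = 1" "\<lambda>i. snd (e i)"] less by blast
      show ?thesis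
      proof (intro bexI[of _ y] ballI)
        fix z assume z: "z \<in> G"
        then obtain i where i: "z = e i"
          unfolding e_def using from_nat_into_surj[OF countG] by metis
        show "A.sg (x - fst z) = (if y - snd z = 0 then 0 else if 0 \<le> y - snd z then 1 else - 1)"
          using y[of i] sg[OF z] unfolding i by (auto split: if_splits)
      qed simp
    qed
  qed
  define K where "K = {(s, b) | s b z. (s, z) \<in> H \<and> (z, b) \<in> G}"
  have KI: "(s, b) \<in> K" if "(s, z) \<in> H" "(z, b) \<in> G" for s b z using that unfolding K_def by blast
  have Gdiff: "(z - w, b - c) \<in> G" and Gmult: "(z * w, b * c) \<in> G" if "(z, b) \<in> G" "(w, c) \<in> G" for z w b c
    using unital_subring_diff[OF GS that] unital_subring_mult[OF GS that] by (simp_all add: times_prod_def)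
  show ?thesis
  proof (rule that[of K])
    show "unital_subring K"
      unfolding unital_subring_def
    proof (intro conjI ballI)
      show "1 \<in> K" using KI[OF H1] unital_subring_one[OF GS] by (simp add: one_prod_def)
      fix x y assume "x \<in> K" "y \<in> K"
      then obtain s b z t c w where *: "x = (s, b)" "y = (t, c)" "(s, z) \<in> H" "(z, b) \<in> G"
        "(t, w) \<in> H" "(w, c) \<in> G" unfolding K_def by blast
      show "x - y \<in> K" "x * y \<in> K"
        using KI[OF Hdiff[OF *(3,5)] Gdiff[OF *(4,6)]] KI[OF Hmult[OF *(3,5)] Gmult[OF *(4,6)]]
        by (simp_all add: * times_prod_def)
    qed
    show "B \<subseteq> fst ` K"
    proof
      fix s assume "s \<in> B"
      then obtain z where z: "(s, z) \<in> H" using H(3) by force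
      then have "z \<in> fst ` G" using total F0(1) by force
      then obtain b where "(z, b) \<in> G" by force
      then show "s \<in> fst ` K" using KI[OF z] by force
    qed
    show "fst x \<in> p \<longleftrightarrow> snd x = 0" if x: "x \<in> K" for x
    proof -
      obtain s b z where *: "x = (s, b)" "(s, z) \<in> H" "(z, b) \<in> G" using x unfolding K_def by blast
      show ?thesis using H0[OF *(2)] partial_iso_zero[OF P *(3)] * by (simp add: zero_prod_def)
    qed
    show "b = star_of c" if "(const c, b) \<in> K" for c b
    proof -
      obtain z where *: "(const c, z) \<in> H" "(z, b) \<in> G" using \<open>(const c, b) \<in> K\<close> unfolding K_def by blast
      have "(z, star_of c) \<in> G" using G0I[OF *(1)] G(2) by blast
      then show ?thesis using inj_onD[OF inj, of "(z, b)" "(z, star_of c)"] *(2) by simp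
    qed
  qed
qed

end

section \<open>Real polynomials inside the quaternionic ones, and real points\<close>

section \<open>Real polynomials\<close>

type_synonym 'd rpoly = "('d \<Rightarrow>\<^sub>0 nat) \<Rightarrow>\<^sub>0 real"

abbreviation rconst :: "real \<Rightarrow> 'd rpoly" where
  "rconst \<equiv> Poly_Mapping.single 0"

definition quat_poly :: "'d rpoly \<Rightarrow> 'd qpoly" where
  "quat_poly f = Poly_Mapping.map of_real f"

definition real_eval :: "'d::finite rpoly \<Rightarrow> real ^ 'd \<Rightarrow> real" where
  "real_eval f a = (\<Sum>e\<in>Poly_Mapping.keys f.
     (\<Prod>i\<in>UNIV. (a $ i) ^ Poly_Mapping.lookup e i) * Poly_Mapping.lookup f e)"

lemma lookup_quat_poly: "Poly_Mapping.lookup (quat_poly f) e = of_real (Poly_Mapping.lookup f e)"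
  by (simp add: quat_poly_def map.rep_eq when_def)

lemma quat_poly_add: "quat_poly (f + g) = quat_poly f + quat_poly g"
  and quat_poly_zero: "quat_poly 0 = 0"
  and quat_poly_inj: "quat_poly f = quat_poly g \<longleftrightarrow> f = g"
  and quat_poly_single: "quat_poly (Poly_Mapping.single e c) = Poly_Mapping.single e (of_real c)"
  by (auto simp: poly_mapping_eq_iff fun_eq_iff lookup_quat_poly lookup_add lookup_minus lookup_single
      when_def)

lemma sum_singles:
  fixes f :: "'a \<Rightarrow>\<^sub>0 'b::comm_monoid_add"
  shows "(\<Sum>e\<in>Poly_Mapping.keys f. Poly_Mapping.single e (Poly_Mapping.lookup f e)) = f"
proof (rule poly_mapping_eqI)
  fix k
  show "Poly_Mapping.lookup (\<Sum>e\<in>Poly_Mapping.keys f. Poly_Mapping.single e (Poly_Mapping.lookup f e)) k =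
      Poly_Mapping.lookup f k"
    by (simp add: lookup_sum lookup_single when_def in_keys_iff)
qed

lemma poly_mapping_single_induct [case_names zero add]:
  fixes f :: "'a \<Rightarrow>\<^sub>0 'b::comm_monoid_add"
  assumes "P 0" "\<And>f e c. P f \<Longrightarrow> P (Poly_Mapping.single e c + f)"
  shows "P f"
proof -
  have "P (\<Sum>e\<in>E. Poly_Mapping.single e (Poly_Mapping.lookup f e))" if "finite E" for E
    using that by induction (simp_all add: assms)
  moreover have "(\<Sum>e\<in>Poly_Mapping.keys f. Poly_Mapping.single e (Poly_Mapping.lookup f e)) = f"
    by (rule sum_singles)
  ultimately show ?thesis by (metis finite_keys)
qed

lemma quat_poly_mult: "quat_poly (f * g) = quat_poly f * quat_poly g"
proof (induction f rule: poly_mapping_single_induct)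
  case (add f e c)
  have "quat_poly (Poly_Mapping.single e c * g) = quat_poly (Poly_Mapping.single e c) * quat_poly g"
    by (induction g rule: poly_mapping_single_induct)
      (simp_all add: distrib_left quat_poly_add quat_poly_single quat_poly_zero mult_single)
  then show ?case using add by (simp add: distrib_right quat_poly_add)
qed (simp add: quat_poly_zero)

lemma quat_poly_one: "quat_poly 1 = 1"
  using quat_poly_single[of 0 1] by simp

lemma quat_poly_central: "quat_poly f * q = q * quat_poly f"
proof (induction f rule: poly_mapping_single_induct)
  case (add f e c)
  have "Poly_Mapping.single e (of_real c) * q = q * Poly_Mapping.single e (of_real c)"
    by (induction q rule: qpoly_induct)
      (simp_all add: distrib_left distrib_right mult_single add.commute of_real_def)
  then show ?case using add by (simp add: distrib_left distrib_right quat_poly_add quat_poly_single)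
qed (simp add: quat_poly_zero)

lemma qpoly_eval_quat_poly: "qpoly_eval (quat_poly f) a = of_real (real_eval f a)"
proof -
  have "Poly_Mapping.keys (quat_poly f) = Poly_Mapping.keys f"
    by (auto simp: in_keys_iff lookup_quat_poly)
  then show ?thesis
    by (simp add: qpoly_eval_def real_eval_def lookup_quat_poly scaleR_conv_of_real)
qed

lemma real_eval_add: "real_eval (f + g) a = real_eval f a + real_eval g a"
  and real_eval_mult: "real_eval (f * g) a = real_eval f a * real_eval g a"
proof -
  have inj: "x = y" if "of_real x = (of_real y :: quat)" for x y using that by simp
  show "real_eval (f + g) a = real_eval f a + real_eval g a"
    by (rule inj) (simp add: quat_poly_add qpoly_eval_add flip: qpoly_eval_quat_poly)
  show "real_eval (f * g) a = real_eval f a * real_eval g a"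
    by (rule inj) (simp add: quat_poly_mult qpoly_eval_mult flip: qpoly_eval_quat_poly)
qed

lemma real_eval_single:
  "real_eval (Poly_Mapping.single e c) a = (\<Prod>i\<in>UNIV. (a $ i) ^ Poly_Mapping.lookup e i) * c"
  by (cases "c = 0") (simp_all add: real_eval_def)

lemma real_eval_diff: "real_eval (f - g) a = real_eval f a - real_eval g a"
  using real_eval_add[of "f - g" g a] by simp

definition rvar :: "'d \<Rightarrow> 'd rpoly" where
  "rvar i = Poly_Mapping.single (Poly_Mapping.single i 1) 1"

lemma real_eval_rvar: "real_eval (rvar i) a = a $ i"
proof -
  have "(\<Prod>j\<in>UNIV. (a $ j) ^ Poly_Mapping.lookup (Poly_Mapping.single i 1) j) =
      (\<Prod>j\<in>UNIV. if j = i then a $ i else 1)"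
    by (intro prod.cong) (auto simp: lookup_single when_def)
  then show ?thesis by (simp add: rvar_def real_eval_single)
qed

lemma single_eq_prod_rvar:
  fixes e :: "'d::finite \<Rightarrow>\<^sub>0 nat"
  shows "Poly_Mapping.single e c = rconst c * (\<Prod>i\<in>UNIV. rvar i ^ Poly_Mapping.lookup e i)"
proof -
  have pow: "rvar i ^ k = Poly_Mapping.single (Poly_Mapping.single i k) 1" for i :: 'd and k
    by (induction k) (simp_all add: rvar_def mult_single flip: single_add)
  have "(\<Prod>i\<in>A. Poly_Mapping.single (f i) 1) = Poly_Mapping.single (\<Sum>i\<in>A. f i) (1::real)"
    if "finite A" for A and f :: "'d \<Rightarrow> 'd \<Rightarrow>\<^sub>0 nat"
    using that by induction (simp_all add: mult_single)
  moreover have "(\<Sum>i\<in>UNIV. Poly_Mapping.single i (Poly_Mapping.lookup e i)) = e"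
  proof (rule poly_mapping_eqI)
    fix j
    have "Poly_Mapping.lookup (\<Sum>i\<in>UNIV. Poly_Mapping.single i (Poly_Mapping.lookup e i)) j =
        (\<Sum>i\<in>UNIV. if i = j then Poly_Mapping.lookup e i else 0)"
      by (simp add: lookup_sum lookup_single when_def)
    then show "Poly_Mapping.lookup (\<Sum>i\<in>UNIV. Poly_Mapping.single i (Poly_Mapping.lookup e i)) j =
        Poly_Mapping.lookup e j" by simp
  qed
  ultimately show ?thesis by (simp add: pow mult_single)
qed

text \<open>The hyperreal coordinates \<open>\<xi> i\<close> of a generic point are represented by a
  sequence \<open>a\<close> of real points. At the generic point \<open>h\<close> vanishes and
  \<open>g\<close> does not, so the same is true at \<open>a n\<close> for almost all
  \<open>n\<close>, hence for some \<open>n\<close>.\<close>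

theorem real_point:
  fixes p :: "'d::finite rpoly set"
  assumes p: "real_prime_ideal p rconst" and h: "h \<in> p" and g: "g \<notin> p"
  obtains a where "real_eval h a = 0" "real_eval g a \<noteq> 0"
proof -
  interpret real_prime_ideal p rconst by (rule p)
  \<comment> \<open>The ring generated by these elements contains both \<open>h\<close> and
    \<open>g\<close>.\<close>
  define B :: "'d rpoly set" where "B = range rvar \<union> rconst ` (Poly_Mapping.lookup h ` Poly_Mapping.keys h) \<union>
    rconst ` (Poly_Mapping.lookup g ` Poly_Mapping.keys g)"
  have "finite B" unfolding B_def by (intro finite_UnI finite_imageI finite finite_keys)
  then obtain K :: "('d rpoly \<times> hyper) set" where K: "unital_subring K" "B \<subseteq> fst ` K"
    "\<And>z. z \<in> K \<Longrightarrow> fst z \<in> p \<longleftrightarrow> snd z = 0" "\<And>c b. (rconst c, b) \<in> K \<Longrightarrow> b = star_of c"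
    using hyperreal_point by blast
  have "\<exists>x. (rvar i, x) \<in> K" for i using K(2) unfolding B_def by force
  then obtain \<xi> where \<xi>: "\<And>i. (rvar i, \<xi> i) \<in> K" by metis
  define a :: "nat \<Rightarrow> real ^ 'd" where "a n = (\<chi> i. rep_hyper (\<xi> i) n)" for n
  \<comment> \<open>\<open>\<Phi> f\<close> pairs \<open>f\<close> with its value at the generic
    point. As \<open>\<Phi>\<close> is a ring homomorphism, the polynomials to which
    \<open>K\<close> assigns this very value form a subring \<open>M\<close>, and it suffices to put
    variables and coefficients into \<open>M\<close>.\<close>
  define \<Phi> :: "'d rpoly \<Rightarrow> 'd rpoly \<times> hyper" where "\<Phi> f = (f, hyper_of (\<lambda>n. real_eval f (a n)))" for f
  define M where "M = {f. \<Phi> f \<in> K}"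
  have "real_eval 1 b = 1" for b :: "real ^ 'd"
    using real_eval_single[of 0 1 b] by simp
  then have "\<Phi> 1 = 1"
    by (simp add: \<Phi>_def one_prod_def one_hyper.abs_eq)
  moreover have "\<Phi> (f - g) = \<Phi> f - \<Phi> g" "\<Phi> (f * g) = \<Phi> f * \<Phi> g" for f g
    by (simp_all add: \<Phi>_def real_eval_diff real_eval_mult minus_hyper.abs_eq times_hyper.abs_eq times_prod_def)
  ultimately have M: "unital_subring M"
    using unital_subring_closed[OF K(1)] by (simp add: unital_subring_def M_def)
  have var: "rvar i \<in> M" for i
  proof -
    have "hyper_of (rep_hyper (\<xi> i)) = \<xi> i" by (metis Quotient_hyper Quotient_abs_rep)
    then show ?thesis using \<xi>[of i] by (simp add: M_def \<Phi>_def real_eval_rvar a_def)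
  qed
  have const: "rconst c \<in> M" if c: "rconst c \<in> B" for c
  proof -
    obtain b where b: "(rconst c, b) \<in> K" using c K(2) by force
    have "star_of c = hyper_of (\<lambda>n. real_eval (rconst c) (a n))"
      by (simp add: real_eval_single star_of.abs_eq)
    then show ?thesis using b K(4)[OF b] by (simp add: M_def \<Phi>_def)
  qed
  have in_M: "f \<in> M" if coeffs: "\<And>e. e \<in> Poly_Mapping.keys f \<Longrightarrow> rconst (Poly_Mapping.lookup f e) \<in> B" for f
  proof -
    have "Poly_Mapping.single e (Poly_Mapping.lookup f e) \<in> M" if e: "e \<in> Poly_Mapping.keys f" for e
      unfolding single_eq_prod_rvar[of e]
    proof (rule unital_subring_mult[OF M])
      show "rconst (Poly_Mapping.lookup f e) \<in> M" using const[OF coeffs[OF e]] .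
      show "(\<Prod>i\<in>UNIV. rvar i ^ Poly_Mapping.lookup e i) \<in> M"
        using var by (intro unital_subring_prod[OF M] unital_subring_power[OF M])
    qed
    then have "(\<Sum>e\<in>Poly_Mapping.keys f. Poly_Mapping.single e (Poly_Mapping.lookup f e)) \<in> M"
      by (rule unital_subring_sum[OF M])
    then show ?thesis by (simp add: sum_singles)
  qed
  have "\<Phi> h \<in> K" "\<Phi> g \<in> K" using in_M[of h] in_M[of g] by (auto simp: B_def M_def)
  then have "hyper_of (\<lambda>n. real_eval h (a n)) = 0" "hyper_of (\<lambda>n. real_eval g (a n)) \<noteq> 0"
    using K(3)[of "\<Phi> h"] K(3)[of "\<Phi> g"] h g by (simp_all add: \<Phi>_def)
  then have "almost_all (\<lambda>n. real_eval h (a n) = 0)" "almost_all (\<lambda>n. real_eval g (a n) \<noteq> 0)"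
    by (simp_all add: zero_hyper.abs_eq hyper.abs_eq_iff not_aa)
  then obtain n where "real_eval h (a n) = 0" "real_eval g (a n) \<noteq> 0"
    using almost_all_ex[OF almost_all_conj] by blast
  then show ?thesis by (rule that)
qed

section \<open>Real left ideals in terms of plain matrix operations\<close>

section \<open>Real left ideals of matrix rings\<close>

lemma finsum_matrix_ring:
  fixes f :: "'i \<Rightarrow> 'a::ring_1 ^ 'n ^ 'n"
  assumes "finite A"
  shows "(\<Oplus>\<^bsub>matrix_ring\<^esub>i\<in>A. f i) = sum f A"
proof -
  interpret ring "matrix_ring :: ('a ^ 'n ^ 'n) ring" by (rule ring_matrix_ring)
  show ?thesis
    using assms
  proof induction
    case empty
    show ?case unfolding finsum_empty sum.empty by (simp add: matrix_ring_def)
  next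
    case (insert i A)
    have "(\<Oplus>\<^bsub>matrix_ring\<^esub>i\<in>insert i A. f i) = f i \<oplus>\<^bsub>matrix_ring\<^esub> (\<Oplus>\<^bsub>matrix_ring\<^esub>i\<in>A. f i)"
      using insert by (intro finsum_insert) (auto simp: matrix_ring_def)
    then show ?case using insert by (simp add: matrix_ring_def)
  qed
qed

lemma a_inv_matrix_ring: "\<ominus>\<^bsub>matrix_ring\<^esub> A = - (A :: 'a::ring_1 ^ 'n ^ 'n)"
proof -
  interpret ring "matrix_ring :: ('a ^ 'n ^ 'n) ring" by (rule ring_matrix_ring)
  show ?thesis by (rule minus_equality) (simp_all add: matrix_ring_def)
qed

lemma uminus_eq_matrix_mult: "- A = (- mat 1) ** (A :: 'a::ring_1 ^ 'n ^ 'n)"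
proof -
  have "(- mat 1) ** A = - (mat 1 ** A)"
    by (simp only: matrix_matrix_mult_def vec_eq_iff vec_lambda_beta uminus_vec_def vector_uminus_component
        mult_minus_left sum_negf) simp
  then show ?thesis by simp
qed

definition real_left :: "('a::ring_1 \<Rightarrow> 'a) \<Rightarrow> ('a ^ 'n ^ 'n) set \<Rightarrow> bool" where
  "real_left star I \<longleftrightarrow> 0 \<in> I \<and> (\<forall>X\<in>I. \<forall>Y\<in>I. X + Y \<in> I) \<and> (\<forall>A. \<forall>X\<in>I. A ** X \<in> I) \<and>
     (\<forall>(k::nat) b. (\<Sum>i\<in>{1..k}. conj_transpose star (b i) ** b i) \<in> I \<longrightarrow> (\<forall>i\<in>{1..k}. b i \<in> I))"

text \<open>Negation is left multiplication by \<open>- mat 1\<close>, and sums in the ring record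
  are ordinary sums.\<close>

lemma real_left_ideal_iff:
  "real_left_ideal matrix_ring (conj_transpose star) I \<longleftrightarrow> real_left star (I :: ('a::ring_1 ^ 'n ^ 'n) set)"
proof -
  interpret ring "matrix_ring :: ('a ^ 'n ^ 'n) ring" by (rule ring_matrix_ring)
  have subgroup: "additive_subgroup I matrix_ring \<longleftrightarrow>
      0 \<in> I \<and> (\<forall>X\<in>I. \<forall>Y\<in>I. X + Y \<in> I) \<and> (\<forall>X\<in>I. - X \<in> I)"
  proof
    assume "additive_subgroup I matrix_ring"
    then interpret additive_subgroup I matrix_ring .
    have "- X \<in> I" if "X \<in> I" for X
      using a_inv_closed[OF that] by (simp only: a_inv_matrix_ring)
    moreover have "X + Y \<in> I" if "X \<in> I" "Y \<in> I" for X Y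
      using a_closed[OF that] by (simp add: matrix_ring_def)
    moreover have "0 \<in> I" using zero_closed by (simp add: matrix_ring_def)
    ultimately show "0 \<in> I \<and> (\<forall>X\<in>I. \<forall>Y\<in>I. X + Y \<in> I) \<and> (\<forall>X\<in>I. - X \<in> I)" by blast
  next
    assume *: "0 \<in> I \<and> (\<forall>X\<in>I. \<forall>Y\<in>I. X + Y \<in> I) \<and> (\<forall>X\<in>I. - X \<in> I)"
    show "additive_subgroup I matrix_ring"
      by (rule additive_subgroup.intro, rule add.subgroupI)
        (use * in \<open>auto simp: a_inv_matrix_ring simp flip: a_inv_def\<close>, auto simp: matrix_ring_def)
  qed
  have "real_left_ideal matrix_ring (conj_transpose star) I \<longleftrightarrow>
      additive_subgroup I matrix_ring \<and> (\<forall>A. \<forall>X\<in>I. A ** X \<in> I) \<and>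
      (\<forall>(k::nat) b. (\<Sum>i\<in>{1..k}. conj_transpose star (b i) ** b i) \<in> I \<longrightarrow> (\<forall>i\<in>{1..k}. b i \<in> I))"
    unfolding real_left_ideal_def left_ideal_def finsum_matrix_ring[OF finite_atLeastAtMost]
    by (simp add: matrix_ring_def)
  moreover have "- X \<in> I" if "\<forall>A. \<forall>X\<in>I. A ** X \<in> I" "X \<in> I" for X
    unfolding uminus_eq_matrix_mult[of X] using that by blast
  ultimately show ?thesis
    unfolding subgroup real_left_def by blast
qed

context
  fixes I :: "('a::ring_1 ^ 'n ^ 'n) set" and star
  assumes I: "real_left star I"
begin

lemma
  shows real_left_zero: "0 \<in> I"
    and real_left_add: "X \<in> I \<Longrightarrow> Y \<in> I \<Longrightarrow> X + Y \<in> I"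
    and real_left_mult: "X \<in> I \<Longrightarrow> A ** X \<in> I"
    and real_left_real: "(\<Sum>i\<in>{1..k::nat}. conj_transpose star (b i) ** b i) \<in> I \<Longrightarrow> i \<in> {1..k} \<Longrightarrow> b i \<in> I"
  using I unfolding real_left_def by blast+

lemma real_left_diff: "X \<in> I \<Longrightarrow> Y \<in> I \<Longrightarrow> X - Y \<in> I"
  using real_left_add[OF _ real_left_mult, of X Y "- mat 1"]
  by (simp only: uminus_eq_matrix_mult[symmetric] add_uminus_conv_diff)

lemma real_left_sum: "(\<And>i. i \<in> A \<Longrightarrow> f i \<in> I) \<Longrightarrow> sum f A \<in> I"
  by (induction A rule: infinite_finite_induct) (auto intro: real_left_zero real_left_add)

end

lemma real_left_Union_chain:
  assumes "C \<noteq> {}" "subset.chain A C" "\<And>I. I \<in> C \<Longrightarrow> real_left star I"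
  shows "real_left star (\<Union>C)"
  unfolding real_left_def
proof (intro conjI ballI allI impI)
  show "0 \<in> \<Union>C" using assms(1,3) real_left_zero by blast
  show "A ** X \<in> \<Union>C" if "X \<in> \<Union>C" for A X using that assms(3) real_left_mult by blast
  show "b i \<in> \<Union>C" if bi: "(\<Sum>i\<in>{1..k}. conj_transpose star (b i) ** b i) \<in> \<Union>C" "i \<in> {1..k}" for k :: nat and b i
  proof -
    obtain I where "I \<in> C" "(\<Sum>i\<in>{1..k}. conj_transpose star (b i) ** b i) \<in> I" using bi(1) by blast
    then show ?thesis
      using real_left_real[OF assms(3), where k = k and b = b and i = i] bi(2) by blast
  qed
  fix X Y assume "X \<in> \<Union>C" "Y \<in> \<Union>C"
  then obtain I where "I \<in> C" "X \<in> I" "Y \<in> I" using assms(2) unfolding subset.chain_def by blast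
  then show "X + Y \<in> \<Union>C" using assms(3) real_left_add by blast
qed

lemma maximal_real_left_exists:
  assumes "real_left star I" "Q \<notin> I"
  obtains N where "real_left star N" "I \<subseteq> N" "Q \<notin> N"
    "\<forall>J. real_left star J \<longrightarrow> N \<subseteq> J \<longrightarrow> Q \<notin> J \<longrightarrow> J = N"
proof -
  let ?A = "{N. real_left star N \<and> I \<subseteq> N \<and> Q \<notin> N}"
  have "\<exists>N\<in>?A. \<forall>J\<in>?A. N \<subseteq> J \<longrightarrow> J = N"
  proof (rule subset_Zorn_nonempty)
    show "?A \<noteq> {}" using assms by blast
    fix C assume C: "C \<noteq> {}" "subset.chain ?A C"
    have sub: "C \<subseteq> ?A" using C(2) by (simp add: subset.chain_def)
    then have "real_left star (\<Union>C)" by (intro real_left_Union_chain[OF C]) blast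
    moreover have "I \<subseteq> \<Union>C" "Q \<notin> \<Union>C" using C(1) sub by blast+
    ultimately show "\<Union>C \<in> ?A" by blast
  qed
  then obtain N where N: "real_left star N" "I \<subseteq> N" "Q \<notin> N"
    "\<forall>J\<in>?A. N \<subseteq> J \<longrightarrow> J = N"
    by blast
  have "\<forall>J. real_left star J \<longrightarrow> N \<subseteq> J \<longrightarrow> Q \<notin> J \<longrightarrow> J = N"
    using N(4) subset_trans[OF N(2)] by simp
  then show ?thesis by (rule that[OF N(1-3)])
qed

section \<open>The norm as a passage from quaternionic to real conditions\<close>

section \<open>The norm of a quaternionic polynomial\<close>

definition qnorm2 :: "quat \<Rightarrow> real" where
  "qnorm2 x = qRe x ^ 2 + qI x ^ 2 + qJ x ^ 2 + qK x ^ 2"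

lemma of_real_quat: "of_real c = Quat c 0 0 0"
  by (simp add: of_real_def one_quat_def scaleR_quat_def)

lemma qcnj_mult_self: "qcnj x * x = of_real (qnorm2 x)"
  by (simp add: qcnj_def times_quat_def of_real_quat qnorm2_def power2_eq_square)

lemma qnorm2_nonneg: "0 \<le> qnorm2 x"
  by (simp add: qnorm2_def)

lemma qnorm2_eq_0_iff: "qnorm2 x = 0 \<longleftrightarrow> x = 0"
  by (cases x) (auto simp: qnorm2_def zero_quat_def add_nonneg_eq_0_iff)

lemma qpoly_eval_star: "qpoly_eval (qpoly_star f) a = qcnj (qpoly_eval f a)"
proof (induction f rule: qpoly_induct)
  case (add f e c)
  have "qcnj (r *\<^sub>R c) = r *\<^sub>R qcnj c" for r by (simp add: qcnj_def scaleR_quat_def)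
  then show ?case using add by (simp add: qpoly_star_add qpoly_eval_add qpoly_star_single qpoly_eval_single)
qed (simp add: qpoly_star_zero qpoly_eval_zero)

definition re_poly :: "'d qpoly \<Rightarrow> 'd rpoly" where
  "re_poly f = Poly_Mapping.map qRe f"

lemma lookup_re_poly: "Poly_Mapping.lookup (re_poly f) e = qRe (Poly_Mapping.lookup f e)"
  by (simp add: re_poly_def map.rep_eq when_def zero_quat_def)

lemma quat_poly_re_poly: "qpoly_star f = f \<Longrightarrow> quat_poly (re_poly f) = f"
proof (rule poly_mapping_eqI)
  fix e assume "qpoly_star f = f"
  then have "qcnj (Poly_Mapping.lookup f e) = Poly_Mapping.lookup f e" by (metis lookup_qpoly_star)
  then show "Poly_Mapping.lookup (quat_poly (re_poly f)) e = Poly_Mapping.lookup f e"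
    by (cases "Poly_Mapping.lookup f e") (simp add: lookup_quat_poly lookup_re_poly of_real_quat qcnj_def)
qed

lemma qpoly_star_quat_poly: "qpoly_star (quat_poly r) = quat_poly r"
  by (rule poly_mapping_eqI) (simp add: lookup_qpoly_star lookup_quat_poly of_real_quat qcnj_def)

text \<open>The reduced norm. The product is fixed by the involution, so its coefficients are real
  and \<open>re_poly\<close> loses nothing.\<close>

definition nrm :: "'d qpoly \<Rightarrow> 'd rpoly" where
  "nrm f = re_poly (qpoly_star f * f)"

lemma quat_poly_nrm: "quat_poly (nrm f) = qpoly_star f * f"
  unfolding nrm_def by (rule quat_poly_re_poly) (simp add: qpoly_star_mult qpoly_star_star)

lemma quat_poly_left_commute: "f * (quat_poly r * g) = quat_poly r * (f * g)"
  by (simp only: mult.assoc[symmetric] quat_poly_central[of r f])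

text \<open>The trace \<open>f + f\<^sup>*\<close> is central, so \<open>f\<close> commutes with \<open>f\<^sup>*\<close>.\<close>

lemma nrm_star: "nrm (qpoly_star f) = nrm f"
proof -
  have "quat_poly (re_poly (f + qpoly_star f)) = f + qpoly_star f"
    by (rule quat_poly_re_poly) (simp add: qpoly_star_add qpoly_star_star add.commute)
  then have "(f + qpoly_star f) * f = f * (f + qpoly_star f)" by (metis quat_poly_central)
  then have "qpoly_star f * f = f * qpoly_star f" by (simp add: distrib_left distrib_right)
  then have "quat_poly (nrm (qpoly_star f)) = quat_poly (nrm f)"
    by (simp add: quat_poly_nrm qpoly_star_star)
  then show ?thesis by (simp add: quat_poly_inj)
qed

text \<open>Thus \<open>f\<close> and its norm vanish at the same points, and a sum of norms
  vanishes only where each summand does.\<close>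

lemma real_eval_nrm: "real_eval (nrm f) a = qnorm2 (qpoly_eval f a)"
proof -
  have "of_real (real_eval (nrm f) a) = (of_real (qnorm2 (qpoly_eval f a)) :: quat)"
    by (simp add: quat_poly_nrm qpoly_eval_mult qpoly_eval_star qcnj_mult_self flip: qpoly_eval_quat_poly)
  then show ?thesis by simp
qed

section \<open>The residue ring of a maximal real left ideal, and linear algebra over it\<close>

section \<open>Maximal real left ideals not containing a given matrix\<close>

definition smul :: "'a::ring_1 \<Rightarrow> 'a ^ 'n ^ 'm \<Rightarrow> 'a ^ 'n ^ 'm" where
  "smul f X = (\<chi> i j. f * X $ i $ j)"

definition row_smul :: "'a::ring_1 \<Rightarrow> 'a ^ 'n \<Rightarrow> 'a ^ 'n" where
  "row_smul f r = (\<chi> k. f * r $ k)"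

definition row_matrix :: "'m \<Rightarrow> 'a::ring_1 ^ 'n \<Rightarrow> 'a ^ 'n ^ 'm" where
  "row_matrix i r = (\<chi> k. if k = i then r else 0)"

definition dot :: "'a::ring_1 ^ 'n \<Rightarrow> 'a ^ 'n \<Rightarrow> 'a" where
  "dot r v = (\<Sum>k\<in>UNIV. r $ k * v $ k)"

abbreviation adj :: "'d qpoly ^ 'n ^ 'm \<Rightarrow> 'd qpoly ^ 'm ^ 'n" where
  "adj \<equiv> conj_transpose qpoly_star"

lemma smul_eq_mult: "smul f X = mat f ** X"
proof -
  have "(\<Sum>k\<in>UNIV. (if i = k then f else 0) * X $ k $ j) = (\<Sum>k\<in>UNIV. if i = k then f * X $ k $ j else 0)" for i j
    by (intro sum.cong) auto
  then show ?thesis by (simp add: smul_def matrix_matrix_mult_def mat_def vec_eq_iff)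
qed

lemma smul_smul: "smul f (smul g X) = smul (f * g) X"
  and smul_one: "smul 1 X = X"
  and smul_zero: "smul 0 X = 0"
  and smul_add_left: "smul (f + g) X = smul f X + smul g X"
  and smul_add: "smul f (X + Y) = smul f X + smul f Y"
  and smul_zero_right: "smul f 0 = 0"
  by (simp_all add: smul_def vec_eq_iff algebra_simps)

lemma smul_sum: "smul f (sum X A) = (\<Sum>i\<in>A. smul f (X i))"
  by (induction A rule: infinite_finite_induct) (simp_all add: smul_zero_right smul_add)

lemma mult_smul_quat_poly: "A ** smul (quat_poly r) X = smul (quat_poly r) (A ** X)"
proof -
  have "A $ i $ k * (quat_poly r * X $ k $ j) = quat_poly r * (A $ i $ k * X $ k $ j)" for i k j
    by (rule quat_poly_left_commute)
  then show ?thesis by (simp add: smul_def matrix_matrix_mult_def vec_eq_iff sum_distrib_left)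
qed

lemma matrix_diff_ldistrib: "A ** (B - C) = A ** B - A ** (C :: 'a::ring_1 ^ 'n ^ 'm)"
  by (simp add: matrix_matrix_mult_def vec_eq_iff right_diff_distrib sum_subtractf)

text \<open>\<open>f\<close> and its conjugate meet in the middle of the product and form the norm,
  which is central and can be moved out.\<close>

lemma adj_smul_mult: "adj (smul f X) ** smul f X = adj X ** smul (quat_poly (nrm f)) X"
  by (simp add: smul_def matrix_matrix_mult_def vec_eq_iff conj_transpose_def qpoly_star_mult
      quat_poly_nrm mult.assoc)

lemma real_left_smul: "real_left star I \<Longrightarrow> X \<in> I \<Longrightarrow> smul f X \<in> I"
  unfolding smul_eq_mult by (rule real_left_mult)

lemma nrm_quat_poly: "nrm (quat_poly r) = r ^ 2"
  using quat_poly_nrm[of "quat_poly r"]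
  by (simp add: qpoly_star_quat_poly quat_poly_inj power2_eq_square flip: quat_poly_mult)

locale maximal_real_left =
  fixes N :: "('d::finite qpoly ^ 'n ^ 'n) set" and Q :: "'d qpoly ^ 'n ^ 'n"
  assumes N: "real_left qpoly_star N" and Q: "Q \<notin> N"
    and maximal: "\<And>J. real_left qpoly_star J \<Longrightarrow> N \<subseteq> J \<Longrightarrow> Q \<notin> J \<Longrightarrow> J = N"
begin

definition PP :: "'d qpoly set" where
  "PP = {f. smul f Q \<in> N}"

definition p :: "'d rpoly set" where
  "p = {r. quat_poly r \<in> PP}"

lemma adj_mult_self_in: "adj X ** X \<in> N \<Longrightarrow> X \<in> N"
  using real_left_real[OF N, where k = 1 and b = "\<lambda>_. X" and i = 1] by simp

text \<open>One direction multiplies by the conjugate of \<open>f\<close>. For the other,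
  \<open>adj (smul f Q) ** smul f Q\<close> is a left multiple of
  \<open>smul (quat_poly (nrm f)) Q\<close>, hence in \<open>N\<close>, and realness of
  \<open>N\<close> gives \<open>smul f Q\<close> itself. Since a polynomial and its conjugate have
  the same norm, the left ideal \<open>PP\<close> is closed under conjugation and therefore
  two-sided.\<close>

lemma PP_iff_nrm: "f \<in> PP \<longleftrightarrow> nrm f \<in> p"
proof
  assume "f \<in> PP"
  then have "smul (qpoly_star f) (smul f Q) \<in> N" unfolding PP_def by (simp add: real_left_smul[OF N])
  then show "nrm f \<in> p" by (simp add: p_def PP_def quat_poly_nrm smul_smul)
next
  assume "nrm f \<in> p"
  then have "adj Q ** smul (quat_poly (nrm f)) Q \<in> N"
    by (simp add: p_def PP_def real_left_mult[OF N])
  then have "adj (smul f Q) ** smul f Q \<in> N" by (simp only: adj_smul_mult)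
  from adj_mult_self_in[OF this] show "f \<in> PP" by (simp add: PP_def)
qed

lemma PP_add: "f \<in> PP \<Longrightarrow> g \<in> PP \<Longrightarrow> f + g \<in> PP"
  by (simp add: PP_def smul_add_left real_left_add[OF N])

lemma PP_mult_left: "f \<in> PP \<Longrightarrow> g * f \<in> PP"
  unfolding PP_def by (simp add: real_left_smul[OF N] flip: smul_smul)

lemma PP_zero: "0 \<in> PP"
  by (simp add: PP_def smul_zero real_left_zero[OF N])

lemma PP_star: "qpoly_star f \<in> PP \<longleftrightarrow> f \<in> PP"
  by (simp add: PP_iff_nrm nrm_star)

text \<open>The quotient of \<open>N\<close> by a central element outside of \<open>p\<close> is a real left ideal that
  still avoids \<open>Q\<close>, hence equal to \<open>N\<close>.\<close>

lemma quotient_eq: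
  assumes "r \<notin> p" "smul (quat_poly r) X \<in> N"
  shows "X \<in> N"
proof -
  define J where "J = {X. smul (quat_poly r) X \<in> N}"
  have "real_left qpoly_star J"
    unfolding real_left_def
  proof (intro conjI ballI allI impI)
    show "0 \<in> J" by (simp add: J_def smul_zero_right real_left_zero[OF N])
    show "X + Y \<in> J" if "X \<in> J" "Y \<in> J" for X Y
      using that by (simp add: J_def smul_add real_left_add[OF N])
    show "A ** X \<in> J" if "X \<in> J" for A X
      using that by (simp add: J_def real_left_mult[OF N] flip: mult_smul_quat_poly)
    fix k :: nat and b :: "nat \<Rightarrow> 'd qpoly ^ 'n ^ 'n" and i
    assume sum: "(\<Sum>i\<in>{1..k}. adj (b i) ** b i) \<in> J" and i: "i \<in> {1..k}"
    have "smul (quat_poly r) (smul (quat_poly r) (\<Sum>i\<in>{1..k}. adj (b i) ** b i)) \<in> N"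
      using sum by (simp add: J_def real_left_smul[OF N])
    moreover have "smul (quat_poly r) (smul (quat_poly r) (adj (b i) ** b i)) =
        adj (smul (quat_poly r) (b i)) ** smul (quat_poly r) (b i)" for i
      by (simp only: adj_smul_mult nrm_quat_poly)
        (simp only: mult_smul_quat_poly smul_smul, simp only: power2_eq_square quat_poly_mult)
    ultimately have "(\<Sum>i\<in>{1..k}. adj (smul (quat_poly r) (b i)) ** smul (quat_poly r) (b i)) \<in> N"
      by (simp add: smul_sum)
    then show "b i \<in> J"
      using real_left_real[OF N, where b = "\<lambda>i. smul (quat_poly r) (b i)" and k = k and i = i] i
      by (simp add: J_def)
  qed
  moreover have "N \<subseteq> J" by (auto simp: J_def real_left_smul[OF N])
  moreover have "Q \<notin> J" using assms(1) by (simp add: J_def p_def PP_def)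
  ultimately have "J = N" by (rule maximal)
  then show ?thesis using assms(2) by (auto simp: J_def)
qed

text \<open>Multiplying \<open>a ^ 2 + s\<close> times \<open>Q\<close> from the left by
  \<open>adj Q\<close> gives a sum of hermitian squares, one of \<open>smul (quat_poly y) Q\<close>
  for every square \<open>y ^ 2\<close> in the sum, and realness of \<open>N\<close> applies to
  it.\<close>

lemma hermitian_squares_in:
  assumes s: "s \<in> sums_of_squares" and "quat_poly (a ^ 2 + s) \<in> PP"
  shows "quat_poly a \<in> PP"
proof -
  have "\<exists>(k::nat) (b :: nat \<Rightarrow> 'd qpoly ^ 'n ^ 'n). adj Q ** smul (quat_poly s) Q = (\<Sum>i\<in>{1..k}. adj (b i) ** b i)"
    using s
  proof induction
    case zero
    show ?case by (intro exI[of _ 0]) (simp add: quat_poly_zero smul_zero)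
  next
    case (step t y x)
    then obtain k :: nat and b :: "nat \<Rightarrow> 'd qpoly ^ 'n ^ 'n" where "adj Q ** smul (quat_poly x) Q = (\<Sum>i\<in>{1..k}. adj (b i) ** b i)" by blast
    moreover have "adj Q ** smul (quat_poly (y ^ 2)) Q = adj (smul (quat_poly y) Q) ** smul (quat_poly y) Q"
      by (simp add: adj_smul_mult nrm_quat_poly)
    moreover have "(\<Sum>i\<in>{1..k}. adj ((b(Suc k := smul (quat_poly y) Q)) i) ** (b(Suc k := smul (quat_poly y) Q)) i) =
        (\<Sum>i\<in>{1..k}. adj (b i) ** b i)"
      by (intro sum.cong) auto
    ultimately show ?case
      using step(1) by (intro exI[of _ "Suc k"] exI[of _ "b(Suc k := smul (quat_poly y) Q)"])
        (simp add: quat_poly_add smul_add_left matrix_add_ldistrib add.commute)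
  qed
  then obtain k :: nat and b :: "nat \<Rightarrow> 'd qpoly ^ 'n ^ 'n" where b: "adj Q ** smul (quat_poly s) Q = (\<Sum>i\<in>{1..k}. adj (b i) ** b i)" by blast
  \<comment> \<open>The multiple of \<open>Q\<close> by \<open>a\<close> is put in the new last
    place \<open>Suc k\<close>, behind the matrices that represent \<open>s\<close>.\<close>
  define c where "c = b(Suc k := smul (quat_poly a) Q)"
  have "(\<Sum>i\<in>{1..k}. adj (c i) ** c i) = adj Q ** smul (quat_poly s) Q"
    unfolding b c_def by (intro sum.cong) auto
  then have "(\<Sum>i\<in>{1..Suc k}. adj (c i) ** c i) = adj Q ** smul (quat_poly (a ^ 2 + s)) Q"
    by (simp add: c_def adj_smul_mult nrm_quat_poly quat_poly_add smul_add_left matrix_add_ldistrib add.commute)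
  also have "\<dots> \<in> N" using assms(2) by (simp add: PP_def real_left_mult[OF N])
  finally have "c (Suc k) \<in> N" using real_left_real[OF N] by fastforce
  then show ?thesis by (simp add: c_def PP_def)
qed

sublocale real_prime_ideal p rconst
proof
  show "0 \<in> p" by (simp add: p_def quat_poly_zero PP_zero)
  show "x + y \<in> p" if "x \<in> p" "y \<in> p" for x y
    using that by (simp add: p_def quat_poly_add PP_add)
  show "r * x \<in> p" if "x \<in> p" for x r
    using that by (simp add: p_def quat_poly_mult PP_mult_left)
  show "1 \<notin> p" using Q by (simp add: p_def PP_def quat_poly_one smul_one)
  \<comment> \<open>A factor outside of \<open>p\<close> can be cancelled by
    \<open>quotient_eq\<close>.\<close>
  show "x \<in> p \<or> y \<in> p" if "x * y \<in> p" for x y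
    using that quotient_eq[of x "smul (quat_poly y) Q"]
    by (auto simp: p_def PP_def quat_poly_mult smul_smul)
  show "rconst 1 = 1" by simp
  show "rconst (x - y) = rconst x - rconst y" for x y by (rule single_diff)
  show "rconst (x * y) = rconst x * rconst y" for x y by (simp add: mult_single)
  show "a \<in> p" if "s \<in> sums_of_squares" "a ^ 2 + s \<in> p" for s a
    using hermitian_squares_in[OF that(1)] that(2) by (simp add: p_def)
qed

lemma PP_diff: "f \<in> PP \<Longrightarrow> g \<in> PP \<Longrightarrow> f - g \<in> PP"
  using PP_add[of f "- 1 * g"] PP_mult_left[of g "- 1"] by simp

definition submodule :: "('d qpoly ^ 'n) set \<Rightarrow> bool" where
  "submodule M \<longleftrightarrow> 0 \<in> M \<and> (\<forall>r\<in>M. \<forall>s\<in>M. r + s \<in> M) \<and> (\<forall>f. \<forall>r\<in>M. row_smul f r \<in> M)"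

text \<open>Gaussian elimination modulo \<open>PP\<close> without denominators: a pivot is made real by multiplication
  with its conjugate.\<close>

lemma elimination:
  assumes "finite J" "submodule M"
  shows "(\<exists>s m. s \<notin> p \<and> m \<in> M \<and> (\<forall>k\<in>J. quat_poly s * q $ k - m $ k \<in> PP)) \<or>
    (\<exists>v. (\<forall>k. k \<notin> J \<longrightarrow> v $ k = 0) \<and> (\<forall>m\<in>M. dot m v \<in> PP) \<and> dot q v \<notin> PP)"
  using assms
proof (induction J arbitrary: M q rule: finite_induct)
  case empty
  then have "0 \<in> M" by (simp add: submodule_def)
  then show ?case using one_notin by auto
next
  case (insert j J)
  show ?case
  proof (cases "\<forall>m\<in>M. m $ j \<in> PP")
    \<comment> \<open>Modulo \<open>PP\<close>, column \<open>j\<close> of \<open>M\<close> is zero: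
      either the unit vector at \<open>j\<close> separates \<open>q\<close>, or column
      \<open>j\<close> of \<open>q\<close> is zero too and imposes no condition.\<close>
    case True
    show ?thesis
    proof (cases "q $ j \<in> PP")
      case False
      define v :: "'d qpoly ^ 'n" where "v = axis j 1"
      have d: "dot r v = r $ j" for r
      proof -
        have "dot r v = (\<Sum>k\<in>UNIV. if k = j then r $ j else 0)"
          unfolding dot_def v_def axis_def by (intro sum.cong) auto
        then show ?thesis by simp
      qed
      have "v $ k = 0" if "k \<notin> insert j J" for k using that by (simp add: v_def axis_def)
      then show ?thesis using True False by (intro disjI2 exI[of _ v]) (simp add: d)
    next
      case qj: True
      from insert.IH[OF insert.prems, of q] show ?thesis
      proof
        assume "\<exists>s m. s \<notin> p \<and> m \<in> M \<and> (\<forall>k\<in>J. quat_poly s * q $ k - m $ k \<in> PP)"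
        then obtain s m where *: "s \<notin> p" "m \<in> M" "\<forall>k\<in>J. quat_poly s * q $ k - m $ k \<in> PP" by blast
        have "quat_poly s * q $ j - m $ j \<in> PP"
          using True qj *(2) by (intro PP_diff PP_mult_left) auto
        then show ?thesis using * by blast
      next
        assume "\<exists>v. (\<forall>k. k \<notin> J \<longrightarrow> v $ k = 0) \<and> (\<forall>m\<in>M. dot m v \<in> PP) \<and> dot q v \<notin> PP"
        then show ?thesis by blast
      qed
    qed
  next
    case False
    then obtain w0 where w0: "w0 \<in> M" "w0 $ j \<notin> PP" by blast
    define t where "t = nrm (w0 $ j)"
    define w where "w = row_smul (qpoly_star (w0 $ j)) w0"
    have t: "t \<notin> p" using w0(2) by (simp add: t_def PP_iff_nrm)
    have w: "w \<in> M" "w $ j = quat_poly t"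
      using w0(1) insert.prems by (simp_all add: w_def submodule_def t_def quat_poly_nrm row_smul_def)
    \<comment> \<open>\<open>E\<close> clears column \<open>j\<close> with the pivot row
      \<open>w\<close>. Its pivot \<open>t\<close> is real and hence central, which makes
      \<open>E\<close> linear over the noncommutative scalars.\<close>
    define E where "E r = row_smul (quat_poly t) r - row_smul (r $ j) w" for r
    have E_add: "E (r + s) = E r + E s" and E_smul: "E (row_smul f r) = row_smul f (E r)"
      and E_zero: "E 0 = 0" and E_j: "E r $ j = 0" for r s f
    proof -
      have c: "quat_poly t * (f * x) = f * (quat_poly t * x)" for x
        by (simp only: quat_poly_left_commute)
      show "E (r + s) = E r + E s" "E 0 = 0" "E (row_smul f r) = row_smul f (E r)"
        by (simp_all add: E_def row_smul_def vec_eq_iff algebra_simps c)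
      show "E r $ j = 0" by (simp add: E_def row_smul_def w(2) quat_poly_central)
    qed
    have sub: "r + s \<in> M" "row_smul f r \<in> M" if "r \<in> M" "s \<in> M" for r s f
      using that insert.prems by (auto simp: submodule_def)
    have E_in: "E r \<in> M" if "r \<in> M" for r
    proof -
      have "E r = row_smul (quat_poly t) r + row_smul (- (r $ j)) w"
        by (simp add: E_def row_smul_def vec_eq_iff)
      then show ?thesis using sub that w(1) by simp
    qed
    have "submodule (E ` M)"
      unfolding submodule_def
    proof (intro conjI ballI allI)
      show "0 \<in> E ` M" using insert.prems E_zero by (force simp: submodule_def)
      fix x assume "x \<in> E ` M"
      then obtain r where r: "x = E r" "r \<in> M" by blast
      show "row_smul f x \<in> E ` M" for f using r sub(2)[OF r(2) r(2)] by (simp flip: E_smul)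
      fix y assume "y \<in> E ` M"
      then obtain s where s: "y = E s" "s \<in> M" by blast
      show "x + y \<in> E ` M" using r s sub(1) by (simp flip: E_add)
    qed
    from insert.IH[OF this, of "E q"] show ?thesis
    proof
      assume "\<exists>s m. s \<notin> p \<and> m \<in> E ` M \<and> (\<forall>k\<in>J. quat_poly s * E q $ k - m $ k \<in> PP)"
      then obtain s r where *: "s \<notin> p" "r \<in> M" "\<forall>k\<in>J. quat_poly s * E q $ k - E r $ k \<in> PP" by blast
      define m where "m = E r + row_smul (quat_poly s * q $ j) w"
      have eq: "quat_poly (s * t) * q $ k - m $ k = quat_poly s * E q $ k - E r $ k" for k
        by (simp add: m_def E_def row_smul_def quat_poly_mult algebra_simps)
      have "\<forall>k\<in>insert j J. quat_poly (s * t) * q $ k - m $ k \<in> PP"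
        unfolding eq using *(3) by (simp add: E_j PP_zero)
      moreover have "m \<in> M" unfolding m_def using sub E_in *(2) w(1) by blast
      moreover have "s * t \<notin> p" using *(1) t mult_in_iff by blast
      ultimately show ?thesis by blast
    next
      assume "\<exists>v. (\<forall>k. k \<notin> J \<longrightarrow> v $ k = 0) \<and> (\<forall>m\<in>E ` M. dot m v \<in> PP) \<and> dot (E q) v \<notin> PP"
      then obtain v' where v': "\<forall>k. k \<notin> J \<longrightarrow> v' $ k = 0" "\<forall>m\<in>M. dot (E m) v' \<in> PP" "dot (E q) v' \<notin> PP"
        by blast
      \<comment> \<open>This is the transpose of \<open>E\<close> applied to \<open>v'\<close>.
        Component \<open>j\<close>, where \<open>v'\<close> is zero, receives
        \<open>- dot w v'\<close>, so pairing with \<open>v\<close> amounts to applying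
        \<open>E\<close> and pairing with \<open>v'\<close>.\<close>
      define v :: "'d qpoly ^ 'n" where "v = (\<chi> k. quat_poly t * v' $ k - (if k = j then dot w v' else 0))"
      have "dot r v = dot (E r) v'" for r
      proof -
        have "dot r v = (\<Sum>k\<in>UNIV. quat_poly t * (r $ k * v' $ k) - (if k = j then r $ j * dot w v' else 0))"
          unfolding dot_def v_def
          by (intro sum.cong) (auto simp: right_diff_distrib quat_poly_left_commute)
        also have "\<dots> = (\<Sum>k\<in>UNIV. quat_poly t * (r $ k * v' $ k)) - r $ j * dot w v'"
          by (simp add: sum_subtractf)
        also have "\<dots> = dot (E r) v'"
          by (simp add: dot_def E_def row_smul_def sum_distrib_left left_diff_distrib sum_subtractf mult.assoc)
        finally show ?thesis .
      qed
      moreover have "v $ k = 0" if "k \<notin> insert j J" for k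
        using that v'(1) by (simp add: v_def)
      ultimately show ?thesis using v'(2,3) by (intro disjI2 exI[of _ v]) simp
    qed
  qed
qed

text \<open>Left ideals of a matrix ring correspond to submodules of the module of rows: a matrix
  lies in \<open>N\<close> exactly if all its rows lie in this set, as the next lemmas show.\<close>

definition row_module :: "('d qpoly ^ 'n) set" where
  "row_module = {r. \<forall>i. row_matrix i r \<in> N}"

lemma submodule_row_module: "submodule row_module"
proof -
  have "row_matrix i (0 :: 'd qpoly ^ 'n) = 0" "row_matrix i (r + s) = row_matrix i r + row_matrix i s"
    "row_matrix i (row_smul f r) = smul f (row_matrix i r)" for i :: 'n and r s :: "'d qpoly ^ 'n" and f
    by (auto simp: row_matrix_def row_smul_def smul_def vec_eq_iff)
  then show ?thesis
    by (simp add: submodule_def row_module_def real_left_zero[OF N] real_left_add[OF N] real_left_smul[OF N])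
qed

lemma row_in_row_module:
  assumes "X \<in> N"
  shows "X $ j \<in> row_module"
proof -
  have "row_matrix i (X $ j) = (\<chi> k l. if k = i \<and> l = j then 1 else 0) ** X" for i :: 'n
  proof -
    have "(\<Sum>l\<in>UNIV. (if k = i \<and> l = j then 1 else 0) * X $ l $ c) =
        (\<Sum>l\<in>UNIV. if l = j then (if k = i then X $ j $ c else 0) else 0)" for k c
      by (intro sum.cong) auto
    then show ?thesis by (simp add: row_matrix_def matrix_matrix_mult_def vec_eq_iff)
  qed
  then show ?thesis using real_left_mult[OF N assms] by (simp add: row_module_def)
qed

lemma in_N_if_rows:
  assumes "\<And>i. X $ i \<in> row_module"
  shows "X \<in> N"
proof -
  have "X = (\<Sum>i\<in>UNIV. row_matrix i (X $ i))"
  proof (rule vec_eq_iff[THEN iffD2], rule allI)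
    fix k
    have "(\<Sum>i\<in>UNIV. row_matrix i (X $ i)) $ k = (\<Sum>i\<in>UNIV. if k = i then X $ i else 0)"
      by (simp add: row_matrix_def)
    then show "X $ k = (\<Sum>i\<in>UNIV. row_matrix i (X $ i)) $ k" by simp
  qed
  moreover have "(\<Sum>i\<in>UNIV. row_matrix i (X $ i)) \<in> N"
    using assms by (intro real_left_sum[OF N]) (simp add: row_module_def)
  ultimately show ?thesis by simp
qed

text \<open>The rows of \<open>adj C ** Q\<close> combine the rows of \<open>Q\<close> with
  conjugated entries of \<open>C\<close> as coefficients. These lie in \<open>PP\<close>, so
  \<open>adj C ** Q\<close> lies in \<open>N\<close>. Then \<open>adj C ** C\<close>, which is
  \<open>s\<close> times \<open>adj C ** Q\<close> minus \<open>adj C ** b\<close>, lies in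
  \<open>N\<close>, and by realness \<open>C\<close> does. So \<open>s Q = C + b\<close> lies in
  \<open>N\<close>, against \<open>s \<notin> p\<close>.\<close>

lemma no_multiple_modulo_PP:
  assumes s: "s \<notin> p" and b: "b \<in> N" and c: "\<And>i k. (smul (quat_poly s) Q - b) $ i $ k \<in> PP"
  shows False
proof -
  define C where "C = smul (quat_poly s) Q - b"
  have sub: "r + t \<in> row_module" "row_smul f r \<in> row_module" if "r \<in> row_module" "t \<in> row_module" for r t f
    using submodule_row_module that by (auto simp: submodule_def)
  have "adj C ** Q \<in> N"
  proof (rule in_N_if_rows)
    fix k
    have "(adj C ** Q) $ k = (\<Sum>i\<in>UNIV. row_smul (qpoly_star (C $ i $ k)) (Q $ i))"
      by (simp add: matrix_matrix_mult_def conj_transpose_def row_smul_def vec_eq_iff)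
    moreover have "row_smul (qpoly_star (C $ i $ k)) (Q $ i) \<in> row_module" for i
    proof -
      have "smul (qpoly_star (C $ i $ k)) Q \<in> N"
        using c PP_star unfolding C_def by (simp add: PP_def)
      from row_in_row_module[OF this, of i] show ?thesis by (simp add: smul_def row_smul_def)
    qed
    then have "(\<Sum>i\<in>A. row_smul (qpoly_star (C $ i $ k)) (Q $ i)) \<in> row_module" for A
      using submodule_row_module
      by (induction A rule: infinite_finite_induct) (auto simp: submodule_def)
    ultimately show "(adj C ** Q) $ k \<in> row_module" by simp
  qed
  from real_left_diff[OF N real_left_smul[OF N this] real_left_mult[OF N b]]
  have "smul (quat_poly s) (adj C ** Q) - adj C ** b \<in> N" .
  moreover have "adj C ** C = adj C ** (smul (quat_poly s) Q - b)" by (simp only: C_def)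
  ultimately have "adj C ** C \<in> N" by (simp only: matrix_diff_ldistrib mult_smul_quat_poly)
  then have "C \<in> N" by (rule adj_mult_self_in)
  then have "C + b \<in> N" using b real_left_add[OF N] by blast
  then show False using s by (simp add: C_def p_def PP_def)
qed

text \<open>Elimination is applied to each row of \<open>Q\<close>. If it never returns a vector,
  every row has a multiple that agrees modulo \<open>PP\<close> with a member of
  \<open>row_module\<close>; multiplied up to the common factor \<open>prod s UNIV\<close>, these
  members are the rows of a matrix in \<open>N\<close>, which \<open>no_multiple_modulo_PP\<close>
  excludes.\<close>

lemma separating_vector:
  "\<exists>v i. (\<forall>X\<in>N. \<forall>j. dot (X $ j) v \<in> PP) \<and> dot (Q $ i) v \<notin> PP"
proof (cases "\<exists>v i. (\<forall>m\<in>row_module. dot m v \<in> PP) \<and> dot (Q $ i) v \<notin> PP")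
  case True
  then show ?thesis using row_in_row_module by blast
next
  case False
  have "\<exists>s m. s \<notin> p \<and> m \<in> row_module \<and> (\<forall>k. quat_poly s * Q $ i $ k - m $ k \<in> PP)" for i
    using elimination[OF finite submodule_row_module, of UNIV "Q $ i"] False by blast
  then obtain s m where *: "\<And>i. s i \<notin> p" "\<And>i. m i \<in> row_module"
    "\<And>i k. quat_poly (s i) * Q $ i $ k - m i $ k \<in> PP" by metis
  define b where "b = (\<chi> i. row_smul (quat_poly (prod s (UNIV - {i}))) (m i))"
  have "b \<in> N"
    by (rule in_N_if_rows) (use submodule_row_module *(2) in \<open>simp add: b_def submodule_def\<close>)
  moreover have "(smul (quat_poly (prod s UNIV)) Q - b) $ i $ k \<in> PP" for i k
  proof -
    have "prod s UNIV = prod s (UNIV - {i}) * s i" by (subst prod.remove[of _ i]) (simp_all add: mult.commute)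
    then have "(smul (quat_poly (prod s UNIV)) Q - b) $ i $ k =
        quat_poly (prod s (UNIV - {i})) * (quat_poly (s i) * Q $ i $ k - m i $ k)"
      by (simp add: smul_def b_def row_smul_def quat_poly_mult right_diff_distrib mult.assoc)
    then show ?thesis using *(3) PP_mult_left by simp
  qed
  moreover have "prod s A \<notin> p" for A
    by (induction A rule: infinite_finite_induct) (auto simp: one_notin mult_in_iff *(1))
  ultimately show ?thesis using no_multiple_modulo_PP by blast
qed

end

section \<open>Evaluation at points and the two directions of the equivalence\<close>

section \<open>The Nullstellensatz\<close>

lemma qpoly_eval_sum: "qpoly_eval (sum f A) a = (\<Sum>i\<in>A. qpoly_eval (f i) a)"
  by (induction A rule: infinite_finite_induct) (simp_all add: qpoly_eval_zero qpoly_eval_add)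

lemma real_eval_sum: "real_eval (sum f A) a = (\<Sum>i\<in>A. real_eval (f i) a)"
  by (induction A rule: infinite_finite_induct) (simp_all add: real_eval_def[of 0] real_eval_add)

lemma sum_qcnj_eq_0:
  fixes y :: "'i \<Rightarrow> quat"
  assumes "finite A" "(\<Sum>i\<in>A. qcnj (y i) * y i) = 0" "i \<in> A"
  shows "y i = 0"
proof -
  have "of_real (\<Sum>i\<in>A. qnorm2 (y i)) = (0 :: quat)" using assms(2) by (simp add: qcnj_mult_self)
  then have "(\<Sum>i\<in>A. qnorm2 (y i)) = 0" by (simp only: of_real_eq_0_iff)
  then show ?thesis using assms(1,3) by (simp add: sum_nonneg_eq_0_iff qnorm2_nonneg qnorm2_eq_0_iff)
qed

text \<open>For realness the value of the sum of hermitian squares at \<open>v\<close> is paired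
  with the conjugate of \<open>v\<close>. The result is the sum of the squared norms of all
  components of the vectors \<open>b i\<close> applied to \<open>v\<close>, so each component is
  zero.\<close>

lemma real_left_vanishing:
  fixes a :: "real ^ 'd::finite" and v :: "quat ^ 'n"
  shows "real_left qpoly_star {X. qpoly_matrix_eval X a *v v = 0}"
  unfolding real_left_def
proof (intro conjI ballI allI impI)
  let ?J = "{X :: 'd qpoly ^ 'n ^ 'n. qpoly_matrix_eval X a *v v = 0}"
  have ev: "(qpoly_matrix_eval X a *v v) $ i = (\<Sum>j\<in>UNIV. qpoly_eval (X $ i $ j) a * v $ j)"
    for X :: "'d qpoly ^ 'n ^ 'n" and i
    by (simp add: matrix_vector_mult_def qpoly_matrix_eval_def)
  have ev_add: "qpoly_matrix_eval (X + Y) a *v v = qpoly_matrix_eval X a *v v + qpoly_matrix_eval Y a *v v"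
    for X Y :: "'d qpoly ^ 'n ^ 'n"
    by (simp add: vec_eq_iff ev qpoly_eval_add distrib_right sum.distrib)
  have ev_mult: "(qpoly_matrix_eval (X ** Y) a *v v) $ i =
      (\<Sum>k\<in>UNIV. qpoly_eval (X $ i $ k) a * (qpoly_matrix_eval Y a *v v) $ k)"
    for X Y :: "'d qpoly ^ 'n ^ 'n" and i
  proof -
    have "(qpoly_matrix_eval (X ** Y) a *v v) $ i =
        (\<Sum>j\<in>UNIV. \<Sum>k\<in>UNIV. qpoly_eval (X $ i $ k) a * (qpoly_eval (Y $ k $ j) a * v $ j))"
      by (simp add: ev matrix_matrix_mult_def qpoly_eval_sum qpoly_eval_mult sum_distrib_right mult.assoc)
    also have "\<dots> = (\<Sum>k\<in>UNIV. \<Sum>j\<in>UNIV. qpoly_eval (X $ i $ k) a * (qpoly_eval (Y $ k $ j) a * v $ j))"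
      by (rule sum.swap)
    finally show ?thesis by (simp add: ev sum_distrib_left)
  qed
  show zero: "0 \<in> ?J" by (simp add: vec_eq_iff ev qpoly_eval_zero)
  show "X + Y \<in> ?J" if "X \<in> ?J" "Y \<in> ?J" for X Y using that by (simp add: ev_add)
  show "A ** X \<in> ?J" if "X \<in> ?J" for A X using that by (simp add: vec_eq_iff ev_mult)
  fix k :: nat and b :: "nat \<Rightarrow> 'd qpoly ^ 'n ^ 'n" and i
  assume sum: "(\<Sum>i\<in>{1..k}. adj (b i) ** b i) \<in> ?J" and i: "i \<in> {1..k}"
  define y where "y i = qpoly_matrix_eval (b i) a *v v" for i
  have ev_sum: "qpoly_matrix_eval (sum X A) a *v v = (\<Sum>i\<in>A. qpoly_matrix_eval (X i) a *v v)"
    for X :: "nat \<Rightarrow> 'd qpoly ^ 'n ^ 'n" and A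
    using zero by (induction A rule: infinite_finite_induct) (simp_all add: ev_add)
  have qs: "qcnj (sum f A) = (\<Sum>i\<in>A. qcnj (f i))" for f :: "'n \<Rightarrow> quat" and A
    by (induction A rule: infinite_finite_induct) simp_all
  have "(\<Sum>l\<in>UNIV. qcnj (v $ l) * (qpoly_matrix_eval (adj (b i) ** b i) a *v v) $ l) =
      (\<Sum>c\<in>UNIV. qcnj (y i $ c) * y i $ c)" for i
  proof -
    have "(\<Sum>l\<in>UNIV. qcnj (v $ l) * (qpoly_matrix_eval (adj (b i) ** b i) a *v v) $ l) =
        (\<Sum>l\<in>UNIV. \<Sum>c\<in>UNIV. qcnj (v $ l) * (qcnj (qpoly_eval (b i $ c $ l) a) * y i $ c))"
      by (simp add: ev_mult y_def conj_transpose_def qpoly_eval_star sum_distrib_left)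
    also have "\<dots> = (\<Sum>c\<in>UNIV. \<Sum>l\<in>UNIV. qcnj (v $ l) * (qcnj (qpoly_eval (b i $ c $ l) a) * y i $ c))"
      by (rule sum.swap)
    also have "\<dots> = (\<Sum>c\<in>UNIV. qcnj (y i $ c) * y i $ c)"
      by (intro sum.cong refl) (simp add: y_def ev qs sum_distrib_right mult.assoc)
    finally show ?thesis .
  qed
  moreover have "(\<Sum>l\<in>UNIV. qcnj (v $ l) * (qpoly_matrix_eval (\<Sum>i\<in>{1..k}. adj (b i) ** b i) a *v v) $ l) =
      (\<Sum>i\<in>{1..k}. \<Sum>l\<in>UNIV. qcnj (v $ l) * (qpoly_matrix_eval (adj (b i) ** b i) a *v v) $ l)"
    unfolding ev_sum sum_component sum_distrib_left by (rule sum.swap)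
  ultimately have "(\<Sum>i\<in>{1..k}. \<Sum>c\<in>UNIV. qcnj (y i $ c) * y i $ c) = 0"
    using sum by simp
  then have "(\<Sum>(i, c)\<in>{1..k} \<times> UNIV. qcnj (y i $ c) * y i $ c) = 0"
    by (simp add: sum.cartesian_product)
  then have "y i $ c = 0" for c
    using sum_qcnj_eq_0[of "{1..k} \<times> UNIV" "\<lambda>(i, c). y i $ c" "(i, c)"] i by (simp add: case_prod_beta)
  then show "b i \<in> ?J" by (simp add: y_def vec_eq_iff)
qed

lemma (in prime_ideal_set) sum_in: "(\<And>i. i \<in> A \<Longrightarrow> f i \<in> p) \<Longrightarrow> sum f A \<in> p"
  by (induction A rule: infinite_finite_induct) (auto intro: zero_in add_in)

text \<open>All entries of the products of the \<open>P l\<close> with \<open>v\<close> lie in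
  \<open>PP\<close>, so their norms lie in \<open>p\<close>, and the sum \<open>h\<close> of these
  norms combines all equations into one. At a real zero of \<open>h\<close> at which the norm of
  \<open>dot (Q $ i) v\<close> is not zero, the value of \<open>v\<close> is the required
  vector.\<close>

lemma maximal_real_left_point:
  fixes P :: "nat \<Rightarrow> 'd::finite qpoly ^ 'n ^ 'n"
  assumes N: "maximal_real_left N Q" and P: "P ` {1..m} \<subseteq> N"
  obtains a v where "\<forall>l\<in>{1..m}. qpoly_matrix_eval (P l) a *v v = 0" "qpoly_matrix_eval Q a *v v \<noteq> 0"
proof -
  interpret maximal_real_left N Q by (rule N)
  obtain v i where v: "\<forall>X\<in>N. \<forall>j. dot (X $ j) v \<in> PP" "dot (Q $ i) v \<notin> PP"
    using separating_vector by blast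
  define h where "h = (\<Sum>l\<in>{1..m}. \<Sum>j\<in>UNIV. nrm (dot (P l $ j) v))"
  have "nrm (dot (P l $ j) v) \<in> p" if "l \<in> {1..m}" for l j
  proof -
    have "P l \<in> N" using P that by blast
    then show ?thesis using v(1) by (simp flip: PP_iff_nrm)
  qed
  then have "h \<in> p" unfolding h_def
    by (intro sum_in)
  moreover have "nrm (dot (Q $ i) v) \<notin> p" using v(2) by (simp add: PP_iff_nrm)
  ultimately obtain a where a: "real_eval h a = 0" "real_eval (nrm (dot (Q $ i) v)) a \<noteq> 0"
    using real_point[OF real_prime_ideal_axioms] by blast
  define w where "w = (\<chi> k. qpoly_eval (v $ k) a)"
  have ev: "(qpoly_matrix_eval X a *v w) $ j = qpoly_eval (dot (X $ j) v) a" for X :: "'d qpoly ^ 'n ^ 'n" and j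
    by (simp add: matrix_vector_mult_def qpoly_matrix_eval_def w_def dot_def qpoly_eval_sum qpoly_eval_mult)
  have "(\<Sum>l\<in>{1..m}. \<Sum>j\<in>UNIV. qnorm2 (qpoly_eval (dot (P l $ j) v) a)) = 0"
    using a(1) by (simp add: h_def real_eval_sum real_eval_nrm)
  then have "qnorm2 (qpoly_eval (dot (P l $ j) v) a) = 0" if "l \<in> {1..m}" for l j
    using that by (simp add: sum_nonneg_eq_0_iff sum_nonneg qnorm2_nonneg)
  then have "qpoly_matrix_eval (P l) a *v w = 0" if "l \<in> {1..m}" for l
    using that by (simp add: vec_eq_iff ev qnorm2_eq_0_iff)
  moreover have "(qpoly_matrix_eval Q a *v w) $ i \<noteq> 0"
    using a(2) by (simp add: ev real_eval_nrm qnorm2_eq_0_iff)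
  then have "qpoly_matrix_eval Q a *v w \<noteq> 0" by auto
  ultimately show ?thesis using that by blast
qed

theorem theorem5:
  fixes m :: nat
    and P :: "nat \<Rightarrow> 'd::finite qpoly ^ 'n ^ 'n"
    and Q :: "'d qpoly ^ 'n ^ 'n"
  assumes "1 \<le> m"
  shows "(\<forall>(a :: real ^ 'd) (v :: quat ^ 'n).
            (\<forall>i\<in>{1..m}. qpoly_matrix_eval (P i) a *v v = 0) \<longrightarrow>
            qpoly_matrix_eval Q a *v v = 0)
     \<longleftrightarrow> Q \<in> smallest_real_left_ideal matrix_ring (conj_transpose qpoly_star) (P ` {1..m})"
proof
  assume vanish: "\<forall>(a :: real ^ 'd) (v :: quat ^ 'n).
      (\<forall>i\<in>{1..m}. qpoly_matrix_eval (P i) a *v v = 0) \<longrightarrow> qpoly_matrix_eval Q a *v v = 0"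
  show "Q \<in> smallest_real_left_ideal matrix_ring (conj_transpose qpoly_star) (P ` {1..m})"
  proof (rule ccontr)
    assume "\<not> ?thesis"
    then obtain I where I: "real_left qpoly_star I" "P ` {1..m} \<subseteq> I" "Q \<notin> I"
      by (auto simp: smallest_real_left_ideal_def real_left_ideal_iff)
    obtain N where N: "real_left qpoly_star N" "I \<subseteq> N" "Q \<notin> N"
      "\<forall>J. real_left qpoly_star J \<longrightarrow> N \<subseteq> J \<longrightarrow> Q \<notin> J \<longrightarrow> J = N"
      using maximal_real_left_exists[OF I(1,3)] .
    have "maximal_real_left N Q" using N by (intro maximal_real_left.intro) simp_all
    from maximal_real_left_point[OF this subset_trans[OF I(2) N(2)]]
    obtain a v where "\<forall>l\<in>{1..m}. qpoly_matrix_eval (P l) a *v v = 0"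
      "qpoly_matrix_eval Q a *v v \<noteq> 0" .
    then show False using vanish by blast
  qed
next
  assume Q: "Q \<in> smallest_real_left_ideal matrix_ring (conj_transpose qpoly_star) (P ` {1..m})"
  show "\<forall>(a :: real ^ 'd) (v :: quat ^ 'n).
      (\<forall>i\<in>{1..m}. qpoly_matrix_eval (P i) a *v v = 0) \<longrightarrow> qpoly_matrix_eval Q a *v v = 0"
  proof (intro allI impI)
    fix a :: "real ^ 'd" and v :: "quat ^ 'n"
    assume "\<forall>i\<in>{1..m}. qpoly_matrix_eval (P i) a *v v = 0"
    then have "P ` {1..m} \<subseteq> {X. qpoly_matrix_eval X a *v v = 0}" by auto
    then have "Q \<in> {X. qpoly_matrix_eval X a *v v = 0}"
      using Q real_left_vanishing[of a v] unfolding smallest_real_left_ideal_def real_left_ideal_iff by blast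
    then show "qpoly_matrix_eval Q a *v v = 0" by simp
  qed
qed

end
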